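(* Let $f=(f_i)_{i\in I}$ be an expanding multi-map and let $G=\langle f_i:i\in I\rangle$. (The open set condition is not assumed.) Suppose that $\deg(f_{i_0})\ge2$ for some $i_0\in I$. Let $(c_i)_{i\in I}$ be negative real numbers and let the H\"older family $\psi=(\psi_i:f_i^{-1}(J(G))\to\mathbb R)_{i\in I}$ be given by $\psi_i(z)=c_i$ for each $z\in f_i^{-1}(J(G))$. Then $\alpha_-(\psi)=\alpha_+(\psi)$ if and only if there exist an automorphism $\varphi\in\mathrm{Aut}(\widehat{\mathbb C})$, complex numbers $(a_i)_{i\in I}$ and $\lambda\in\mathbb R$ such that for all $i\in I$, $$\varphi\circ f_i\circ\varphi^{-1}(z)=a_iz^{\pm\deg(f_i)}\quad\text{and}\quad\log\deg(f_i)=\lambda c_i.$$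
   Context: $\widehat{\mathbb C}$ is the Riemann sphere with spherical distance; $\|h'(z)\|$ is the norm of the derivative of a holomorphic map $h$ with respect to the spherical metric. $I$ is a finite set; $\mathrm{Rat}$ is the set of non-constant rational maps on $\widehat{\mathbb C}$. A multi-map is an element $f=(f_i)_{i\in I}\in\mathrm{Rat}^I$; it is always assumed non-exceptional, i.e. it is not the case that $\mathrm{card}(I)=1$ and the single map has degree $1$. $G=\langle f_i:i\in I\rangle=\{f_{i_1}\circ\dots\circ f_{i_n}:n\ge1,\ i_1,\dots,i_n\in I\}$. The Fatou set $F(G)$ is the set of $z$ having a neighbourhood on which $G$ is a normal family; the Julia set is $J(G)=\widehat{\mathbb C}\setminus F(G)$. For $\omega\in I^{\mathbb N}$ put $f_{\omega|_n}=f_{\omega_n}\circ\dots\circ f_{\omega_1}$; $J_\omega$ is the complement of the set of $z$ having a neighbourhood on which $(f_{\omega|_n})_{n\in\mathbb N}$ is normal. The skew product is $\tilde f(\omega,z)=(\sigma\omega,f_{\omega_1}(z))$ on $I^{\mathbb N}\times\widehat{\mathbb C}$, $\sigma$ the left shift. $J(\tilde f)$ is the closure of $\bigcup_{\omega}\{\omega\}\times J_\omega$ in $I^{\mathbb N}\times\widehat{\mathbb C}$ (product topology); it is $\tilde f$-invariant. $f$ is expanding if $J(\tilde f)\ne\emptyset$ and there are $C>0,\lambda'>1$ with $\|(f_{\omega|_n})'(z)\|\ge C(\lambda')^n$ for all $n\in\mathbb N$ and $(\omega,z)\in J(\tilde f)$. Put $\tilde\psi:J(\tilde f)\to\mathbb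 R$, $\tilde\psi(\omega,z)=\psi_{\omega_1}(z)$, and $S_n\tilde\psi=\sum_{k=0}^{n-1}\tilde\psi\circ\tilde f^k$. Let $\zeta_i(z)=-\log\|f_i'(z)\|$, with $\tilde\zeta$ defined likewise. For $\alpha\in\mathbb R$, $\mathcal F(\alpha,\psi)=\pi_{\widehat{\mathbb C}}(\{x\in J(\tilde f):\lim_n S_n\tilde\psi(x)/S_n\tilde\zeta(x)=\alpha\})$, where $\pi_{\widehat{\mathbb C}}:I^{\mathbb N}\times\widehat{\mathbb C}\to\widehat{\mathbb C}$ is the projection; $\alpha_-(\psi)$ and $\alpha_+(\psi)$ are the infimum and supremum of $\{\alpha\in\mathbb R:\mathcal F(\alpha,\psi)\ne\emptyset\}$. The sign in $z^{\pm\deg(f_i)}$ may depend on $i$. *)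

theory Defs
  imports "HOL-Complex_Analysis.Complex_Analysis" "HOL-Computational_Algebra.Polynomial_Factorial"
    "HOL-Computational_Algebra.Field_as_Ring"
begin

subsection \<open>The Riemann sphere with the spherical distance\<close>

datatype riemann_sphere = Fin complex | Infty

text \<open>Inverse stereographic projection onto the unit sphere of \<open>complex \<times> real\<close>.\<close>

fun stereo :: "riemann_sphere \<Rightarrow> complex \<times> real" where
  "stereo (Fin z) =
     ((2 / (1 + (cmod z)\<^sup>2)) *\<^sub>R z, ((cmod z)\<^sup>2 - 1) / ((cmod z)\<^sup>2 + 1))"
| "stereo Infty = (0, 1)"

lemma norm_stereo: "norm (stereo x) = 1"
proof (cases x)
  case (Fin z)
  define r where "r = (cmod z)\<^sup>2"
  have r: "r \<ge> 0" by (simp add: r_def)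
  have "(norm (stereo x))\<^sup>2 = ((2 / (1 + r)) * cmod z)\<^sup>2 + ((r - 1) / (r + 1))\<^sup>2"
    using r by (simp add: Fin norm_Pair r_def[symmetric] power_divide)
  also have "\<dots> = (4 * r + (r - 1)\<^sup>2) / (r + 1)\<^sup>2"
    by (simp add: power_mult_distrib power_divide r_def[symmetric] add_divide_distrib add.commute)
  also have "4 * r + (r - 1)\<^sup>2 = (r + 1)\<^sup>2"
    by (simp add: power2_eq_square algebra_simps)
  finally have "(norm (stereo x))\<^sup>2 = 1" using r by simp
  then show ?thesis using norm_ge_zero[of "stereo x"] by (simp add: power2_eq_1_iff)
qed (simp add: norm_Pair)

lemma stereo_inject: "stereo x = stereo y \<longleftrightarrow> x = y"
proof
  assume eq: "stereo x = stereo y"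
  have ne1: "(r - 1) / (r + 1) \<noteq> 1" if "r \<ge> 0" for r :: real
    using that by (auto simp: divide_simps)
  have inj: "r = s" if "r \<ge> 0" "s \<ge> 0" "(r - 1) / (r + 1) = (s - 1) / (s + 1)" for r s :: real
  proof -
    have "(r - 1) * (s + 1) = (s - 1) * (r + 1)"
      using that by (simp add: divide_simps)
    then show ?thesis by (simp add: algebra_simps)
  qed
  show "x = y"
  proof (cases x; cases y)
    fix z w assume xy: "x = Fin z" "y = Fin w"
    have n: "(cmod z)\<^sup>2 = (cmod w)\<^sup>2"
      using eq inj[of "(cmod z)\<^sup>2" "(cmod w)\<^sup>2"] by (simp add: xy)
    have pos: "1 + (cmod w)\<^sup>2 > 0" by (rule add_pos_nonneg) auto
    have "(2 / (1 + (cmod w)\<^sup>2)) *\<^sub>R z = (2 / (1 + (cmod w)\<^sup>2)) *\<^sub>R w"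
      using eq by (simp add: xy n)
    then show "x = y" using pos by (simp add: xy)
  next
    fix z assume xy: "x = Fin z" "y = Infty"
    show "x = y" using eq ne1[of "(cmod z)\<^sup>2"] by (simp add: xy)
  next
    fix z assume xy: "x = Infty" "y = Fin z"
    show "x = y" using eq ne1[of "(cmod z)\<^sup>2"] by (simp add: xy eq_commute[of 1])
  qed simp
qed simp

lemma arccos_inner_triangle:
  fixes a b c :: "'a::real_inner"
  assumes "norm a = 1" "norm b = 1" "norm c = 1"
  shows "arccos (inner a c) \<le> arccos (inner a b) + arccos (inner b c)"
proof -
  have bd: "\<bar>inner u v\<bar> \<le> 1" if "norm u = 1" "norm v = 1" for u v :: 'a
    using Cauchy_Schwarz_ineq2[of u v] that by simp
  define p where "p = inner a b"
  define q where "q = inner b c"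
  have p: "-1 \<le> p" "p \<le> 1" and q: "-1 \<le> q" "q \<le> 1"
    and ac: "-1 \<le> inner a c" "inner a c \<le> 1"
    using bd[of a b] bd[of b c] bd[of a c] assms by (auto simp: p_def q_def abs_le_iff)
  have sq: "inner a a = 1" "inner b b = 1" "inner c c = 1"
    using assms by (simp_all add: dot_square_norm)
  have n1: "(norm (a - p *\<^sub>R b))\<^sup>2 = 1 - p\<^sup>2" and n2: "(norm (c - q *\<^sub>R b))\<^sup>2 = 1 - q\<^sup>2"
    unfolding power2_norm_eq_inner
    by (simp_all add: inner_diff sq inner_commute p_def q_def power2_eq_square algebra_simps)
  have "inner (a - p *\<^sub>R b) (c - q *\<^sub>R b) = inner a c - p * q"
    by (simp add: inner_diff sq p_def q_def algebra_simps)
  moreover have "\<bar>inner (a - p *\<^sub>R b) (c - q *\<^sub>R b)\<bar> \<le> sqrt (1 - p\<^sup>2) * sqrt (1 - q\<^sup>2)"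
    using Cauchy_Schwarz_ineq2[of "a - p *\<^sub>R b" "c - q *\<^sub>R b"]
    by (simp flip: n1 n2)
  ultimately have key: "p * q - sqrt (1 - p\<^sup>2) * sqrt (1 - q\<^sup>2) \<le> inner a c"
    by linarith
  show ?thesis
  proof (cases "arccos p + arccos q \<le> pi")
    case True
    have "cos (arccos p + arccos q) \<le> inner a c"
      using key p q by (simp add: cos_add sin_arccos)
    moreover have "0 \<le> arccos p + arccos q" using arccos_lbound p q by (simp add: add_nonneg_nonneg)
    ultimately have "arccos (inner a c) \<le> arccos (cos (arccos p + arccos q))"
      using ac by (intro arccos_le_arccos) auto
    also have "\<dots> = arccos p + arccos q"
      using True \<open>0 \<le> arccos p + arccos q\<close> by (simp add: arccos_cos)
    finally show ?thesis by (simp add: p_def q_def)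
  next
    case False
    then show ?thesis using arccos_ubound[of "inner a c"] ac by (simp add: p_def q_def)
  qed
qed

instantiation riemann_sphere :: metric_space
begin

definition dist_riemann_sphere :: "riemann_sphere \<Rightarrow> riemann_sphere \<Rightarrow> real" where
  "dist_riemann_sphere x y = arccos (inner (stereo x) (stereo y))"

definition uniformity_riemann_sphere :: "(riemann_sphere \<times> riemann_sphere) filter" where
  "uniformity_riemann_sphere = (INF e\<in>{0 <..}. principal {(x, y). dist x y < e})"

definition open_riemann_sphere :: "riemann_sphere set \<Rightarrow> bool" where
  "open_riemann_sphere U \<longleftrightarrow>
     (\<forall>x\<in>U. eventually (\<lambda>(x', y). x' = x \<longrightarrow> y \<in> U) uniformity)"

instance
proof
  fix x y z :: riemann_sphere
  have bd: "-1 \<le> inner (stereo x) (stereo y)" "inner (stereo x) (stereo y) \<le> 1"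
    using Cauchy_Schwarz_ineq2[of "stereo x" "stereo y"] by (auto simp: norm_stereo abs_le_iff)
  show "dist x y = 0 \<longleftrightarrow> x = y"
  proof
    assume "dist x y = 0"
    then have "cos (arccos (inner (stereo x) (stereo y))) = cos 0"
      by (simp add: dist_riemann_sphere_def)
    then have "inner (stereo x) (stereo y) = 1" using bd by (simp add: cos_arccos)
    moreover have "inner (stereo u) (stereo u) = 1" for u
      by (simp add: dot_square_norm norm_stereo)
    ultimately have "inner (stereo x - stereo y) (stereo x - stereo y) = 0"
      by (simp add: inner_diff_left inner_diff_right inner_commute[of "stereo y"])
    then show "x = y" by (simp add: stereo_inject)
  next
    assume "x = y"
    then show "dist x y = 0"
      by (simp add: dist_riemann_sphere_def dot_square_norm norm_stereo)
  qed
  have "dist x y \<le> dist x z + dist z y"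
    unfolding dist_riemann_sphere_def
    by (rule arccos_inner_triangle) (simp_all add: norm_stereo)
  then show "dist x y \<le> dist x z + dist y z"
    by (simp add: dist_riemann_sphere_def inner_commute)
qed (simp_all add: uniformity_riemann_sphere_def open_riemann_sphere_def)

end

subsection \<open>Rational maps\<close>

definition sphere_quot :: "complex \<Rightarrow> complex \<Rightarrow> riemann_sphere" where
  "sphere_quot a b = (if b = 0 then Infty else Fin (a / b))"

text \<open>The map \<open>z \<mapsto> p(z) / q(z)\<close>; it is meant for \<open>p\<close> and \<open>q\<close> without common zero.\<close>

fun ratmap :: "complex poly \<Rightarrow> complex poly \<Rightarrow> riemann_sphere \<Rightarrow> riemann_sphere" where
  "ratmap p q (Fin z) = sphere_quot (poly p z) (poly q z)"
| "ratmap p q Infty =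
     (let n = max (degree p) (degree q) in sphere_quot (coeff p n) (coeff q n))"

definition Rat :: "(riemann_sphere \<Rightarrow> riemann_sphere) set" where
  "Rat = {ratmap p q | p q. coprime p q \<and> max (degree p) (degree q) \<ge> 1}"

definition rat_degree :: "(riemann_sphere \<Rightarrow> riemann_sphere) \<Rightarrow> nat" where
  "rat_degree h =
     (THE d. \<exists>p q. coprime p q \<and> h = ratmap p q \<and> d = max (degree p) (degree q))"

lemma ratmap_degree_unique:
  assumes "coprime p q" "coprime p' q'" and eq: "ratmap p q = ratmap p' q'"
  shows "max (degree p) (degree q) = max (degree p') (degree q')"
proof (cases "q = 0 \<or> q' = 0")
  case True
  have *: "q' = 0" if q: "q = 0" and e: "ratmap p q = ratmap p' q'" for p q p' q'
  proof -
    have "poly q' z = 0" for z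
      using fun_cong[OF e, of "Fin z"] by (simp add: q sphere_quot_def split: if_splits)
    then show ?thesis using poly_all_0_iff_0 by blast
  qed
  have "q = 0" "q' = 0" using True *[OF _ eq] *[OF _ eq[symmetric]] by auto
  then have "is_unit p" "is_unit p'" using assms by auto
  then have "degree p = 0" "degree p' = 0" by (auto dest: dvd_imp_degree_le)
  then show ?thesis using \<open>q = 0\<close> \<open>q' = 0\<close> by simp
next
  case False
  have "p * q' = p' * q"
  proof (rule ccontr)
    assume "p * q' \<noteq> p' * q"
    then have "(p * q' - p' * q) * (q * q') \<noteq> 0" using False by simp
    moreover have "poly ((p * q' - p' * q) * (q * q')) z = 0" for z
    proof (cases "poly q z = 0 \<or> poly q' z = 0")
      case False
      then have "poly p z / poly q z = poly p' z / poly q' z"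
        using fun_cong[OF eq, of "Fin z"] by (simp add: sphere_quot_def)
      then show ?thesis using False by (simp add: field_simps)
    qed auto
    ultimately show False using poly_all_0_iff_0 by blast
  qed
  then have pq: "p * q' = p' * q" .
  have "p dvd p' * q" "p' dvd p * q'" "q dvd p * q'" "q' dvd p' * q"
    using pq by (metis dvd_triv_left dvd_triv_right)+
  moreover have "coprime q p" "coprime q' p'"
    using assms(1,2) by (simp_all add: coprime_commute)
  ultimately have "p dvd p'" "p' dvd p" "q dvd q'" "q' dvd q"
    using assms(1,2) by (simp_all add: coprime_dvd_mult_left_iff coprime_dvd_mult_right_iff)
  moreover have "degree u = degree v" if "u dvd v" "v dvd u" for u v :: "complex poly"
    using that by (metis dvd_0_left_iff dvd_imp_degree_le le_antisym)
  ultimately show ?thesis by metis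
qed

lemma rat_degree_ratmap:
  assumes "coprime p q"
  shows "rat_degree (ratmap p q) = max (degree p) (degree q)"
  unfolding rat_degree_def
proof (rule the_equality)
  show "\<exists>p' q'. coprime p' q' \<and> ratmap p q = ratmap p' q' \<and>
      max (degree p) (degree q) = max (degree p') (degree q')"
    using assms by blast
  show "d = max (degree p) (degree q)"
    if "\<exists>p' q'. coprime p' q' \<and> ratmap p q = ratmap p' q' \<and> d = max (degree p') (degree q')" for d
    using that assms ratmap_degree_unique by metis
qed

text \<open>Invertible elements of the monoid of rational maps, i.e. the Moebius transformations.\<close>

definition Aut_sphere :: "(riemann_sphere \<Rightarrow> riemann_sphere) set" where
  "Aut_sphere = {\<phi> \<in> Rat. bij \<phi> \<and> inv \<phi> \<in> Rat}"

subsection \<open>Norm of the derivative in the spherical metric\<close>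

text \<open>The chart \<open>z \<mapsto> 1/z\<close> is an isometry of the spherical metric \<open>2 |dz| / (1 + |z|\<^sup>2)\<close>.
  Hence, reading \<open>h\<close> near \<open>x\<close> in the chart \<open>z\<close> or \<open>1/z\<close> on either side as a holomorphic function
  \<open>g\<close> near \<open>w\<close>, the norm is \<open>|g'(w)| (1 + |w|\<^sup>2) / (1 + |g w|\<^sup>2)\<close>.\<close>

fun sphere_inv :: "riemann_sphere \<Rightarrow> riemann_sphere" where
  "sphere_inv (Fin z) = sphere_quot 1 z"
| "sphere_inv Infty = Fin 0"

text \<open>The value at \<open>Infty\<close> is arbitrary.\<close>

fun to_complex :: "riemann_sphere \<Rightarrow> complex" where
  "to_complex (Fin z) = z"
| "to_complex Infty = 0"

definition chart_at :: "riemann_sphere \<Rightarrow> riemann_sphere \<Rightarrow> riemann_sphere" where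
  "chart_at x = (if x = Infty then sphere_inv else id)"

definition sph_deriv_norm :: "(riemann_sphere \<Rightarrow> riemann_sphere) \<Rightarrow> riemann_sphere \<Rightarrow> real" where
  "sph_deriv_norm h x =
     (let g = (\<lambda>u. to_complex (chart_at (h x) (h (chart_at x (Fin u)))));
          w = to_complex (chart_at x x)
      in cmod (deriv g w) * (1 + (cmod w)\<^sup>2) / (1 + (cmod (g w))\<^sup>2))"

subsection \<open>Normality, Fatou and Julia sets\<close>

definition normal_family_on ::
    "riemann_sphere set \<Rightarrow> (riemann_sphere \<Rightarrow> riemann_sphere) set \<Rightarrow> bool" where
  "normal_family_on U H \<longleftrightarrow>
     (\<forall>h. (\<forall>n::nat. h n \<in> H) \<longrightarrow>
        (\<exists>r g. strict_mono r \<and>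
           (\<forall>K. compact K \<and> K \<subseteq> U \<longrightarrow> uniform_limit K (\<lambda>n. h (r n)) g sequentially)))"

definition fatou :: "(riemann_sphere \<Rightarrow> riemann_sphere) set \<Rightarrow> riemann_sphere set" where
  "fatou H = {z. \<exists>U. open U \<and> z \<in> U \<and> normal_family_on U H}"

definition julia :: "(riemann_sphere \<Rightarrow> riemann_sphere) set \<Rightarrow> riemann_sphere set" where
  "julia H = - fatou H"

subsection \<open>Multi-maps\<close>

definition multi_map :: "('i::finite \<Rightarrow> riemann_sphere \<Rightarrow> riemann_sphere) \<Rightarrow> bool" where
  "multi_map f \<longleftrightarrow>
     (\<forall>i. f i \<in> Rat) \<and> \<not> (CARD('i) = 1 \<and> (\<forall>i. rat_degree (f i) = 1))"

definition semigroup_gen ::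
    "('i \<Rightarrow> riemann_sphere \<Rightarrow> riemann_sphere) \<Rightarrow> (riemann_sphere \<Rightarrow> riemann_sphere) set" where
  "semigroup_gen f = {foldr (\<lambda>i h. f i \<circ> h) is id | is. is \<noteq> []}"

text \<open>Words are indexed from \<open>0\<close>: \<open>word_comp f \<omega> n\<close> is
  \<open>f (\<omega> (n - 1)) \<circ> \<dots> \<circ> f (\<omega> 0)\<close>.\<close>

primrec word_comp ::
    "('i \<Rightarrow> riemann_sphere \<Rightarrow> riemann_sphere) \<Rightarrow> (nat \<Rightarrow> 'i) \<Rightarrow> nat \<Rightarrow> riemann_sphere \<Rightarrow> riemann_sphere"
  where
  "word_comp f \<omega> 0 = id"
| "word_comp f \<omega> (Suc n) = f (\<omega> n) \<circ> word_comp f \<omega> n"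

definition julia_fibre ::
    "('i \<Rightarrow> riemann_sphere \<Rightarrow> riemann_sphere) \<Rightarrow> (nat \<Rightarrow> 'i) \<Rightarrow> riemann_sphere set" where
  "julia_fibre f \<omega> = julia {word_comp f \<omega> n | n. n \<ge> 1}"

definition skew_product ::
    "('i \<Rightarrow> riemann_sphere \<Rightarrow> riemann_sphere) \<Rightarrow>
     (nat \<Rightarrow> 'i) \<times> riemann_sphere \<Rightarrow> (nat \<Rightarrow> 'i) \<times> riemann_sphere" where
  "skew_product f = (\<lambda>(\<omega>, z). (\<lambda>n. \<omega> (Suc n), f (\<omega> 0) z))"

definition skew_topology :: "((nat \<Rightarrow> 'i) \<times> riemann_sphere) topology" where
  "skew_topology =
     prod_topology (product_topology (\<lambda>_. discrete_topology UNIV) UNIV) euclidean"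

definition julia_skew ::
    "('i \<Rightarrow> riemann_sphere \<Rightarrow> riemann_sphere) \<Rightarrow> ((nat \<Rightarrow> 'i) \<times> riemann_sphere) set" where
  "julia_skew f = skew_topology closure_of (\<Union>\<omega>. {\<omega>} \<times> julia_fibre f \<omega>)"

definition expanding :: "('i \<Rightarrow> riemann_sphere \<Rightarrow> riemann_sphere) \<Rightarrow> bool" where
  "expanding f \<longleftrightarrow>
     julia_skew f \<noteq> {} \<and>
     (\<exists>C l. C > 0 \<and> l > 1 \<and>
        (\<forall>n\<ge>1. \<forall>(\<omega>, z)\<in>julia_skew f. sph_deriv_norm (word_comp f \<omega> n) z \<ge> C * l ^ n))"

subsection \<open>Multifractal level sets\<close>

text \<open>A family \<open>\<psi> i\<close>, defined on \<open>f i -` julia (semigroup_gen f)\<close>, is rendered by total functions;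
  on \<open>julia_skew f\<close> only the values on these domains are used.\<close>

definition lift_potential ::
    "('i \<Rightarrow> riemann_sphere \<Rightarrow> real) \<Rightarrow> (nat \<Rightarrow> 'i) \<times> riemann_sphere \<Rightarrow> real" where
  "lift_potential \<psi> = (\<lambda>(\<omega>, z). \<psi> (\<omega> 0) z)"

definition birkhoff_sum :: "('x \<Rightarrow> 'x) \<Rightarrow> nat \<Rightarrow> ('x \<Rightarrow> real) \<Rightarrow> 'x \<Rightarrow> real" where
  "birkhoff_sum T n u x = (\<Sum>k<n. u ((T ^^ k) x))"

definition geom_potential ::
    "('i \<Rightarrow> riemann_sphere \<Rightarrow> riemann_sphere) \<Rightarrow> 'i \<Rightarrow> riemann_sphere \<Rightarrow> real" where
  "geom_potential f i z = - ln (sph_deriv_norm (f i) z)"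

definition level_set ::
    "('i \<Rightarrow> riemann_sphere \<Rightarrow> riemann_sphere) \<Rightarrow> ('i \<Rightarrow> riemann_sphere \<Rightarrow> real) \<Rightarrow> real \<Rightarrow>
     riemann_sphere set" where
  "level_set f \<psi> \<alpha> = snd ` {x \<in> julia_skew f.
     (\<lambda>n. birkhoff_sum (skew_product f) n (lift_potential \<psi>) x
          / birkhoff_sum (skew_product f) n (lift_potential (geom_potential f)) x)
       \<longlonglongrightarrow> \<alpha>}"

text \<open>Infimum and supremum are taken in the extended reals, so that no convention for empty or
  unbounded sets of reals enters.\<close>

definition alpha_minus ::
    "('i \<Rightarrow> riemann_sphere \<Rightarrow> riemann_sphere) \<Rightarrow> ('i \<Rightarrow> riemann_sphere \<Rightarrow> real) \<Rightarrow> ereal" where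
  "alpha_minus f \<psi> = Inf (ereal ` {\<alpha>. level_set f \<psi> \<alpha> \<noteq> {}})"

definition alpha_plus ::
    "('i \<Rightarrow> riemann_sphere \<Rightarrow> riemann_sphere) \<Rightarrow> ('i \<Rightarrow> riemann_sphere \<Rightarrow> real) \<Rightarrow> ereal" where
  "alpha_plus f \<psi> = Sup (ereal ` {\<alpha>. level_set f \<psi> \<alpha> \<noteq> {}})"

end

theory Submission
  imports Defs "HOL-Computational_Algebra.Fundamental_Theorem_Algebra"
begin

text \<open>
  If there is only one level, then expansion forces the multiplier of every periodic point of a word \<open>g\<close> of
  degree at least two to be determined by the word: \<open>|(g ^^ n)' x| = |g' p| ^ n\<close> for a repelling fixed point
  \<open>p\<close> of \<open>g\<close> and all \<open>x\<close> of period \<open>n\<close> in the Julia set. Let \<open>\<phi>\<close> be the Koenigs linearisation at \<open>p\<close>, so that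
  \<open>\<phi> (lam * z) = g (\<phi> z)\<close>. Periodic points close to a homoclinic orbit show that \<open>\<phi>\<close> has the same spherical
  derivative at all its zeros \<open>w\<close> (taking \<open>p = 0\<close>), hence the germ \<open>j\<close> at \<open>0\<close> with \<open>j 0 = w\<close> and
  \<open>\<phi> \<circ> j = \<phi>\<close> has \<open>|j'| = 1\<close> at the points near \<open>0\<close> that \<open>\<phi>\<close> maps into the backward orbit
  of \<open>p\<close>, and this forces \<open>j\<close> to be an isometry of the plane.
  As \<open>g\<close> has no critical point in the Julia set, \<open>j\<close> is a translation, and the periods of \<open>\<phi>\<close>
  have rank one. So \<open>\<phi>\<close> descends to a map of the punctured plane, which extends to a Moebius transformation by
  the great Picard theorem, and it conjugates \<open>g\<close> to a power map with multiplier \<open>deg g\<close> at \<open>p\<close>. Applied to words of length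
  one and two, this gives the relation between \<open>c\<close> and the degrees, and it shows that all maps share their two
  critical points, which a single automorphism moves to \<open>0\<close> and \<open>\<infinity>\<close>.

  Conversely, power maps are homotheties of the metric \<open>|du| / |u|\<close>, which is comparable to the spherical
  metric on the Julia set, since no critical point lies there. Hence the two Birkhoff sums are proportional
  up to a bounded error.
\<close>

subsection \<open>Charts of the sphere\<close>

text \<open>On a cycle the Birkhoff quotient tends to the sum of the \<open>c\<close> over one
  period, divided by minus the logarithm of the multiplier. A single level thus makes this logarithm
  proportional to the period. Density of repelling cycles is not invoked: one fixed point comes from
  the holomorphic fixed point formula, as repelling or of multiplier 1. The iterates are not normal
  there, and expansion excludes 1. The other cycles are built explicitly next to homoclinic orbits.
  So rigidity sees the Julia set only as a closed backward invariant set that contains the fixed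
  point and no critical point. The identity |j'| = 1 is known only on a set invariant under division
  by \<open>lam\<close>, and \<open>lam\<close> may rotate by an irrational angle; leading
  coefficients are compared along powers at which the rotation recurs. Two competitors must be
  excluded. Periods of rank two, as for Lattes maps, would make \<phi> send the whole plane into the
  Julia set. A symmetry \<open>v - z\<close>, as for Chebyshev polynomials, would give \<phi> a
  critical point over the Julia set.\<close>

lemma sphere_inv_inv [simp]: "sphere_inv (sphere_inv x) = x"
  by (cases x) (auto simp: sphere_quot_def)

lemma stereo_sphere_inv: "stereo (sphere_inv x) = (cnj (fst (stereo x)), - snd (stereo x))"
proof (cases x)
  case (Fin z)
  show ?thesis
  proof (cases "z = 0")
    case False
    define r where "r = (cmod z)\<^sup>2"
    have r: "r > 0" using False by (simp add: r_def)
    have zz: "z * cnj z = of_real r" unfolding r_def by (metis complex_norm_square)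
    have "(2 / (1 + 1 / r)) *\<^sub>R (1 / z) = (2 / (1 + r)) *\<^sub>R cnj z"
    proof -
      have "1 / z = cnj z / of_real r" using zz False r by (simp add: field_simps)
      then have "(2 / (1 + 1 / r)) *\<^sub>R (1 / z) = of_real (2 / (1 + 1 / r) / r) * cnj z"
        by (simp add: scaleR_conv_of_real)
      also have "2 / (1 + 1 / r) / r = 2 / (1 + r)"
      proof -
        have "(1 + 1 / r) * r = 1 + r" using r by (simp add: distrib_right)
        then show ?thesis by (metis divide_divide_eq_left)
      qed
      finally show ?thesis by (simp add: scaleR_conv_of_real)
    qed
    moreover have "(1 / r - 1) / (1 / r + 1) = - ((r - 1) / (r + 1))"
      using r by (simp add: field_simps)
    ultimately show ?thesis
      using False by (simp add: Fin sphere_quot_def norm_divide power_divide flip: r_def)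
  qed (simp add: Fin sphere_quot_def)
qed simp

text \<open>The chord belonging to an arc of length \<open>d\<close> has length
  \<open>sqrt (2 - 2 * cos d)\<close>, so arcs and chords tend to 0 together. Limits on the sphere
  can then be computed in \<open>complex \<times> real\<close>.\<close>

lemma tendsto_sphere_iff:
  fixes f :: "'a \<Rightarrow> riemann_sphere"
  shows "(f \<longlongrightarrow> l) F \<longleftrightarrow> ((\<lambda>x. stereo (f x)) \<longlongrightarrow> stereo l) F"
proof
  have nn: "inner (stereo x) (stereo x) = 1" for x by (simp add: dot_square_norm norm_stereo)
  have bd: "-1 \<le> inner (stereo x) (stereo y) \<and> inner (stereo x) (stereo y) \<le> 1" for x y
    using Cauchy_Schwarz_ineq2[of "stereo x" "stereo y"] by (auto simp: norm_stereo abs_le_iff)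
  { assume "(f \<longlongrightarrow> l) F"
    then have "((\<lambda>x. dist (f x) l) \<longlongrightarrow> 0) F" by (rule tendsto_dist_iff[THEN iffD1])
    then have "((\<lambda>x. sqrt (2 - 2 * cos (dist (f x) l))) \<longlongrightarrow> sqrt (2 - 2 * cos 0)) F"
      by (intro tendsto_intros isCont_tendsto_compose[OF isCont_cos])
    moreover have "dist (stereo (f x)) (stereo l) = sqrt (2 - 2 * cos (dist (f x) l))" for x
      using bd[of "f x" l]
      by (simp add: dist_norm norm_eq_sqrt_inner inner_diff nn dist_riemann_sphere_def cos_arccos
          inner_commute)
    ultimately show "((\<lambda>x. stereo (f x)) \<longlongrightarrow> stereo l) F"
      by (subst tendsto_dist_iff) simp
  next
    assume "((\<lambda>x. stereo (f x)) \<longlongrightarrow> stereo l) F"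
    then have "((\<lambda>x. inner (stereo (f x)) (stereo l)) \<longlongrightarrow> inner (stereo l) (stereo l)) F"
      by (intro tendsto_intros)
    then have "((\<lambda>x. arccos (inner (stereo (f x)) (stereo l))) \<longlongrightarrow> arccos (inner (stereo l) (stereo l))) F"
      by (rule continuous_on_tendsto_compose[OF continuous_on_arccos']) (use bd in auto)
    then show "(f \<longlongrightarrow> l) F"
      by (subst tendsto_dist_iff) (simp add: dist_riemann_sphere_def nn)
  }
qed

lemma tendsto_Fin [tendsto_intros]:
  assumes "(f \<longlongrightarrow> l) F"
  shows "((\<lambda>x. Fin (f x)) \<longlongrightarrow> Fin l) F"
proof -
  have "1 + (cmod l)\<^sup>2 \<noteq> 0" "(cmod l)\<^sup>2 + 1 \<noteq> 0"
    using zero_le_power2[of "cmod l"] by linarith+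
  then show ?thesis unfolding tendsto_sphere_iff stereo.simps
    by (intro tendsto_intros assms)
qed

lemma to_complex_eq: "to_complex x = (1 / (1 - snd (stereo x))) *\<^sub>R fst (stereo x)"
proof (cases x)
  case (Fin z)
  define r where "r = (cmod z)\<^sup>2"
  have r: "r \<ge> 0" by (simp add: r_def)
  then have "1 / (1 - (r - 1) / (r + 1)) * (2 / (1 + r)) = 1" by (simp add: field_simps)
  then show ?thesis by (simp add: Fin flip: r_def)
qed simp

lemma snd_stereo_1: "snd (stereo x) = 1 \<longleftrightarrow> x = Infty"
proof (cases x)
  case (Fin z)
  have "(cmod z)\<^sup>2 + 1 > 0" by (simp add: add_nonneg_pos)
  then show ?thesis by (simp add: Fin divide_eq_eq)
qed simp

lemma tendsto_to_complex:
  assumes "(f \<longlongrightarrow> l) F" "l \<noteq> Infty"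
  shows "((\<lambda>x. to_complex (f x)) \<longlongrightarrow> to_complex l) F"
proof -
  have "1 - snd (stereo l) \<noteq> 0" using assms(2) by (simp add: snd_stereo_1)
  then show ?thesis unfolding to_complex_eq
    by (intro tendsto_intros assms(1)[unfolded tendsto_sphere_iff])
qed

lemma tendsto_sphere_inv [tendsto_intros]:
  "(f \<longlongrightarrow> l) F \<Longrightarrow> ((\<lambda>x. sphere_inv (f x)) \<longlongrightarrow> sphere_inv l) F"
  unfolding tendsto_sphere_iff stereo_sphere_inv by (intro tendsto_intros)

lemma chart_at_chart_at [simp]: "chart_at x (chart_at x y) = y"
  by (simp add: chart_at_def)

lemma tendsto_chart_at [tendsto_intros]:
  "(f \<longlongrightarrow> l) F \<Longrightarrow> ((\<lambda>x. chart_at y (f x)) \<longlongrightarrow> chart_at y l) F"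
  by (auto simp: chart_at_def intro: tendsto_sphere_inv)

lemma chart_at_self: "chart_at x x \<noteq> Infty"
  by (cases x) (auto simp: chart_at_def)

lemma Fin_to_complex: "x \<noteq> Infty \<Longrightarrow> Fin (to_complex x) = x"
  by (cases x) auto

lemma chart_at_point [simp]: "chart_at x (Fin (to_complex (chart_at x x))) = x"
  by (simp add: Fin_to_complex chart_at_self)

lemma open_Fin_image:
  assumes "open V"
  shows "open (Fin ` V)"
proof -
  have eq: "Fin ` V = to_complex -` V \<inter> - {Infty}"
    by (auto simp: image_iff) (metis Fin_to_complex)
  have "continuous_on (- {Infty}) to_complex"
    unfolding continuous_on_def
    by (auto intro!: tendsto_to_complex tendsto_ident_at)
  moreover have "open (- {Infty})" by (simp add: open_Compl)
  ultimately show ?thesis unfolding eq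
    using assms continuous_on_open_vimage by blast
qed

lemma continuous_chart_at: "continuous_on A (chart_at x)"
  unfolding continuous_on_def by (auto intro!: tendsto_chart_at tendsto_ident_at)

lemma continuous_Fin: "continuous_on A Fin"
  unfolding continuous_on_def by (auto intro!: tendsto_Fin tendsto_ident_at)

lemma continuous_sphere_inv: "continuous_on A sphere_inv"
  unfolding continuous_on_def by (auto intro!: tendsto_sphere_inv tendsto_ident_at)

lemma open_chart_image:
  assumes "open V"
  shows "open (chart_at x ` V)"
proof -
  have "chart_at x ` V = chart_at x -` V"
    by (auto simp: image_iff) (metis chart_at_chart_at)
  then show ?thesis
    using assms continuous_chart_at[of UNIV x] by (simp add: open_vimage)
qed

lemma compact_sphere: "compact (UNIV :: riemann_sphere set)"
proof -
  have "x \<in> Fin ` cball 0 1 \<union> sphere_inv ` Fin ` cball 0 1" for x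
  proof (cases x)
    case (Fin z)
    show ?thesis
    proof (cases "cmod z \<le> 1")
      case False
      then have "x = sphere_inv (Fin (1 / z))" "cmod (1 / z) \<le> 1"
        by (auto simp: Fin sphere_quot_def norm_divide divide_le_eq_1)
      then show ?thesis by force
    qed (auto simp: Fin)
  next
    case Infty
    then have "x = sphere_inv (Fin 0)" by (simp add: sphere_quot_def)
    then show ?thesis by force
  qed
  then have "UNIV = Fin ` cball 0 1 \<union> sphere_inv ` Fin ` cball 0 1" by blast
  then show ?thesis
    by (metis compact_Un compact_cball compact_continuous_image continuous_Fin continuous_sphere_inv)
qed

lemma tendsto_eventually_not_Infty:
  "(f \<longlongrightarrow> Fin z) F \<Longrightarrow> eventually (\<lambda>x. f x \<noteq> Infty) F"
  using tendsto_imp_eventually_ne by fastforce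

lemma eventually_nhds_isCont:
  fixes f :: "'a::t2_space \<Rightarrow> 'b::topological_space"
  assumes "isCont f z" "eventually P (nhds (f z))"
  shows "eventually (\<lambda>x. P (f x)) (nhds z)"
  using assms filterlim_iff isCont_def tendsto_at_iff_tendsto_nhds by blast

subsection \<open>Holomorphic maps into the sphere and their spherical derivative\<close>

text \<open>The chart \<open>c\<close> is not tied to \<open>H z\<close>: a germ may be presented by
  \<open>h\<close> or by its reciprocal, whichever is at hand. \<open>sph_repr\<close> is the
  canonical choice.\<close>

definition sph_holo :: "(complex \<Rightarrow> riemann_sphere) \<Rightarrow> complex \<Rightarrow> bool" where
  "sph_holo H z \<longleftrightarrow> (\<exists>h c. h analytic_on {z} \<and> c \<in> {id, sphere_inv} \<and>
     (\<forall>\<^sub>F u in nhds z. H u = c (Fin (h u))))"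

definition sph_repr :: "(complex \<Rightarrow> riemann_sphere) \<Rightarrow> complex \<Rightarrow> complex \<Rightarrow> complex" where
  "sph_repr H z = (\<lambda>u. to_complex (chart_at (H z) (H u)))"

text \<open>The classical spherical derivative of a meromorphic function: the source carries the
  Euclidean metric, and the factor 2 of the spherical one is dropped.\<close>

definition sd :: "(complex \<Rightarrow> riemann_sphere) \<Rightarrow> complex \<Rightarrow> real" where
  "sd H z = cmod (deriv (sph_repr H z) z) / (1 + (cmod (sph_repr H z z))\<^sup>2)"

text \<open>Everything reduces to one change of chart: replacing \<open>h\<close> by
  \<open>1 / h\<close> leaves \<open>|h'| / (1 + |h|^2)\<close> unchanged. Hence \<open>sd\<close>
  can be computed from any representative.\<close>

lemma sph_holoI:
  assumes "h analytic_on {z}" "c \<in> {id, sphere_inv}" "\<forall>\<^sub>F u in nhds z. H u = c (Fin (h u))"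
  shows sph_holo_intro: "sph_holo H z"
    and sph_holo_isCont: "isCont H z"
    and sph_repr_analytic: "sph_repr H z analytic_on {z}"
    and sph_repr_eventually: "\<forall>\<^sub>F u in nhds z. H u = chart_at (H z) (Fin (sph_repr H z u))"
    and sd_eq: "sd H z = cmod (deriv h z) / (1 + (cmod (h z))\<^sup>2)"
proof -
  show "sph_holo H z" using assms unfolding sph_holo_def by blast
  have hc: "(h \<longlongrightarrow> h z) (nhds z)"
    using analytic_at_imp_isCont[OF assms(1)] by (simp add: isCont_def tendsto_at_iff_tendsto_nhds)
  have Hz: "H z = c (Fin (h z))" using assms(3) by (rule eventually_nhds_x_imp_x)
  have "((\<lambda>u. c (Fin (h u))) \<longlongrightarrow> c (Fin (h z))) (nhds z)"
    using assms(2) hc by (auto intro!: tendsto_intros)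
  then have Hl: "(H \<longlongrightarrow> H z) (nhds z)"
    unfolding Hz by (rule Lim_transform_eventually) (use assms(3) in eventually_elim, simp)
  show cont: "isCont H z" using Hl by (simp add: isCont_def tendsto_at_iff_tendsto_nhds)
  have "((\<lambda>u. chart_at (H z) (H u)) \<longlongrightarrow> Fin (to_complex (chart_at (H z) (H z)))) (nhds z)"
    by (subst Fin_to_complex[OF chart_at_self]) (intro tendsto_intros Hl)
  from tendsto_eventually_not_Infty[OF this]
  show "\<forall>\<^sub>F u in nhds z. H u = chart_at (H z) (Fin (sph_repr H z u))"
    by eventually_elim (simp add: sph_repr_def Fin_to_complex)
  have der: "h field_differentiable at z"
    using assms(1) by (simp add: analytic_on_imp_differentiable_at)
  consider "c = chart_at (H z)" | "h z \<noteq> 0" "\<forall>\<^sub>F u in nhds z. sph_repr H z u = 1 / h u"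
  proof (cases "c = chart_at (H z)")
    case False
    have hz: "h z \<noteq> 0"
      using False assms(2) by (auto simp: Hz chart_at_def sphere_quot_def split: if_splits)
    have "\<forall>\<^sub>F u in nhds z. h u \<noteq> 0" using hc hz by (rule tendsto_imp_eventually_ne)
    then have "\<forall>\<^sub>F u in nhds z. sph_repr H z u = 1 / h u"
      using assms(3)
    proof eventually_elim
      case (elim u)
      have "c = id \<Longrightarrow> False" using False hz by (auto simp: Hz chart_at_def)
      then have "c = sphere_inv" using assms(2) by auto
      then show ?case using elim hz by (simp add: sph_repr_def Hz chart_at_def sphere_quot_def)
    qed
    with hz that(2) show ?thesis by blast
  qed (use that in blast)
  then have "sph_repr H z analytic_on {z} \<and> sd H z = cmod (deriv h z) / (1 + (cmod (h z))\<^sup>2)"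
  proof cases
    case 1
    have ev: "\<forall>\<^sub>F u in nhds z. sph_repr H z u = h u"
      using assms(3) unfolding 1 by eventually_elim (simp add: sph_repr_def)
    from ev have "sph_repr H z z = h z" by (rule eventually_nhds_x_imp_x)
    with ev show ?thesis
      using assms(1) analytic_at_cong[OF ev refl] by (simp add: sd_def deriv_cong_ev[OF ev refl])
  next
    case 2
    have z: "sph_repr H z z = 1 / h z" using 2(2) by (rule eventually_nhds_x_imp_x)
    have an: "(\<lambda>u. 1 / h u) analytic_on {z}" using assms(1) 2(1) by (intro analytic_intros) auto
    have d: "deriv (\<lambda>u. 1 / h u) z = - deriv h z / (h z)\<^sup>2"
      using field_differentiable_derivI[OF der] 2(1)
      by (intro DERIV_imp_deriv) (auto intro!: derivative_eq_intros simp: power2_eq_square)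
    have "sd H z = cmod (deriv h z) / (cmod (h z))\<^sup>2 / (1 + 1 / (cmod (h z))\<^sup>2)"
      by (simp add: sd_def z deriv_cong_ev[OF 2(2) refl] d norm_divide norm_power power_divide)
    also have "\<dots> = cmod (deriv h z) / (1 + (cmod (h z))\<^sup>2)"
      using 2(1) by (simp add: field_simps)
    finally show ?thesis using an analytic_at_cong[OF 2(2) refl] by simp
  qed
  then show "sph_repr H z analytic_on {z}" "sd H z = cmod (deriv h z) / (1 + (cmod (h z))\<^sup>2)"
    by auto
qed

lemma sph_holoE:
  assumes "sph_holo H z"
  obtains h where "h analytic_on {z}" "\<forall>\<^sub>F u in nhds z. H u = chart_at (H z) (Fin (h u))"
    "h = sph_repr H z" "h z = to_complex (chart_at (H z) (H z))"
proof -
  obtain h c where h: "h analytic_on {z}" "c \<in> {id, sphere_inv}" "\<forall>\<^sub>F u in nhds z. H u = c (Fin (h u))"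
    using assms unfolding sph_holo_def by blast
  show ?thesis
    using that[OF sph_repr_analytic[OF h] sph_repr_eventually[OF h] refl] by (simp add: sph_repr_def)
qed

lemma chart_at_cases: "chart_at x \<in> {id, sphere_inv}"
  by (simp add: chart_at_def)

lemma sph_holo_imp_isCont: "sph_holo H z \<Longrightarrow> isCont H z"
  by (metis sph_holo_def sph_holo_isCont)

lemma sph_holo_cong:
  assumes "\<forall>\<^sub>F u in nhds z. H u = G u"
  shows "sph_holo H z \<longleftrightarrow> sph_holo G z" and "sd H z = sd G z"
proof -
  have z: "H z = G z" using assms by (rule eventually_nhds_x_imp_x)
  have *: "sph_holo G z" if "sph_holo H z" "\<forall>\<^sub>F u in nhds z. H u = G u" for H G
  proof -
    from that(1) obtain h where h: "h analytic_on {z}" "\<forall>\<^sub>F u in nhds z. H u = chart_at (H z) (Fin (h u))"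
      by (rule sph_holoE)
    from h(2) that(2) have "\<forall>\<^sub>F u in nhds z. G u = chart_at (H z) (Fin (h u))"
      by eventually_elim simp
    with h(1) show ?thesis by (intro sph_holo_intro[OF _ chart_at_cases])
  qed
  from assms have "\<forall>\<^sub>F u in nhds z. G u = H u" by eventually_elim simp
  with assms * show "sph_holo H z \<longleftrightarrow> sph_holo G z" by blast
  have ev: "\<forall>\<^sub>F u in nhds z. sph_repr H z u = sph_repr G z u"
    using assms by eventually_elim (simp add: sph_repr_def z)
  then show "sd H z = sd G z"
    by (simp add: sd_def deriv_cong_ev[OF ev refl] eventually_nhds_x_imp_x[OF ev])
qed

lemma sph_holo_compose_analytic:
  assumes "k analytic_on {z}" "sph_holo H (k z)"
  shows "sph_holo (\<lambda>u. H (k u)) z" and "sd (\<lambda>u. H (k u)) z = sd H (k z) * cmod (deriv k z)"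
proof -
  from assms(2) obtain h where h: "h analytic_on {k z}" "\<forall>\<^sub>F u in nhds (k z). H u = chart_at (H (k z)) (Fin (h u))"
    by (rule sph_holoE)
  have an: "(\<lambda>u. h (k u)) analytic_on {z}"
    using analytic_on_compose[OF assms(1), of h] h(1) by (simp add: o_def)
  have ev: "\<forall>\<^sub>F u in nhds z. H (k u) = chart_at (H (k z)) (Fin (h (k u)))"
    by (rule eventually_nhds_isCont[OF analytic_at_imp_isCont[OF assms(1)] h(2)])
  show "sph_holo (\<lambda>u. H (k u)) z" by (rule sph_holo_intro[OF an chart_at_cases ev])
  have "deriv (h \<circ> k) z = deriv h (k z) * deriv k z"
    using assms(1) h(1) by (intro deriv_chain analytic_on_imp_differentiable_at) auto
  then show "sd (\<lambda>u. H (k u)) z = sd H (k z) * cmod (deriv k z)"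
    by (simp add: sd_eq[OF an chart_at_cases ev] sd_eq[OF h(1) chart_at_cases h(2)] o_def norm_mult)
qed

definition sph_map_at :: "(riemann_sphere \<Rightarrow> riemann_sphere) \<Rightarrow> riemann_sphere \<Rightarrow> bool" where
  "sph_map_at g x \<longleftrightarrow> sph_holo (\<lambda>u. g (chart_at x (Fin u))) (to_complex (chart_at x x))"

lemma sph_deriv_norm_eq_sd:
  "sph_deriv_norm g x = (1 + (cmod (to_complex (chart_at x x)))\<^sup>2) *
     sd (\<lambda>u. g (chart_at x (Fin u))) (to_complex (chart_at x x))"
  unfolding sph_deriv_norm_def sd_def sph_repr_def Let_def by simp

lemma sph_deriv_norm_nonneg: "sph_deriv_norm g x \<ge> 0"
  unfolding sph_deriv_norm_def Let_def by (simp add: add_nonneg_nonneg)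

lemma sd_nonneg: "sd H z \<ge> 0"
  unfolding sd_def by (simp add: add_nonneg_nonneg)

lemma sph_holo_compose:
  assumes "sph_holo H z" "sph_map_at g (H z)"
  shows "sph_holo (\<lambda>u. g (H u)) z" and "sd (\<lambda>u. g (H u)) z = sph_deriv_norm g (H z) * sd H z"
proof -
  from assms(1) obtain h where h: "h analytic_on {z}" "\<forall>\<^sub>F u in nhds z. H u = chart_at (H z) (Fin (h u))"
     "h z = to_complex (chart_at (H z) (H z))"
    by (rule sph_holoE)
  let ?G = "\<lambda>u. g (chart_at (H z) (Fin u))"
  have ev: "\<forall>\<^sub>F u in nhds z. g (H u) = ?G (h u)"
    using h(2) by eventually_elim (erule arg_cong)
  have G: "sph_holo ?G (h z)" using assms(2) by (simp add: sph_map_at_def h(3))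
  show "sph_holo (\<lambda>u. g (H u)) z"
    using sph_holo_compose_analytic(1)[OF h(1) G] sph_holo_cong(1)[OF ev] by simp
  have "1 + (cmod (h z))\<^sup>2 > 0" by (simp add: add_pos_nonneg)
  then have "sph_deriv_norm g (H z) * sd H z = sd ?G (h z) * cmod (deriv h z)"
    by (simp add: sph_deriv_norm_eq_sd sd_eq[OF h(1) chart_at_cases h(2)] flip: h(3))
  then show "sd (\<lambda>u. g (H u)) z = sph_deriv_norm g (H z) * sd H z"
    by (simp add: sph_holo_cong(2)[OF ev] sph_holo_compose_analytic(2)[OF h(1) G])
qed

lemma sph_map_at_comp:
  assumes "sph_map_at h x" "sph_map_at g (h x)"
  shows "sph_map_at (g \<circ> h) x"
    and "sph_deriv_norm (g \<circ> h) x = sph_deriv_norm g (h x) * sph_deriv_norm h x"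
  using sph_holo_compose[of "\<lambda>u. h (chart_at x (Fin u))" "to_complex (chart_at x x)" g] assms
  by (auto simp: sph_map_at_def sph_deriv_norm_eq_sd)

lemma sph_map_at_imp_isCont:
  assumes "sph_map_at g x"
  shows "isCont g x"
proof -
  let ?w = "to_complex (chart_at x x)" and ?k = "\<lambda>y. to_complex (chart_at x y)"
  have "isCont (\<lambda>u. g (chart_at x (Fin u))) ?w"
    using assms by (simp add: sph_map_at_def sph_holo_imp_isCont)
  moreover have k: "(?k \<longlongrightarrow> ?w) (nhds x)"
    by (intro tendsto_to_complex tendsto_intros chart_at_self filterlim_ident)
  ultimately have lim: "((\<lambda>y. g (chart_at x (Fin (?k y)))) \<longlongrightarrow> g (chart_at x (Fin ?w))) (nhds x)"
    by (rule isCont_tendsto_compose)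
  have "((\<lambda>y. chart_at x y) \<longlongrightarrow> Fin ?w) (nhds x)"
    by (subst Fin_to_complex[OF chart_at_self]) (intro tendsto_intros filterlim_ident)
  then have "\<forall>\<^sub>F y in nhds x. g (chart_at x (Fin (?k y))) = g y"
    by (rule tendsto_eventually_not_Infty[THEN eventually_mono]) (simp add: Fin_to_complex)
  from Lim_transform_eventually[OF lim this]
  show ?thesis by (simp add: isCont_def tendsto_at_iff_tendsto_nhds)
qed

text \<open>The chart in \<open>sd H u\<close> jumps with \<open>H u\<close>; by
  \<open>sd_eq\<close> one fixed representative near \<open>z\<close> computes all the
  values.\<close>

lemma isCont_sd:
  assumes "sph_holo H z"
  shows "isCont (sd H) z"
proof -
  from assms obtain h where h: "h analytic_on {z}" "\<forall>\<^sub>F u in nhds z. H u = chart_at (H z) (Fin (h u))"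
    by (rule sph_holoE)
  obtain S where S: "open S" "z \<in> S" "h holomorphic_on S" using h(1) analytic_at by blast
  have "\<forall>\<^sub>F u in nhds z. u \<in> S" using S eventually_nhds by blast
  moreover have "\<forall>\<^sub>F u in nhds z. \<forall>\<^sub>F v in nhds u. H v = chart_at (H z) (Fin (h v))"
    using h(2) by (simp add: eventually_eventually)
  ultimately have ev: "\<forall>\<^sub>F u in nhds z. sd H u = cmod (deriv h u) / (1 + (cmod (h u))\<^sup>2)"
  proof eventually_elim
    case (elim u)
    have "h analytic_on {u}" using S elim(1) by (simp add: holomorphic_on_imp_analytic_at)
    then show ?case by (rule sd_eq[OF _ chart_at_cases elim(2)])
  qed
  have "isCont (deriv h) z"
    by (meson S analytic_at analytic_at_imp_isCont holomorphic_deriv)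
  moreover have "1 + (cmod (h z))\<^sup>2 \<noteq> 0"
    using zero_le_power2[of "cmod (h z)"] by linarith
  ultimately have "isCont (\<lambda>u. cmod (deriv h u) / (1 + (cmod (h u))\<^sup>2)) z"
    using analytic_at_imp_isCont[OF h(1)] by (intro continuous_intros)
  then show ?thesis using isCont_cong[OF ev] by simp
qed

subsection \<open>Rational maps in homogeneous coordinates\<close>

text \<open>The homogenisation of \<open>P\<close> in degree \<open>n\<close>, at the point with
  homogeneous coordinates \<open>a : b\<close>. It puts \<open>Infty\<close> on the same footing as
  the other points and turns composition of rational maps into substitution.\<close>

definition hom_eval :: "nat \<Rightarrow> complex poly \<Rightarrow> complex \<Rightarrow> complex \<Rightarrow> complex" where
  "hom_eval n P a b = (\<Sum>i\<le>n. coeff P i * a ^ i * b ^ (n - i))"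

definition hom_subst :: "nat \<Rightarrow> complex poly \<Rightarrow> complex poly \<Rightarrow> complex poly \<Rightarrow> complex poly" where
  "hom_subst n P A B = (\<Sum>i\<le>n. smult (coeff P i) (A ^ i * B ^ (n - i)))"

lemma poly_hom_subst: "poly (hom_subst n P A B) z = hom_eval n P (poly A z) (poly B z)"
  by (simp add: hom_subst_def hom_eval_def poly_sum mult.assoc)

lemma hom_eval_dehom:
  assumes "degree P \<le> n" "b \<noteq> 0"
  shows "hom_eval n P a b = b ^ n * poly P (a / b)"
proof -
  have "poly P (a / b) = (\<Sum>i\<le>n. coeff P i * (a / b) ^ i)"
    unfolding poly_altdef using assms(1)
    by (intro sum.mono_neutral_left) (auto simp: coeff_eq_0)
  moreover have "coeff P i * a ^ i * b ^ (n - i) = b ^ n * (coeff P i * (a / b) ^ i)" if "i \<le> n" for i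
  proof -
    have "b ^ n = b ^ i * b ^ (n - i)" using that by (simp flip: power_add)
    then show ?thesis using assms(2) by (simp add: power_divide)
  qed
  then have "hom_eval n P a b = (\<Sum>i\<le>n. b ^ n * (coeff P i * (a / b) ^ i))"
    unfolding hom_eval_def by (intro sum.cong) auto
  ultimately show ?thesis by (simp only: sum_distrib_left)
qed

lemma hom_eval_at_infinity: "hom_eval n P a 0 = coeff P n * a ^ n"
proof -
  have "hom_eval n P a 0 = (\<Sum>i\<in>{..n}. if i = n then coeff P n * a ^ n else 0)"
    unfolding hom_eval_def by (rule sum.cong) (auto simp: power_0_left)
  then show ?thesis by simp
qed

lemma sphere_quot_scale: "c \<noteq> 0 \<Longrightarrow> sphere_quot (c * a) (c * b) = sphere_quot a b"
  by (simp add: sphere_quot_def)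

lemma sphere_quot_cases:
  obtains a b where "x = sphere_quot a b" "a \<noteq> 0 \<or> b \<noteq> 0"
proof (cases x)
  case (Fin z)
  then show ?thesis using that[of z 1] by (simp add: sphere_quot_def)
next
  case Infty
  then show ?thesis using that[of 1 0] by (simp add: sphere_quot_def)
qed

lemma sphere_quot_eq_iff:
  assumes "a \<noteq> 0 \<or> b \<noteq> 0" "a' \<noteq> 0 \<or> b' \<noteq> 0"
  shows "sphere_quot a b = sphere_quot a' b' \<longleftrightarrow> a * b' = a' * b"
  using assms by (auto simp: sphere_quot_def field_simps)

lemma ratmap_sphere_quot:
  assumes "a \<noteq> 0 \<or> b \<noteq> 0" "n = max (degree P) (degree Q)"
  shows "ratmap P Q (sphere_quot a b) = sphere_quot (hom_eval n P a b) (hom_eval n Q a b)"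
proof (cases "b = 0")
  case True
  then have "a \<noteq> 0" using assms by simp
  then have "sphere_quot (a ^ n * coeff P n) (a ^ n * coeff Q n) = sphere_quot (coeff P n) (coeff Q n)"
    by (intro sphere_quot_scale) simp
  then show ?thesis
    using True assms(2) by (simp add: hom_eval_at_infinity sphere_quot_def[of a] Let_def mult.commute)
next
  case False
  then show ?thesis
    using assms(2) by (simp add: hom_eval_dehom sphere_quot_scale sphere_quot_def[of a])
qed

lemma coprime_no_common_root:
  fixes P Q :: "complex poly"
  assumes "coprime P Q"
  shows "poly P z \<noteq> 0 \<or> poly Q z \<noteq> 0"
proof (rule ccontr)
  assume "\<not> ?thesis"
  then have "[:-z, 1:] dvd P" "[:-z, 1:] dvd Q" by (simp_all add: poly_eq_0_iff_dvd)
  then have "is_unit [:-z, 1:]" using assms by (metis coprime_common_divisor)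
  then have "degree [:-z, 1:] = 0" by (simp add: is_unit_iff_degree)
  then show False by simp
qed

lemma ex_poly_root:
  fixes p :: "complex poly"
  assumes "degree p \<noteq> 0"
  obtains z where "poly p z = 0"
proof -
  have "\<exists>z. poly p z = 0" using assms alg_closed_imp_poly_has_root[of p] by auto
  then show ?thesis using that by blast
qed

lemma coprime_complex_polyI:
  fixes P Q :: "complex poly"
  assumes "P \<noteq> 0 \<or> Q \<noteq> 0" "\<And>z. poly P z \<noteq> 0 \<or> poly Q z \<noteq> 0"
  shows "coprime P Q"
proof (rule coprimeI)
  fix c assume c: "c dvd P" "c dvd Q"
  then have "c \<noteq> 0" using assms(1) by auto
  moreover have "degree c = 0"
  proof (rule ccontr)
    assume "degree c \<noteq> 0"
    then obtain z where "poly c z = 0" by (rule ex_poly_root)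
    then have "poly P z = 0" "poly Q z = 0" using c by (auto elim!: dvdE)
    then show False using assms(2) by blast
  qed
  ultimately show "is_unit c" by (simp add: is_unit_iff_degree)
qed

lemma hom_eval_nonzero:
  assumes "coprime P Q" "n = max (degree P) (degree Q)" "n \<ge> 1" "a \<noteq> 0 \<or> b \<noteq> 0"
  shows "hom_eval n P a b \<noteq> 0 \<or> hom_eval n Q a b \<noteq> 0"
proof (cases "b = 0")
  case True
  have "coeff P n \<noteq> 0 \<or> coeff Q n \<noteq> 0"
    using assms(2,3) by (metis leading_coeff_0_iff max_def degree_0 not_one_le_zero)
  then show ?thesis using True assms(4) by (auto simp: hom_eval_at_infinity)
next
  case False
  then show ?thesis
    using assms coprime_no_common_root[OF assms(1), of "a / b"] by (auto simp: hom_eval_dehom)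
qed

lemma RatE:
  assumes "g \<in> Rat"
  obtains P Q n where "g = ratmap P Q" "coprime P Q" "n = max (degree P) (degree Q)" "n \<ge> 1"
    "rat_degree g = n"
  using assms rat_degree_ratmap unfolding Rat_def by blast

lemma RatI: "coprime P Q \<Longrightarrow> max (degree P) (degree Q) \<ge> 1 \<Longrightarrow> ratmap P Q \<in> Rat"
  unfolding Rat_def by blast

lemma coeff_mult_degree_le:
  fixes A B :: "'a::comm_semiring_0 poly"
  assumes "degree A \<le> m" "degree B \<le> k"
  shows "coeff (A * B) (m + k) = coeff A m * coeff B k"
proof -
  have "coeff (A * B) (m + k) = (\<Sum>i\<le>m + k. if i = m then coeff A m * coeff B k else 0)"
    unfolding coeff_mult
  proof (rule sum.cong)
    fix i assume "i \<in> {..m + k}"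
    show "coeff A i * coeff B (m + k - i) = (if i = m then coeff A m * coeff B k else 0)"
    proof (cases "i < m")
      case True
      then have "coeff B (m + k - i) = 0" using assms(2) by (intro coeff_eq_0) linarith
      then show ?thesis using True by simp
    next
      case False
      show ?thesis
      proof (cases "i = m")
        case False
        with \<open>\<not> i < m\<close> have "coeff A i = 0" using assms(1) by (intro coeff_eq_0) linarith
        then show ?thesis using False by simp
      qed simp
    qed
  qed simp
  then show ?thesis by simp
qed

lemma coeff_power_degree_le:
  fixes A :: "'a::comm_semiring_1 poly"
  assumes "degree A \<le> m"
  shows "coeff (A ^ i) (i * m) = coeff A m ^ i \<and> degree (A ^ i) \<le> i * m"
proof (induction i)
  case (Suc i)
  then have "coeff (A * A ^ i) (m + i * m) = coeff A m * coeff (A ^ i) (i * m)"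
    using assms by (intro coeff_mult_degree_le) auto
  moreover have "degree (A * A ^ i) \<le> m + i * m"
    using degree_mult_le[of A "A ^ i"] Suc assms by linarith
  ultimately show ?case using Suc by simp
qed simp

lemma hom_subst_degree:
  assumes "degree A \<le> m" "degree B \<le> m"
  shows "degree (hom_subst n P A B) \<le> n * m"
    and "coeff (hom_subst n P A B) (n * m) = hom_eval n P (coeff A m) (coeff B m)"
proof -
  have *: "degree (A ^ i * B ^ (n - i)) \<le> n * m \<and>
    coeff (A ^ i * B ^ (n - i)) (n * m) = coeff A m ^ i * coeff B m ^ (n - i)" if "i \<le> n" for i
  proof -
    have nm: "n * m = i * m + (n - i) * m" using that by (simp flip: distrib_right)
    show ?thesis unfolding nm
      using coeff_power_degree_le[OF assms(1), of i] coeff_power_degree_le[OF assms(2), of "n - i"]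
        degree_mult_le[of "A ^ i" "B ^ (n - i)"] by (auto simp: coeff_mult_degree_le)
  qed
  show "degree (hom_subst n P A B) \<le> n * m" unfolding hom_subst_def
    using * by (intro degree_sum_le) (auto intro: order_trans[OF degree_smult_le])
  show "coeff (hom_subst n P A B) (n * m) = hom_eval n P (coeff A m) (coeff B m)"
    unfolding hom_subst_def hom_eval_def using * by (simp add: coeff_sum mult.assoc)
qed

text \<open>Substituting a pair of forms without common zero into another such pair creates no
  common zero. The degree is exactly \<open>n * m\<close> because the coefficients in that degree
  are the values of the outer forms at the image of \<open>Infty\<close>, which do not both
  vanish.\<close>

lemma Rat_compose:
  assumes "g \<in> Rat" "h \<in> Rat"
  shows "g \<circ> h \<in> Rat" and "rat_degree (g \<circ> h) = rat_degree g * rat_degree h"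
proof -
  obtain P Q n where g: "g = ratmap P Q" "coprime P Q" "n = max (degree P) (degree Q)" "n \<ge> 1"
    "rat_degree g = n" using assms(1) by (rule RatE)
  obtain A B m where h: "h = ratmap A B" "coprime A B" "m = max (degree A) (degree B)" "m \<ge> 1"
    "rat_degree h = m" using assms(2) by (rule RatE)
  let ?R = "hom_subst n P A B" and ?S = "hom_subst n Q A B"
  have nz: "poly ?R z \<noteq> 0 \<or> poly ?S z \<noteq> 0" for z
    unfolding poly_hom_subst using coprime_no_common_root[OF h(2)] g by (intro hom_eval_nonzero) auto
  then have cop: "coprime ?R ?S"
    by (intro coprime_complex_polyI) (metis poly_0)+
  have cne: "coeff A m \<noteq> 0 \<or> coeff B m \<noteq> 0"
    using h(3,4) by (metis leading_coeff_0_iff max_def degree_0 not_one_le_zero)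
  have top: "hom_eval n P (coeff A m) (coeff B m) \<noteq> 0 \<or> hom_eval n Q (coeff A m) (coeff B m) \<noteq> 0"
    using cne g by (intro hom_eval_nonzero) auto
  have dA: "degree A \<le> m" "degree B \<le> m" using h(3) by auto
  have deg: "max (degree ?R) (degree ?S) = n * m"
  proof (rule antisym)
    show "max (degree ?R) (degree ?S) \<le> n * m" by (simp add: hom_subst_degree(1)[OF dA])
    show "n * m \<le> max (degree ?R) (degree ?S)"
      using top le_degree[of ?R "n * m"] le_degree[of ?S "n * m"]
      by (auto simp: hom_subst_degree(2)[OF dA])
  qed
  have eq: "g \<circ> h = ratmap ?R ?S"
  proof
    fix x show "(g \<circ> h) x = ratmap ?R ?S x"
    proof (cases x)
      case (Fin z)
      show ?thesis using coprime_no_common_root[OF h(2), of z]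
        by (simp add: Fin g(1) h(1) ratmap_sphere_quot[OF _ g(3)] poly_hom_subst)
    next
      case Infty
      have "ratmap ?R ?S Infty = sphere_quot (coeff ?R (n * m)) (coeff ?S (n * m))"
        by (simp only: ratmap.simps Let_def deg)
      also have "\<dots> = g (sphere_quot (coeff A m) (coeff B m))"
        by (simp add: hom_subst_degree(2)[OF dA] g(1) ratmap_sphere_quot[OF cne g(3)])
      finally show ?thesis by (simp add: Infty h(1) Let_def flip: h(3))
    qed
  qed
  show "g \<circ> h \<in> Rat" unfolding eq using cop deg g(4) h(4) by (intro RatI) auto
  show "rat_degree (g \<circ> h) = rat_degree g * rat_degree h"
    unfolding eq rat_degree_ratmap[OF cop] deg g(5) h(5) ..
qed

subsection \<open>Rational maps as holomorphic maps\<close>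

text \<open>The numerator is the Wronskian, which only changes sign when \<open>A\<close> and
  \<open>B\<close> are exchanged. So zeros of \<open>B\<close> obey the same formula, and critical
  points are zeros of a polynomial.\<close>

lemma sph_holo_sphere_quot:
  assumes "A analytic_on {z}" "B analytic_on {z}" "A z \<noteq> 0 \<or> B z \<noteq> 0"
  shows "sph_holo (\<lambda>u. sphere_quot (A u) (B u)) z"
    and "sd (\<lambda>u. sphere_quot (A u) (B u)) z =
      cmod (deriv A z * B z - A z * deriv B z) / ((cmod (A z))\<^sup>2 + (cmod (B z))\<^sup>2)"
proof -
  have dif: "A field_differentiable at z" "B field_differentiable at z"
    using assms by (simp_all add: analytic_on_imp_differentiable_at)
  have quot: "cmod (deriv (\<lambda>u. F u / G u) z) / (1 + (cmod (F z / G z))\<^sup>2) =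
      cmod (deriv F z * G z - F z * deriv G z) / ((cmod (F z))\<^sup>2 + (cmod (G z))\<^sup>2)"
    if "F field_differentiable at z" "G field_differentiable at z" "G z \<noteq> 0" for F G
  proof -
    have "deriv (\<lambda>u. F u / G u) z = (deriv F z * G z - F z * deriv G z) / (G z)\<^sup>2"
      using that by (intro DERIV_imp_deriv)
        (auto intro!: derivative_eq_intros simp: field_differentiable_derivI power2_eq_square)
    then have "cmod (deriv (\<lambda>u. F u / G u) z) =
        cmod (deriv F z * G z - F z * deriv G z) / (cmod (G z))\<^sup>2"
      by (simp add: norm_divide norm_power)
    moreover have "(cmod (G z))\<^sup>2 * (1 + (cmod (F z / G z))\<^sup>2) = (cmod (F z))\<^sup>2 + (cmod (G z))\<^sup>2"
      using that(3) by (simp add: norm_divide power_divide distrib_left)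
    ultimately show ?thesis by (simp add: divide_divide_eq_left)
  qed
  have "sph_holo (\<lambda>u. sphere_quot (A u) (B u)) z \<and> sd (\<lambda>u. sphere_quot (A u) (B u)) z =
      cmod (deriv A z * B z - A z * deriv B z) / ((cmod (A z))\<^sup>2 + (cmod (B z))\<^sup>2)"
  proof (cases "B z = 0")
    case False
    have an: "(\<lambda>u. A u / B u) analytic_on {z}" using assms False by (intro analytic_intros) auto
    have "\<forall>\<^sub>F u in nhds z. B u \<noteq> 0"
      using analytic_at_imp_isCont[OF assms(2)] False
      by (intro tendsto_imp_eventually_ne) (auto simp: isCont_def tendsto_at_iff_tendsto_nhds)
    then have ev: "\<forall>\<^sub>F u in nhds z. sphere_quot (A u) (B u) = id (Fin (A u / B u))"
      by eventually_elim (simp add: sphere_quot_def)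
    show ?thesis
      using sph_holo_intro[where c = id, OF an _ ev] sd_eq[where c = id, OF an _ ev]
        quot[OF dif False] by simp
  next
    case True
    with assms(3) have az: "A z \<noteq> 0" by simp
    have an: "(\<lambda>u. B u / A u) analytic_on {z}" using assms az by (intro analytic_intros) auto
    have "\<forall>\<^sub>F u in nhds z. A u \<noteq> 0"
      using analytic_at_imp_isCont[OF assms(1)] az
      by (intro tendsto_imp_eventually_ne) (auto simp: isCont_def tendsto_at_iff_tendsto_nhds)
    then have ev: "\<forall>\<^sub>F u in nhds z. sphere_quot (A u) (B u) = sphere_inv (Fin (B u / A u))"
      by eventually_elim (simp add: sphere_quot_def)
    have "cmod (deriv B z * A z - B z * deriv A z) = cmod (deriv A z * B z - A z * deriv B z)"
      by (metis norm_minus_commute mult.commute)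
    then show ?thesis
      using sph_holo_intro[where c = sphere_inv, OF an _ ev]
        sd_eq[where c = sphere_inv, OF an _ ev] quot[OF dif(2,1) az] by (simp add: add.commute)
  qed
  then show "sph_holo (\<lambda>u. sphere_quot (A u) (B u)) z"
    "sd (\<lambda>u. sphere_quot (A u) (B u)) z =
      cmod (deriv A z * B z - A z * deriv B z) / ((cmod (A z))\<^sup>2 + (cmod (B z))\<^sup>2)"
    by auto
qed

lemma analytic_poly [analytic_intros]: "poly P analytic_on S"
  unfolding poly_altdef[abs_def] by (intro analytic_intros)

lemma analytic_hom_eval: "hom_eval n P 1 analytic_on S"
  unfolding hom_eval_def[abs_def] by (intro analytic_intros)

lemma ratmap_at_Infty:
  assumes "n = max (degree P) (degree Q)"
  shows "ratmap P Q (sphere_inv (Fin u)) = sphere_quot (hom_eval n P 1 u) (hom_eval n Q 1 u)"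
  using ratmap_sphere_quot[of 1 u n P Q] assms by simp

lemma Rat_sph_map_at:
  assumes "g \<in> Rat"
  shows "sph_map_at g x"
proof -
  obtain P Q n where g: "g = ratmap P Q" "coprime P Q" "n = max (degree P) (degree Q)" "n \<ge> 1"
    using assms by (rule RatE)
  show ?thesis
  proof (cases x)
    case (Fin z)
    then show ?thesis
      using sph_holo_sphere_quot(1)[of "poly P" z "poly Q"] coprime_no_common_root[OF g(2)]
      by (simp add: sph_map_at_def chart_at_def g(1) analytic_poly)
  next
    case Infty
    have "hom_eval n P 1 0 \<noteq> 0 \<or> hom_eval n Q 1 0 \<noteq> 0"
      using g by (intro hom_eval_nonzero) auto
    then show ?thesis
      using sph_holo_sphere_quot(1)[of "hom_eval n P 1" 0 "hom_eval n Q 1"] analytic_hom_eval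
      by (simp add: sph_map_at_def chart_at_def g(1) Infty ratmap_at_Infty[OF g(3)] del: sphere_inv.simps)
         (simp add: ratmap_at_Infty[OF g(3)] del: sphere_inv.simps(1))
  qed
qed

lemma Rat_isCont: "g \<in> Rat \<Longrightarrow> isCont g x"
  by (simp add: Rat_sph_map_at sph_map_at_imp_isCont)

lemma Rat_continuous_on: "g \<in> Rat \<Longrightarrow> continuous_on A g"
  by (simp add: Rat_isCont continuous_at_imp_continuous_on)

lemma Rat_deriv_comp:
  "g \<in> Rat \<Longrightarrow> h \<in> Rat \<Longrightarrow>
    sph_deriv_norm (g \<circ> h) x = sph_deriv_norm g (h x) * sph_deriv_norm h x"
  by (simp add: Rat_sph_map_at sph_map_at_comp(2))

lemma sph_deriv_norm_id [simp]: "sph_deriv_norm id x = 1"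
proof -
  have "1 + (cmod z)\<^sup>2 > 0" for z by (simp add: add_pos_nonneg)
  then show ?thesis
    by (cases x) (simp_all add: sph_deriv_norm_def Let_def chart_at_def del: sphere_inv.simps(1), auto simp: less_le)
qed

text \<open>The finite solutions of \<open>ratmap P Q x = sphere_quot a b\<close> are the roots of
  this member of the pencil. Were it zero, coprimality would make \<open>P\<close> and
  \<open>Q\<close> constant.\<close>

lemma Rat_pencil_nonzero:
  fixes P Q :: "complex poly"
  assumes "coprime P Q" "max (degree P) (degree Q) \<ge> 1" "a \<noteq> 0 \<or> b \<noteq> 0"
  shows "smult b P - smult a Q \<noteq> 0"
proof
  assume "smult b P - smult a Q = 0"
  then have eq: "smult b P = smult a Q" by simp
  have "P dvd smult a Q" "Q dvd smult b P"
    using eq by (metis dvd_smult dvd_refl)+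
  then have "(a \<noteq> 0 \<longrightarrow> P dvd Q) \<and> (b \<noteq> 0 \<longrightarrow> Q dvd P)" by (metis dvd_smult_cancel)
  moreover have "P dvd Q \<and> Q dvd P" if "a \<noteq> 0" "b \<noteq> 0" using calculation that by blast
  moreover have "a = 0 \<Longrightarrow> P = 0" "b = 0 \<Longrightarrow> Q = 0" using eq assms(3) by auto
  ultimately have "is_unit P \<and> is_unit Q \<or> P = 0 \<and> is_unit Q \<or> Q = 0 \<and> is_unit P"
    using assms(1) by (metis coprime_common_divisor dvd_refl coprime_0_left_iff coprime_0_right_iff)
  then have "degree P = 0" "degree Q = 0" by (auto dest: dvd_imp_degree_le)
  then show False using assms(2) by simp
qed

lemma Rat_finite_fibre:
  assumes "g \<in> Rat"
  shows "finite {x. g x = y}"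
proof -
  obtain P Q n where g: "g = ratmap P Q" "coprime P Q" "n = max (degree P) (degree Q)" "n \<ge> 1"
    using assms by (rule RatE)
  obtain a b where y: "y = sphere_quot a b" "a \<noteq> 0 \<or> b \<noteq> 0" by (rule sphere_quot_cases)
  have "{x. g x = y} \<subseteq> insert Infty (Fin ` {z. poly (smult b P - smult a Q) z = 0})"
  proof
    fix x assume x: "x \<in> {x. g x = y}"
    show "x \<in> insert Infty (Fin ` {z. poly (smult b P - smult a Q) z = 0})"
    proof (cases x)
      case (Fin z)
      then have "poly P z * b = a * poly Q z"
        using x coprime_no_common_root[OF g(2), of z] y by (simp add: g(1) sphere_quot_eq_iff)
      then show ?thesis by (simp add: Fin mult.commute)
    qed simp
  qed
  moreover have "finite {z. poly (smult b P - smult a Q) z = 0}"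
    using Rat_pencil_nonzero[OF g(2)] g(3,4) y(2) by (intro poly_roots_finite) auto
  ultimately show ?thesis by (meson finite.insertI finite_imageI finite_subset)
qed

lemma Rat_surj:
  assumes "g \<in> Rat"
  shows "\<exists>x. g x = y"
proof -
  obtain P Q n where g: "g = ratmap P Q" "coprime P Q" "n = max (degree P) (degree Q)" "n \<ge> 1"
    using assms by (rule RatE)
  obtain a b where y: "y = sphere_quot a b" "a \<noteq> 0 \<or> b \<noteq> 0" by (rule sphere_quot_cases)
  let ?L = "smult b P - smult a Q"
  show ?thesis
  proof (cases "degree ?L = 0")
    case False
    then obtain z where "poly ?L z = 0" by (rule ex_poly_root)
    then have "g (Fin z) = y"
      using coprime_no_common_root[OF g(2), of z] y by (simp add: g(1) sphere_quot_eq_iff mult.commute)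
    then show ?thesis ..
  next
    case True
    \<comment> \<open>A pencil member without finite roots has lost its top coefficient, and the
      missing preimage is \<open>Infty\<close>.\<close>
    then have "coeff ?L n = 0" using g(4) by (intro coeff_eq_0) linarith
    moreover have "coeff P n \<noteq> 0 \<or> coeff Q n \<noteq> 0"
      using g(3,4) by (metis leading_coeff_0_iff max_def degree_0 not_one_le_zero)
    ultimately have "g Infty = y"
      using y by (simp add: g(1) Let_def sphere_quot_eq_iff mult.commute flip: g(3))
    then show ?thesis ..
  qed
qed

lemma Rat_open_map:
  assumes "g \<in> Rat" "open U"
  shows "open (g ` U)"
proof (subst open_subopen, intro ballI)
  have "\<exists>T. open T \<and> g x \<in> T \<and> T \<subseteq> g ` U" if "x \<in> U" for x
  proof -
    let ?H = "\<lambda>u. g (chart_at x (Fin u))" and ?w = "to_complex (chart_at x x)"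
    have "sph_holo ?H ?w" using Rat_sph_map_at[OF assms(1), of x] by (simp add: sph_map_at_def)
    then obtain h where h: "h analytic_on {?w}" "\<forall>\<^sub>F u in nhds ?w. ?H u = chart_at (?H ?w) (Fin (h u))"
      by (rule sph_holoE)
    have cont: "continuous_on UNIV (\<lambda>u. chart_at x (Fin u))"
      using continuous_on_compose[OF continuous_Fin continuous_chart_at] by (simp add: o_def)
    have "open ((\<lambda>u. chart_at x (Fin u)) -` U)" using assms(2) cont by (rule open_vimage)
    then have ev1: "\<forall>\<^sub>F u in nhds ?w. chart_at x (Fin u) \<in> U"
      using that eventually_nhds[of _ ?w] by auto
    obtain S where S: "open S" "?w \<in> S" "h holomorphic_on S" using h(1) analytic_at by blast
    have "\<forall>\<^sub>F u in nhds ?w. u \<in> S" using S eventually_nhds by blast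
    with ev1 have "\<forall>\<^sub>F u in nhds ?w. chart_at x (Fin u) \<in> U \<and> u \<in> S \<and> ?H u = chart_at (?H ?w) (Fin (h u))"
      using h(2) by eventually_elim auto
    then obtain e where e: "e > 0" "\<And>u. u \<in> ball ?w e \<Longrightarrow> chart_at x (Fin u) \<in> U \<and> u \<in> S \<and>
        ?H u = chart_at (?H ?w) (Fin (h u))"
      unfolding eventually_nhds_metric by (auto simp: dist_commute)
    have hol: "h holomorphic_on ball ?w e" using S(3) e(2) by (auto intro: holomorphic_on_subset)
    have "\<not> h constant_on ball ?w e"
    proof
      assume "h constant_on ball ?w e"
      then obtain c where "\<And>u. u \<in> ball ?w e \<Longrightarrow> h u = c" unfolding constant_on_def by blast
      then have "(\<lambda>u. chart_at x (Fin u)) ` ball ?w e \<subseteq> {y. g y = chart_at (?H ?w) (Fin c)}"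
        using e(2) by auto
      then have "finite ((\<lambda>u. chart_at x (Fin u)) ` ball ?w e)"
        using Rat_finite_fibre[OF assms(1)] finite_subset by blast
      moreover have "inj (\<lambda>u. chart_at x (Fin u))"
        by (rule injI) (metis chart_at_chart_at riemann_sphere.inject)
      ultimately have "finite (ball ?w e)" by (meson finite_imageD inj_on_subset subset_UNIV)
      then show False using e(1) by (metis finite_imp_not_open open_ball ball_eq_empty not_le)
    qed
    then have "open (h ` ball ?w e)"
      by (intro open_mapping_thm[OF hol]) auto
    then have "open (chart_at (?H ?w) ` Fin ` h ` ball ?w e)"
      by (intro open_chart_image open_Fin_image)
    moreover have "chart_at (?H ?w) ` Fin ` h ` ball ?w e \<subseteq> g ` U"
    proof
      fix y assume "y \<in> chart_at (?H ?w) ` Fin ` h ` ball ?w e"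
      then obtain u where "u \<in> ball ?w e" "y = chart_at (?H ?w) (Fin (h u))" by blast
      then show "y \<in> g ` U" using e(2)[of u] by (metis imageI)
    qed
    moreover have "g x \<in> chart_at (?H ?w) ` Fin ` h ` ball ?w e"
      using e(2)[of ?w] e(1) by (intro image_eqI[OF _ imageI[OF imageI[of ?w]]]) auto
    ultimately show ?thesis by blast
  qed
  then show "\<exists>T. open T \<and> y \<in> T \<and> T \<subseteq> g ` U" if "y \<in> g ` U" for y using that by blast
qed

subsection \<open>Automorphisms\<close>

definition mob :: "complex \<Rightarrow> complex \<Rightarrow> complex \<Rightarrow> complex \<Rightarrow> riemann_sphere \<Rightarrow> riemann_sphere" where
  "mob a b c d = ratmap [:b, a:] [:d, c:]"

lemma mob_degree:
  fixes a b c d :: complex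
  assumes "a * d \<noteq> b * c"
  shows "max (degree [:b, a:]) (degree [:d, c:]) = 1"
  using assms by (cases "a = 0"; cases "c = 0") auto

lemma mob_sphere_quot:
  assumes "a * d \<noteq> b * c" "x \<noteq> 0 \<or> y \<noteq> 0"
  shows "mob a b c d (sphere_quot x y) = sphere_quot (a * x + b * y) (c * x + d * y)"
  unfolding mob_def
  by (subst ratmap_sphere_quot[OF assms(2) mob_degree[OF assms(1), symmetric]])
    (simp add: hom_eval_def algebra_simps)

lemma mob_Rat:
  assumes "a * d \<noteq> b * c"
  shows "mob a b c d \<in> Rat"
  unfolding mob_def
proof (rule RatI)
  show "1 \<le> max (degree [:b, a:]) (degree [:d, c:])" using mob_degree[OF assms] by simp
  have "poly [:b, a:] z \<noteq> 0 \<or> poly [:d, c:] z \<noteq> 0" for z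
  proof (rule ccontr)
    assume "\<not> ?thesis"
    then have "b = - (z * a)" "d = - (z * c)" by (simp_all add: add_eq_0_iff)
    then show False using assms by (simp add: algebra_simps)
  qed
  then show "coprime [:b, a:] [:d, c:]" using assms by (intro coprime_complex_polyI) auto
qed

lemma mob_inverse:
  assumes "a * d \<noteq> b * c"
  shows "mob d (-b) (-c) a (mob a b c d x) = x"
proof -
  obtain p q where x: "x = sphere_quot p q" "p \<noteq> 0 \<or> q \<noteq> 0" by (rule sphere_quot_cases)
  have D: "a * d - b * c \<noteq> 0" using assms by simp
  have nz: "a * p + b * q \<noteq> 0 \<or> c * p + d * q \<noteq> 0"
  proof (rule ccontr)
    assume n: "\<not> ?thesis"
    have "(a * d - b * c) * p = d * (a * p + b * q) - b * (c * p + d * q)"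
         "(a * d - b * c) * q = a * (c * p + d * q) - c * (a * p + b * q)"
      by (simp_all add: algebra_simps)
    then show False using n D x(2) by simp
  qed
  have "mob d (-b) (-c) a (mob a b c d x) =
      sphere_quot (d * (a * p + b * q) + - b * (c * p + d * q)) (- c * (a * p + b * q) + a * (c * p + d * q))"
    using assms nz unfolding x(1)
    by (subst mob_sphere_quot[OF assms x(2)], subst mob_sphere_quot) (auto simp: mult.commute)
  also have "\<dots> = sphere_quot ((a * d - b * c) * p) ((a * d - b * c) * q)"
    by (simp add: algebra_simps)
  finally show ?thesis using D by (simp add: sphere_quot_scale x(1))
qed

lemma Aut_sphereI:
  assumes "\<phi> \<in> Rat" "\<psi> \<in> Rat" "\<And>x. \<psi> (\<phi> x) = x" "\<And>x. \<phi> (\<psi> x) = x"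
  shows "\<phi> \<in> Aut_sphere" "inv \<phi> = \<psi>"
proof -
  show i: "inv \<phi> = \<psi>" using assms(3,4) by (intro inv_unique_comp ext) auto
  have "bij \<phi>" using assms(3,4) by (intro o_bij[of \<psi>]) auto
  then show "\<phi> \<in> Aut_sphere" using assms i by (simp add: Aut_sphere_def)
qed

lemma mob_Aut:
  assumes "a * d \<noteq> b * c"
  shows "mob a b c d \<in> Aut_sphere"
proof (rule Aut_sphereI(1))
  have *: "d * a \<noteq> (- b) * (- c)" using assms by (simp add: mult.commute)
  show "mob d (-b) (-c) a \<in> Rat" using * by (rule mob_Rat)
  show "mob a b c d (mob d (-b) (-c) a x) = x" for x using mob_inverse[OF *] by simp
qed (simp_all add: mob_Rat mob_inverse assms)

lemma ex_Aut_0_Infty: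
  assumes "x \<noteq> y"
  obtains \<phi> where "\<phi> \<in> Aut_sphere" "\<phi> x = Fin 0" "\<phi> y = Infty"
proof -
  obtain a b where x: "x = sphere_quot a b" "a \<noteq> 0 \<or> b \<noteq> 0" by (rule sphere_quot_cases)
  obtain c d where y: "y = sphere_quot c d" "c \<noteq> 0 \<or> d \<noteq> 0" by (rule sphere_quot_cases)
  \<comment> \<open>The rows of the matrix are the linear forms vanishing at \<open>x\<close> and at
    \<open>y\<close>; they are independent because \<open>x \<noteq> y\<close>.\<close>
  have ne: "b * (- c) \<noteq> (- a) * d" using assms x y by (simp add: sphere_quot_eq_iff mult.commute)
  have "mob b (-a) d (-c) x = Fin 0"
    unfolding x(1) using ne by (subst mob_sphere_quot[OF ne x(2)]) (auto simp: sphere_quot_def mult.commute)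
  moreover have "mob b (-a) d (-c) y = Infty"
    unfolding y(1) using ne by (subst mob_sphere_quot[OF ne y(2)]) (auto simp: sphere_quot_def mult.commute)
  ultimately show ?thesis using that mob_Aut[OF ne] by blast
qed

lemma Aut_sphereD:
  assumes "\<phi> \<in> Aut_sphere"
  shows "\<phi> \<in> Rat" "inv \<phi> \<in> Rat" "inv \<phi> (\<phi> x) = x" "\<phi> (inv \<phi> x) = x" "rat_degree \<phi> = 1"
    "rat_degree (inv \<phi>) = 1" "sph_deriv_norm \<phi> x \<noteq> 0" "inv \<phi> \<in> Aut_sphere" "inv (inv \<phi>) = \<phi>"
proof -
  show R: "\<phi> \<in> Rat" "inv \<phi> \<in> Rat" using assms by (auto simp: Aut_sphere_def)
  have b: "bij \<phi>" using assms by (auto simp: Aut_sphere_def)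
  then show i: "inv \<phi> (\<phi> x) = x" "\<phi> (inv \<phi> x) = x" for x
    by (simp_all add: bij_is_inj bij_is_surj surj_f_inv_f)
  show "inv (inv \<phi>) = \<phi>" "inv \<phi> \<in> Aut_sphere"
    using assms b by (auto simp: Aut_sphere_def inv_inv_eq bij_imp_bij_inv)
  have id: "inv \<phi> \<circ> \<phi> = id" using i by auto
  have "mob 1 0 0 1 = id"
  proof
    fix x show "mob 1 0 0 1 x = id x"
      by (rule sphere_quot_cases[of x]) (simp add: mob_sphere_quot)
  qed
  then have "rat_degree id = 1"
    using rat_degree_ratmap[of "[:0, 1:]" "[:1, 0:]"] coprime_complex_polyI[of "[:0, 1:]" "[:1:]"]
    by (simp add: mob_def)
  then have "rat_degree (inv \<phi>) * rat_degree \<phi> = 1"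
    using Rat_compose(2)[OF R(2,1)] id by simp
  then show "rat_degree \<phi> = 1" "rat_degree (inv \<phi>) = 1" by auto
  show "sph_deriv_norm \<phi> x \<noteq> 0"
    using Rat_deriv_comp[OF R(2,1), of x] id by auto
qed

subsection \<open>Local inverses\<close>

lemma analytic_local_inverse:
  assumes "f analytic_on {z}" "deriv f z \<noteq> 0"
  obtains g where "g analytic_on {f z}" "g (f z) = z" "\<forall>\<^sub>F y in nhds (f z). f (g y) = y"
    "\<forall>\<^sub>F x in nhds z. g (f x) = x" "deriv g (f z) * deriv f z = 1"
proof -
  obtain S where S: "open S" "z \<in> S" "f holomorphic_on S" using assms(1) analytic_at by blast
  obtain r where r: "r > 0" "ball z r \<subseteq> S" "inj_on f (ball z r)"
    using has_complex_derivative_locally_injective[OF S(3,2,1) assms(2)] by blast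
  have hol: "f holomorphic_on ball z r" using S(3) r(2) by (rule holomorphic_on_subset)
  obtain g where g: "g holomorphic_on (f ` ball z r)"
      "\<And>x. x \<in> ball z r \<Longrightarrow> deriv f x * deriv g (f x) = 1" "\<And>x. x \<in> ball z r \<Longrightarrow> g (f x) = x"
    using holomorphic_has_inverse[OF hol open_ball r(3)] by blast
  have op: "open (f ` ball z r)" using open_mapping_thm3[OF hol open_ball r(3)] .
  have zin: "f z \<in> f ` ball z r" "z \<in> ball z r" using r(1) by auto
  show ?thesis
  proof (rule that)
    show "g analytic_on {f z}" using g(1) op zin by (simp add: holomorphic_on_imp_analytic_at)
    show "g (f z) = z" using g(3) zin by simp
    have "\<forall>\<^sub>F y in nhds (f z). y \<in> f ` ball z r" using op zin(1) eventually_nhds by blast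
    then show "\<forall>\<^sub>F y in nhds (f z). f (g y) = y" by eventually_elim (auto simp: g(3))
    have "\<forall>\<^sub>F x in nhds z. x \<in> ball z r" using open_ball zin(2) eventually_nhds by blast
    then show "\<forall>\<^sub>F x in nhds z. g (f x) = x" by eventually_elim (rule g(3))
    show "deriv g (f z) * deriv f z = 1" using g(2)[OF zin(2)] by (simp add: mult.commute)
  qed
qed

lemma sph_holo_repr:
  assumes "sph_holo H z"
  shows "sph_repr H z analytic_on {z}" "\<forall>\<^sub>F u in nhds z. H u = chart_at (H z) (Fin (sph_repr H z u))"
  by (rule sph_holoE[OF assms], simp)+

lemma sph_holo_deriv_nonzero:
  assumes "sph_holo H z" "sd H z \<noteq> 0"
  shows "deriv (sph_repr H z) z \<noteq> 0"
  using assms unfolding sd_def by auto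

lemma sph_holo_locally_injective:
  assumes "sph_holo H z" "sd H z \<noteq> 0"
  obtains r where "r > 0" "inj_on H (ball z r)"
proof -
  have an: "sph_repr H z analytic_on {z}" using sph_holo_repr(1)[OF assms(1)] .
  obtain S where S: "open S" "z \<in> S" "sph_repr H z holomorphic_on S" using an analytic_at by blast
  obtain r where r: "r > 0" "inj_on (sph_repr H z) (ball z r)"
    using has_complex_derivative_locally_injective[OF S(3,2,1) sph_holo_deriv_nonzero[OF assms]] by blast
  then have "inj_on H (ball z r)"
    unfolding inj_on_def sph_repr_def by metis
  with r(1) show ?thesis by (rule that)
qed

text \<open>\<open>K\<close> is a local inverse of \<open>H\<close> at \<open>a\<close> composed
  with \<open>H\<close> near \<open>b\<close>. Applied to the linearisation, it yields the germs
  whose rigidity is the heart of the proof.\<close>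

lemma sph_holo_lift:
  assumes "sph_holo H a" "sph_holo H b" "H a = H b" "sd H a \<noteq> 0"
  obtains K where "K analytic_on {b}" "K b = a" "\<forall>\<^sub>F v in nhds b. H (K v) = H v"
proof -
  let ?ha = "sph_repr H a" and ?hb = "sph_repr H b"
  have A: "?ha analytic_on {a}" "\<forall>\<^sub>F u in nhds a. H u = chart_at (H a) (Fin (?ha u))"
    using sph_holo_repr[OF assms(1)] by auto
  have B: "?hb analytic_on {b}" "\<forall>\<^sub>F u in nhds b. H u = chart_at (H a) (Fin (?hb u))"
    using sph_holo_repr[OF assms(2)] assms(3) by auto
  obtain g where g: "g analytic_on {?ha a}" "g (?ha a) = a" "\<forall>\<^sub>F y in nhds (?ha a). ?ha (g y) = y"
    using analytic_local_inverse[OF A(1) sph_holo_deriv_nonzero[OF assms(1,4)]] by blast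
  have eq: "?hb b = ?ha a" by (simp add: sph_repr_def assms(3))
  let ?K = "\<lambda>v. g (?hb v)"
  have an: "?K analytic_on {b}"
    using analytic_on_compose[OF B(1), of g] g(1) eq by (simp add: o_def)
  have Kb: "?K b = a" using g(2) eq by simp
  have "\<forall>\<^sub>F v in nhds b. ?ha (g (?hb v)) = ?hb v"
    by (rule eventually_nhds_isCont[OF analytic_at_imp_isCont[OF B(1)]]) (simp add: eq g(3))
  moreover have "\<forall>\<^sub>F v in nhds b. H (?K v) = chart_at (H a) (Fin (?ha (?K v)))"
    by (rule eventually_nhds_isCont[OF analytic_at_imp_isCont[OF an]]) (simp add: Kb A(2))
  ultimately have "\<forall>\<^sub>F v in nhds b. H (?K v) = H v"
    using B(2) by eventually_elim simp
  with an Kb show ?thesis by (rule that)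
qed

text \<open>The set of points where the germs agree is open by definition. At a point of its closure
  the values agree, so one chart serves both maps and ordinary analytic continuation applies
  there.\<close>

lemma sph_holo_identity:
  assumes F: "\<And>z. sph_holo F z" and G: "\<And>z. sph_holo G z"
    and ev: "\<forall>\<^sub>F u in nhds a. F u = G u"
  shows "F z = G z"
proof -
  define A where "A = {z. \<forall>\<^sub>F u in nhds z. F u = G u}"
  have op: "open A"
  proof (subst open_subopen, intro ballI)
    fix z assume "z \<in> A"
    then obtain S where "open S" "z \<in> S" "\<forall>u\<in>S. F u = G u"
      unfolding A_def eventually_nhds by blast
    then show "\<exists>T. open T \<and> z \<in> T \<and> T \<subseteq> A"
      unfolding A_def eventually_nhds by blast
  qed
  have eqA: "F z = G z" if "z \<in> A" for z
    using that eventually_nhds_x_imp_x unfolding A_def by blast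
  have "closed {z. F z = G z}"
    using F G sph_holo_imp_isCont
    by (intro closed_Collect_eq) (auto simp: continuous_on_eq_continuous_at)
  then have cl: "closure A \<subseteq> {z. F z = G z}"
    using eqA by (intro closure_minimal) auto
  have "closure A \<subseteq> A"
  proof
    fix z assume z: "z \<in> closure A"
    with cl have Fz: "F z = G z" by auto
    let ?f = "sph_repr F z" and ?g = "sph_repr G z"
    have f: "?f analytic_on {z}" "\<forall>\<^sub>F u in nhds z. F u = chart_at (F z) (Fin (?f u))"
      using sph_holo_repr[OF F[of z]] by auto
    have g: "?g analytic_on {z}" "\<forall>\<^sub>F u in nhds z. G u = chart_at (F z) (Fin (?g u))"
      using sph_holo_repr[OF G[of z]] Fz by auto
    obtain S where S: "open S" "z \<in> S" "?f holomorphic_on S" "?g holomorphic_on S"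
      using f(1) g(1) analytic_at_two by blast
    have "\<forall>\<^sub>F u in nhds z. u \<in> S" using S eventually_nhds by blast
    then have "\<forall>\<^sub>F u in nhds z. u \<in> S \<and> F u = chart_at (F z) (Fin (?f u)) \<and> G u = chart_at (F z) (Fin (?g u))"
      using f(2) g(2) by eventually_elim auto
    then obtain e where e: "e > 0" "\<And>u. u \<in> ball z e \<Longrightarrow> u \<in> S \<and> F u = chart_at (F z) (Fin (?f u)) \<and>
        G u = chart_at (F z) (Fin (?g u))"
      unfolding eventually_nhds_metric by (auto simp: dist_commute)
    have "?f u = ?g u" if "u \<in> ball z e" for u
    proof (rule analytic_continuation_open[of "A \<inter> ball z e" "ball z e" ?f ?g])
      show "open (A \<inter> ball z e)" using op by auto
      show "A \<inter> ball z e \<noteq> {}"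
        using z e(1) unfolding closure_approachable
          by (metis Int_iff dist_commute empty_iff mem_ball)
      show "?f holomorphic_on ball z e" "?g holomorphic_on ball z e"
        using S(3,4) e(2) by (auto intro: holomorphic_on_subset)
      show "?f u = ?g u" if "u \<in> A \<inter> ball z e" for u
        using eqA[of u] that Fz by (simp add: sph_repr_def)
    qed (use that in auto)
    then have "\<forall>u\<in>ball z e. F u = G u" using e(2) by metis
    then show "z \<in> A" unfolding A_def eventually_nhds_metric using e(1) by (auto simp: dist_commute)
  qed
  then have "closed A" by (metis closure_subset_eq)
  moreover have "a \<in> A" using ev by (simp add: A_def)
  ultimately have "A = UNIV" using op clopen[of A] by auto
  then show ?thesis using eqA by blast
qed

subsection \<open>Koenigs linearisation\<close>

text \<open>\<open>L\<close> is the limit of the rescaled iterates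
  \<open>\<kappa> ^^ n / \<mu> ^ n\<close>, whose increments come from the quadratic Taylor
  remainder. The shift by one step in \<open>n\<close> is the functional equation.\<close>

lemma Koenigs_contraction:
  fixes \<kappa> :: "complex \<Rightarrow> complex"
  assumes an: "\<kappa> analytic_on {0}" and k0: "\<kappa> 0 = 0" and d: "deriv \<kappa> 0 = \<mu>"
    and mu: "0 < cmod \<mu>" "cmod \<mu> < 1"
  obtains L where "L analytic_on {0}" "L 0 = 0" "deriv L 0 = 1" "\<forall>\<^sub>F y in nhds 0. L (\<kappa> y) = \<mu> * L y"
proof -
  define s where "s = cmod \<mu>"
  \<comment> \<open>The iterates shrink like \<open>q ^ n\<close>, so the rescaled quadratic errors
    have size \<open>(q^2 / s) ^ n\<close>. Convergence needs \<open>q^2 < s\<close>, while a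
    contraction factor must exceed \<open>s\<close>; the midpoint of \<open>s\<close> and
    \<open>sqrt s\<close> meets both demands.\<close>
  define q where "q = (s + sqrt s) / 2"
  have s: "0 < s" "s < 1" using mu by (auto simp: s_def)
  then have "s < sqrt s" by (simp add: real_less_rsqrt power2_eq_square)
  then have q: "s < q" "q < sqrt s" "0 < q" using s by (auto simp: q_def)
  have q2: "q\<^sup>2 / s < 1" "q < 1" "0 \<le> q\<^sup>2 / s"
  proof -
    have "q\<^sup>2 < (sqrt s)\<^sup>2" using q by (intro power_strict_mono) auto
    then show "q\<^sup>2 / s < 1" using s by simp
    have "sqrt s < 1" using s by simp
    then show "q < 1" using q by linarith
  qed (use s in auto)
  obtain r0 where r0: "r0 > 0" "\<kappa> holomorphic_on ball 0 r0" using an analytic_at_ball by blast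
  define r1 where "r1 = r0 / 2"
  have r1: "r1 > 0" "cball 0 r1 \<subseteq> ball 0 r0" using r0(1) by (auto simp: r1_def)
  have hd: "deriv \<kappa> holomorphic_on ball 0 r0" "deriv (deriv \<kappa>) holomorphic_on ball 0 r0"
    using r0(2) by (auto intro!: holomorphic_deriv)
  have "continuous_on (cball 0 r1) (deriv (deriv \<kappa>))"
    using hd(2) r1(2) by (meson continuous_on_subset holomorphic_on_imp_continuous_on)
  then have "bounded (deriv (deriv \<kappa>) ` cball 0 r1)"
    by (intro compact_imp_bounded compact_continuous_image) auto
  then obtain B where B: "B > 0" "\<And>x. x \<in> cball 0 r1 \<Longrightarrow> cmod (deriv (deriv \<kappa>) x) \<le> B"
    unfolding bounded_pos by auto
  have tay: "cmod (\<kappa> y - \<mu> * y) \<le> B * (cmod y)\<^sup>2" if "y \<in> cball 0 r1" for y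
  proof -
    have "cmod ((deriv ^^ 0) \<kappa> y - (\<Sum>i\<le>1. (deriv ^^ i) \<kappa> 0 * (y - 0) ^ i / fact i))
        \<le> B * cmod (y - 0) ^ Suc 1 / fact 1"
    proof (rule complex_Taylor[of "cball 0 r1"])
      fix i :: nat and x assume x: "x \<in> cball (0::complex) r1" "i \<le> 1"
      have "(deriv ^^ i) \<kappa> holomorphic_on ball 0 r0"
        using r0(2) by (intro holomorphic_higher_deriv) auto
      then have "((deriv ^^ i) \<kappa> has_field_derivative deriv ((deriv ^^ i) \<kappa>) x) (at x)"
        using x(1) r1(2) by (intro holomorphic_derivI[of _ "ball 0 r0"]) blast+
      then show "((deriv ^^ i) \<kappa> has_field_derivative (deriv ^^ Suc i) \<kappa> x) (at x within cball 0 r1)"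
        by (simp add: has_field_derivative_at_within)
    qed (use r1 that B(2) in auto)
    then show ?thesis by (simp add: k0 d power2_eq_square)
  qed
  \<comment> \<open>On this disc the quadratic error is at most \<open>(q - s) * cmod y\<close>, so
    that \<open>\<kappa>\<close> contracts by the factor \<open>q\<close>.\<close>
  define r where "r = min r1 ((q - s) / B)"
  have r: "r > 0" "r \<le> r1" "B * r \<le> q - s"
    using r1(1) q(1) B(1) by (auto simp: r_def min_def field_simps)
  have hol: "\<kappa> holomorphic_on ball 0 r" using r0(2) r(2) r1(2)
    by (meson ball_subset_cball holomorphic_on_subset order_trans subset_cball)
  have contr: "cmod (\<kappa> y) \<le> q * cmod y" if "cmod y < r" for y
  proof -
    have "cmod (\<kappa> y) \<le> cmod (\<mu> * y) + cmod (\<kappa> y - \<mu> * y)" by norm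
    also have "\<dots> \<le> s * cmod y + B * (cmod y)\<^sup>2"
      using tay[of y] that r(2) by (simp add: s_def norm_mult)
    also have "B * (cmod y)\<^sup>2 \<le> (B * r) * cmod y"
      using that B(1) by (simp add: power2_eq_square mult_left_mono mult_right_mono)
    also have "\<dots> \<le> (q - s) * cmod y" using r(3) by (intro mult_right_mono) auto
    finally show ?thesis by (simp add: algebra_simps)
  qed
  have it: "(\<kappa> ^^ n) holomorphic_on ball 0 r \<and> (\<forall>y\<in>ball 0 r. cmod ((\<kappa> ^^ n) y) \<le> q ^ n * cmod y \<and> cmod ((\<kappa> ^^ n) y) < r)" for n
  proof (induction n)
    case (Suc n)
    have "\<kappa> \<circ> (\<kappa> ^^ n) holomorphic_on ball 0 r"
      using Suc hol by (intro holomorphic_on_compose_gen) (auto)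
    moreover have "cmod ((\<kappa> ^^ Suc n) y) \<le> q ^ Suc n * cmod y \<and> cmod ((\<kappa> ^^ Suc n) y) < r" if "y \<in> ball 0 r" for y
    proof -
      have y: "cmod ((\<kappa> ^^ n) y) \<le> q ^ n * cmod y" "cmod ((\<kappa> ^^ n) y) < r" using Suc that by auto
      have a: "cmod ((\<kappa> ^^ Suc n) y) \<le> q * cmod ((\<kappa> ^^ n) y)" using contr[OF y(2)] by simp
      also have "\<dots> \<le> q * (q ^ n * cmod y)" using y(1) q(3) by (intro mult_left_mono) auto
      finally have 1: "cmod ((\<kappa> ^^ Suc n) y) \<le> q ^ Suc n * cmod y" by simp
      have "q * cmod ((\<kappa> ^^ n) y) \<le> cmod ((\<kappa> ^^ n) y)"
        using q2(2) q(3) by (simp add: mult_left_le_one_le)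
      then show ?thesis using 1 a y(2) by linarith
    qed
    ultimately show ?case by (simp add: o_def)
  qed simp
  have mu0: "\<mu> \<noteq> 0" using mu(1) by auto
  define L' where "L' = (\<lambda>n y. (\<kappa> ^^ n) y / \<mu> ^ n)"
  have L'hol: "L' n holomorphic_on ball 0 r" for n
    unfolding L'_def using it[of n] mu0 by (intro holomorphic_intros) auto
  let ?D = "\<lambda>n y. L' (Suc n) y - L' n y"
  have "cmod (?D n y) \<le> B * r\<^sup>2 / s * (q\<^sup>2 / s) ^ n" if "y \<in> ball 0 r" for n y
  proof -
    let ?Y = "(\<kappa> ^^ n) y"
    have Y: "cmod ?Y \<le> q ^ n * cmod y" "cmod ?Y < r" using it[of n] that by auto
    have "?D n y = (\<kappa> ?Y - \<mu> * ?Y) / \<mu> ^ Suc n"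
      using mu0 by (simp add: L'_def diff_divide_distrib)
    then have "cmod (?D n y) = cmod (\<kappa> ?Y - \<mu> * ?Y) / s ^ Suc n"
      by (simp add: norm_divide norm_power norm_mult s_def)
    also have "\<dots> \<le> B * (cmod ?Y)\<^sup>2 / s ^ Suc n"
      using tay[of ?Y] Y(2) r(2) s by (intro divide_right_mono) auto
    also have "\<dots> \<le> B * (q ^ n * r)\<^sup>2 / s ^ Suc n"
    proof -
      have "cmod ?Y \<le> q ^ n * r"
        using Y(1) that q(3) by (meson less_imp_le mem_ball_0 mult_left_mono order_trans zero_le_power)
      then show ?thesis using B(1) s
        by (intro divide_right_mono mult_left_mono power_mono) auto
    qed
    also have "\<dots> = B * r\<^sup>2 / s * (q\<^sup>2 / s) ^ n"
      by (simp add: power_mult_distrib power_divide power_mult[symmetric] mult.commute)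
    finally show ?thesis .
  qed
  moreover have "summable (\<lambda>n. B * r\<^sup>2 / s * (q\<^sup>2 / s) ^ n)"
    using q2 by (intro summable_mult summable_geometric) auto
  ultimately have "uniform_limit (ball 0 r) (\<lambda>n y. \<Sum>i<n. ?D i y) (\<lambda>y. suminf (\<lambda>i. ?D i y)) sequentially"
    by (rule Weierstrass_m_test)
  then have "uniform_limit (ball 0 r) (\<lambda>n y. (\<Sum>i<n. ?D i y) + y) (\<lambda>y. suminf (\<lambda>i. ?D i y) + y) sequentially"
    by (rule uniform_limit_add) (rule uniform_limit_const)
  moreover have "(\<Sum>i<n. ?D i y) + y = L' n y" for n y
    using sum_lessThan_telescope[of "\<lambda>i. L' i y" n] by (simp add: L'_def)
  ultimately obtain L where lim: "uniform_limit (ball 0 r) L' L sequentially"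
    by auto
  have pt: "(\<lambda>n. L' n y) \<longlonglongrightarrow> L y" if "cmod y < r" for y
    using tendsto_uniform_limitI[OF lim] that by auto
  have hL: "L holomorphic_on ball 0 r"
  proof (rule holomorphic_uniform_sequence[OF open_ball L'hol])
    fix x :: complex assume "x \<in> ball 0 r"
    then obtain e where "e > 0" "cball x e \<subseteq> ball 0 r" by (meson open_ball open_contains_cball)
    then show "\<exists>d>0. cball x d \<subseteq> ball 0 r \<and> uniform_limit (cball x d) L' L sequentially"
      using uniform_limit_on_subset[OF lim] by blast
  qed
  have kn0: "(\<kappa> ^^ n) 0 = 0" for n by (induction n) (auto simp: k0)
  have dn: "deriv (L' n) 0 = 1" for n
  proof -
    have "((\<kappa> ^^ n) has_field_derivative \<mu> ^ n) (at 0)"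
    proof (induction n)
      case (Suc n)
      have "(\<kappa> has_field_derivative \<mu>) (at ((\<kappa> ^^ n) 0))"
        using an d by (simp add: kn0 analytic_on_imp_differentiable_at DERIV_deriv_iff_field_differentiable flip: d)
      from DERIV_chain[OF this Suc] show ?case by (simp add: o_def)
    qed (simp add: id_def)
    then show ?thesis
      unfolding L'_def using mu0 by (intro DERIV_imp_deriv) (auto intro!: derivative_eq_intros)
  qed
  show ?thesis
  proof (rule that)
    show "L analytic_on {0}" using hL r(1) by (auto simp: analytic_at_ball)
    show "L 0 = 0" using pt[of 0] r(1) by (simp add: L'_def kn0 LIMSEQ_const_iff)
    have "(\<lambda>n. deriv (L' n) 0) \<longlonglongrightarrow> deriv L 0"
      using lim L'hol r(1) by (intro deriv_complex_uniform_limit) auto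
    then show "deriv L 0 = 1" by (simp add: dn LIMSEQ_const_iff)
    have "L (\<kappa> y) = \<mu> * L y" if y: "y \<in> ball 0 r" for y
    proof (rule LIMSEQ_unique)
      have "cmod (\<kappa> y) < r" using it[of 1] y by auto
      then show "(\<lambda>n. L' n (\<kappa> y)) \<longlonglongrightarrow> L (\<kappa> y)" by (rule pt)
      have "(\<lambda>n. \<mu> * L' (Suc n) y) \<longlonglongrightarrow> \<mu> * L y"
        using y by (intro tendsto_intros LIMSEQ_Suc pt) auto
      moreover have "\<mu> * L' (Suc n) y = L' n (\<kappa> y)" for n
        using mu0 by (simp add: L'_def funpow_swap1)
      ultimately show "(\<lambda>n. L' n (\<kappa> y)) \<longlonglongrightarrow> \<mu> * L y" by simp
    qed
    then show "\<forall>\<^sub>F y in nhds 0. L (\<kappa> y) = \<mu> * L y"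
      unfolding eventually_nhds_metric using r(1) by (auto simp: dist_commute)
  qed
qed

lemma sph_map_at_funpow:
  assumes "g \<in> Rat"
  shows "sph_map_at (g ^^ n) x"
proof (induction n arbitrary: x)
  case 0
  have "id = mob 1 0 0 1"
  proof
    fix x show "id x = mob 1 0 0 1 x"
      by (rule sphere_quot_cases[of x]) (simp add: mob_sphere_quot)
  qed
  then have "id \<in> Rat" using mob_Rat[of 1 1 0 0] by simp
  then show ?case using Rat_sph_map_at[of id] by (simp add: id_def)
next
  case (Suc n)
  have "sph_map_at (g \<circ> (g ^^ n)) x"
    using Suc assms Rat_sph_map_at by (intro sph_map_at_comp) auto
  then show ?case by (simp add: o_def)
qed

text \<open>The inverse branch of \<open>g\<close> at the fixed point is a contraction and can be
  linearised; inverting its linearisation gives the germ of \<open>\<phi>\<close>. The functional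
  equation spreads the germ over the plane, because division by powers of \<open>lam\<close> brings
  every point close to 0.\<close>

theorem Koenigs:
  assumes g: "g \<in> Rat" and fix0: "g (Fin 0) = Fin 0" and rep: "sph_deriv_norm g (Fin 0) > 1"
  obtains lam \<phi> where "cmod lam > 1" "\<And>z. sph_holo \<phi> z" "\<phi> 0 = Fin 0" "sd \<phi> 0 \<noteq> 0"
    "\<And>z. \<phi> (lam * z) = g (\<phi> z)"
proof -
  let ?H = "\<lambda>u. g (Fin u)"
  have holo: "sph_holo ?H 0"
    using Rat_sph_map_at[OF g, of "Fin 0"] by (simp add: sph_map_at_def chart_at_def)
  define G where "G = sph_repr ?H 0"
  have G: "G analytic_on {0}" "\<forall>\<^sub>F u in nhds 0. g (Fin u) = Fin (G u)"
    by (rule sph_holoE[OF holo], use fix0 in \<open>simp add: G_def chart_at_def\<close>)+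
  have G0: "G 0 = 0" by (simp add: G_def sph_repr_def fix0 chart_at_def)
  define lam where "lam = deriv G 0"
  have "sd ?H 0 = cmod lam"
    using G0 by (simp add: sd_def lam_def flip: G_def)
  then have lam: "cmod lam > 1"
    using rep by (simp add: sph_deriv_norm_eq_sd chart_at_def)
  then have l0: "lam \<noteq> 0" by auto
  obtain \<kappa> where k: "\<kappa> analytic_on {0}" "\<kappa> 0 = 0" "\<forall>\<^sub>F y in nhds 0. G (\<kappa> y) = y" "deriv \<kappa> 0 * lam = 1"
    using analytic_local_inverse[OF G(1)] l0 unfolding lam_def G0 by metis
  have dk: "deriv \<kappa> 0 = 1 / lam" using k(4) l0 by (simp add: field_simps)
  obtain L where L: "L analytic_on {0}" "L 0 = 0" "deriv L 0 = 1" "\<forall>\<^sub>F y in nhds 0. L (\<kappa> y) = (1 / lam) * L y"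
    using Koenigs_contraction[OF k(1,2) dk] lam l0 by (auto simp: norm_divide)
  obtain \<psi> where p: "\<psi> analytic_on {0}" "\<psi> 0 = 0" "\<forall>\<^sub>F y in nhds 0. L (\<psi> y) = y"
      "\<forall>\<^sub>F x in nhds 0. \<psi> (L x) = x" "deriv \<psi> 0 = 1"
    using analytic_local_inverse[OF L(1)] L(2,3) by auto
  have pc: "isCont \<psi> 0" and kc: "isCont \<kappa> 0" using p(1) k(1) by (auto intro: analytic_at_imp_isCont)
  have "isCont (\<lambda>z. z / lam) 0" by (intro continuous_intros) (use l0 in auto)
  then have sc: "\<forall>\<^sub>F z in nhds 0. P (z / lam)" if "\<forall>\<^sub>F z in nhds 0. P z" for P
    using eventually_nhds_isCont[where f = "\<lambda>z. z / lam" and z = 0 and P = P] that by simp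
  have e1: "\<forall>\<^sub>F z in nhds 0. P (\<psi> z)" if "\<forall>\<^sub>F z in nhds 0. P z" for P
    using eventually_nhds_isCont[OF pc] that p(2) by simp
  have e2: "\<forall>\<^sub>F z in nhds 0. P (\<kappa> z)" if "\<forall>\<^sub>F z in nhds 0. P z" for P
    using eventually_nhds_isCont[OF kc] that k(2) by simp
  have an: "\<forall>\<^sub>F z in nhds 0. \<psi> analytic_on {z}"
  proof -
    obtain S where "open S" "0 \<in> S" "\<psi> holomorphic_on S" using p(1) analytic_at by blast
    then show ?thesis unfolding eventually_nhds by (auto intro: holomorphic_on_imp_analytic_at)
  qed
  have "\<forall>\<^sub>F z in nhds 0. \<psi> analytic_on {z} \<and> g (Fin (\<psi> (z / lam))) = Fin (\<psi> z)"
    using an e1[OF L(4)] p(3) e1[OF e2[OF p(4)]] e1[OF k(3)] sc[OF e1[OF G(2)]]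
  proof eventually_elim
    case (elim z)
    have "\<psi> (z / lam) = \<kappa> (\<psi> z)" using elim(2-4) by simp
    then show ?case using elim by simp
  qed
  then obtain r where r: "r > 0" "\<And>z. cmod z < r \<Longrightarrow> \<psi> analytic_on {z}"
      "\<And>z. cmod z < r \<Longrightarrow> g (Fin (\<psi> (z / lam))) = Fin (\<psi> z)"
    unfolding eventually_nhds_metric by auto
  \<comment> \<open>Near 0 the germ satisfies the functional equation, so all sufficiently large
    \<open>n\<close> give the same value; \<open>\<phi>\<close> takes the least admissible
    one.\<close>
  define \<Phi> where "\<Phi> = (\<lambda>n z. (g ^^ n) (Fin (\<psi> (z / lam ^ n))))"
  have step: "\<Phi> (Suc n) z = \<Phi> n z" if "cmod (z / lam ^ n) < r" for n z
  proof -
    have "z / lam ^ Suc n = z / lam ^ n / lam" by (simp add: mult.commute)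
    then show ?thesis by (simp only: \<Phi>_def funpow_Suc_right o_apply r(3)[OF that])
  qed
  have mono: "cmod (z / lam ^ m) < r" if "cmod (z / lam ^ n) < r" "n \<le> m" for z n m
  proof -
    have "cmod lam ^ n \<le> cmod lam ^ m" using that lam by (intro power_increasing) auto
    moreover have "0 < cmod lam ^ n" using l0 by simp
    ultimately have "cmod (z / lam ^ m) \<le> cmod (z / lam ^ n)"
      by (simp add: norm_divide norm_power frac_le)
    then show ?thesis using that by simp
  qed
  have ind: "\<Phi> m z = \<Phi> n z" if "cmod (z / lam ^ n) < r" "n \<le> m" for n m z
    using that(2)
  proof (induction m rule: dec_induct)
    case (step m)
    then show ?case using \<open>\<And>n z. cmod (z / lam ^ n) < r \<Longrightarrow> \<Phi> (Suc n) z = \<Phi> n z\<close> mono[OF that(1)] by auto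
  qed simp
  have ex: "\<exists>n. cmod (z / lam ^ n) < r" for z
  proof -
    have "(\<lambda>n. cmod z * (1 / cmod lam) ^ n) \<longlonglongrightarrow> cmod z * 0"
      using lam by (intro tendsto_intros LIMSEQ_realpow_zero) (auto simp: divide_less_eq)
    then have "\<forall>\<^sub>F n in sequentially. cmod z * (1 / cmod lam) ^ n < r"
      using r(1) by (intro order_tendstoD) auto
    then have "\<forall>\<^sub>F n in sequentially. cmod (z / lam ^ n) < r"
      by eventually_elim (simp add: norm_divide norm_power power_divide)
    then show ?thesis by (auto simp: eventually_sequentially)
  qed
  define \<phi> where "\<phi> = (\<lambda>z. \<Phi> (LEAST n. cmod (z / lam ^ n) < r) z)"
  have phi: "\<phi> z = \<Phi> n z" if "cmod (z / lam ^ n) < r" for z n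
    unfolding \<phi>_def using that by (intro ind[symmetric] LeastI[of "\<lambda>n. cmod (z / lam ^ n) < r"] Least_le)
  show ?thesis
  proof (rule that[OF lam])
    show holo\<phi>: "sph_holo \<phi> z" for z
    proof -
      obtain n where n: "cmod (z / lam ^ n) < r" using ex by blast
      let ?k = "\<lambda>u. \<psi> (u / lam ^ n)"
      have "(\<lambda>u. u / lam ^ n) analytic_on {z}" using l0 by (intro analytic_intros) auto
      then have an: "?k analytic_on {z}"
        using analytic_on_compose[of "\<lambda>u. u / lam ^ n" "{z}" \<psi>] r(2)[OF n] by (simp add: o_def)
      have "sph_holo (\<lambda>u. Fin (?k u)) z" by (rule sph_holo_intro[where c = id, OF an]) auto
      then have h: "sph_holo (\<lambda>u. (g ^^ n) (Fin (?k u))) z"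
        using sph_holo_compose(1)[where g = "g ^^ n"] sph_map_at_funpow[OF g] by blast
      have "open {u. cmod (u / lam ^ n) < r}" using l0 by (intro open_Collect_less continuous_intros) auto
      then have "\<forall>\<^sub>F u in nhds z. cmod (u / lam ^ n) < r" using n by (auto simp: eventually_nhds)
      then have ev: "\<forall>\<^sub>F u in nhds z. \<phi> u = (g ^^ n) (Fin (?k u))"
        by eventually_elim (simp add: phi \<Phi>_def)
      show ?thesis using h sph_holo_cong(1)[OF ev] by simp
    qed
    show "\<phi> 0 = Fin 0" using phi[of 0 0] r(1) by (simp add: \<Phi>_def p(2))
    have "\<forall>\<^sub>F u in nhds 0. cmod u < r"
      unfolding eventually_nhds_metric using r(1) by auto
    then have "\<forall>\<^sub>F u in nhds 0. \<phi> u = id (Fin (\<psi> u))"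
      by eventually_elim (use phi[where n = 0] in \<open>simp add: \<Phi>_def\<close>)
    then have "sd \<phi> 0 = cmod (deriv \<psi> 0) / (1 + (cmod (\<psi> 0))\<^sup>2)"
      by (intro sd_eq[OF p(1)]) auto
    then show "sd \<phi> 0 \<noteq> 0" by (simp add: p(2,5))
    show "\<phi> (lam * z) = g (\<phi> z)" for z
    proof -
      obtain n where n: "cmod (z / lam ^ n) < r" using ex by blast
      have "(lam * z) / lam ^ Suc n = z / lam ^ n" using l0 by simp
      then show ?thesis using phi[of "lam * z" "Suc n"] phi[OF n] n by (simp add: \<Phi>_def)
    qed
  qed
qed

subsection \<open>Holomorphic maps from the plane to the sphere\<close>

lemma sph_holo_finite_analytic:
  assumes "sph_holo H z" "H z \<noteq> Infty"
  shows "(\<lambda>u. to_complex (H u)) analytic_on {z}"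
  using sph_holo_repr(1)[OF assms(1)] assms(2) by (simp add: sph_repr_def chart_at_def)

lemma sph_holo_finite_holomorphic:
  assumes "\<And>z. z \<in> S \<Longrightarrow> sph_holo H z" "\<And>z. z \<in> S \<Longrightarrow> H z \<noteq> Infty"
  shows "(\<lambda>u. to_complex (H u)) holomorphic_on S"
  using sph_holo_finite_analytic assms
  by (meson analytic_imp_holomorphic analytic_on_analytic_at)

lemma sd_const [simp]: "sd (\<lambda>z. c) z = 0"
  by (simp add: sd_def sph_repr_def)

lemma sph_Picard:
  assumes holo: "\<And>z. sph_holo F z" and q: "distinct [q1, q2, q3]"
    and omit: "\<And>z. F z \<noteq> q1 \<and> F z \<noteq> q2 \<and> F z \<noteq> q3"
  shows "\<exists>c. F = (\<lambda>z. c)"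
proof -
  obtain M where M: "M \<in> Aut_sphere" "M q2 = Fin 0" "M q1 = Infty"
    using ex_Aut_0_Infty[of q2 q1] q by auto
  have inj: "M x = M y \<longleftrightarrow> x = y" for x y using Aut_sphereD(3)[OF M(1)] by metis
  have MF: "sph_holo (\<lambda>u. M (F u)) z" for z
    using holo Rat_sph_map_at[OF Aut_sphereD(1)[OF M(1)]] by (rule sph_holo_compose(1))
  have ninf: "M (F z) \<noteq> Infty" for z using omit[of z] inj M(3) by metis
  let ?h = "\<lambda>u. to_complex (M (F u))"
  have "?h holomorphic_on UNIV" using MF ninf by (intro sph_holo_finite_holomorphic)
  moreover have h: "Fin (?h z) = M (F z)" for z using ninf by (simp add: Fin_to_complex)
  have q3: "M q3 \<noteq> Infty" "M q3 \<noteq> Fin 0" using inj M q by (metis distinct_length_2_or_more)+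
  have "0 \<noteq> to_complex (M q3)" using q3 by (cases "M q3") auto
  moreover have "range ?h \<inter> {0, to_complex (M q3)} = {}"
  proof -
    have "?h z \<noteq> 0 \<and> ?h z \<noteq> to_complex (M q3)" for z
      using h[of z] omit[of z] inj M(2) q3(1) by (metis Fin_to_complex)
    then have "x \<notin> {0, to_complex (M q3)}" if "x \<in> range ?h" for x using that by force
    then show ?thesis by blast
  qed
  ultimately obtain c where "?h = (\<lambda>z. c)" by (rule little_Picard)
  then have "M (F z) = Fin c" for z using h by metis
  then have "F z = inv M (Fin c)" for z by (metis Aut_sphereD(3) M(1))
  then show ?thesis by blast
qed

text \<open>A nonempty open set contains three points, so the little Picard theorem applies.\<close>

lemma sph_Liouville:
  assumes holo: "\<And>z. sph_holo F z" and "open U" "y \<in> U" and omit: "\<And>z. F z \<notin> U"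
  shows "\<exists>c. F = (\<lambda>z. c)"
proof -
  have "infinite U"
  proof
    assume "finite U"
    then have fU: "finite {w. chart_at y (Fin w) \<in> U}"
      by (rule finite_vimageI[of U "\<lambda>w. chart_at y (Fin w)", unfolded vimage_def])
         (rule injI, metis chart_at_chart_at riemann_sphere.inject)
    have "open ((\<lambda>w. chart_at y (Fin w)) -` U)"
      using assms(2) continuous_on_compose[OF continuous_Fin[of UNIV] continuous_chart_at]
      by (intro open_vimage) (auto simp: o_def)
    moreover have "to_complex (chart_at y y) \<in> (\<lambda>w. chart_at y (Fin w)) -` U" using assms(3) by simp
    ultimately show False using fU finite_imp_not_open unfolding vimage_def by blast
  qed
  then obtain A where A: "A \<subseteq> U" "finite A" "card A = 3" by (meson infinite_arbitrarily_large)
  then obtain q1 q2 q3 where "A = {q1, q2, q3}" "distinct [q1, q2, q3]"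
    by (auto simp: card_3_iff)
  then show ?thesis using A(1) omit by (intro sph_Picard[OF holo]) auto
qed

subsection \<open>Linearisation at a repelling fixed point\<close>

text \<open>\<open>J\<close> stands for a fibrewise Julia set, moved so that the fixed point is 0.
  The assumption \<open>periodic\<close> concerns repelling cycles wherever they lie: in the
  application these are in the Julia set automatically.\<close>

locale linearised =
  fixes g :: "riemann_sphere \<Rightarrow> riemann_sphere" and J :: "riemann_sphere set"
    and lam :: complex and \<phi> :: "complex \<Rightarrow> riemann_sphere"
  assumes gRat: "g \<in> Rat" and deg: "rat_degree g \<ge> 2"
    and closedJ: "closed J" and backJ: "\<And>x. g x \<in> J \<Longrightarrow> x \<in> J"
    and nondeg: "\<And>x. x \<in> J \<Longrightarrow> sph_deriv_norm g x \<noteq> 0"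
    and zeroJ: "Fin 0 \<in> J" and fix0: "g (Fin 0) = Fin 0"
    and periodic: "\<And>x n. n \<ge> 1 \<Longrightarrow> (g ^^ n) x = x \<Longrightarrow> sph_deriv_norm (g ^^ n) x > 1 \<Longrightarrow>
      sph_deriv_norm (g ^^ n) x = sph_deriv_norm g (Fin 0) ^ n"
    and lam: "cmod lam > 1" and holo: "\<And>z. sph_holo \<phi> z"
    and phi0: "\<phi> 0 = Fin 0" and sd0: "sd \<phi> 0 \<noteq> 0"
    and funeq: "\<And>z. \<phi> (lam * z) = g (\<phi> z)"
begin

lemma lam0: "lam \<noteq> 0"
  using lam by auto

lemma funeq_pow: "\<phi> (lam ^ n * z) = (g ^^ n) (\<phi> z)"
  by (induction n arbitrary: z) (auto simp: funeq mult.assoc)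

lemma sd_scale:
  "sd (\<lambda>u. \<phi> (c * u)) z = sd \<phi> (c * z) * cmod c"
  using sph_holo_compose_analytic(2)[of "\<lambda>u. c * u" z \<phi>] holo by (simp add: analytic_intros)

lemma sd_funeq_pow: "sph_deriv_norm (g ^^ n) (\<phi> z) * sd \<phi> z = cmod lam ^ n * sd \<phi> (lam ^ n * z)"
proof -
  have "sd (\<lambda>u. (g ^^ n) (\<phi> u)) z = sd \<phi> (lam ^ n * z) * cmod lam ^ n"
    using sd_scale[of "lam ^ n" z] by (simp only: funeq_pow norm_power)
  then show ?thesis
    using sph_holo_compose(2)[OF holo sph_map_at_funpow[OF gRat], of n z] by (simp add: mult.commute)
qed

lemma deriv_fixed_point: "sph_deriv_norm g (Fin 0) = cmod lam"
  using sd_funeq_pow[of 1 0] sd0 by (simp add: phi0)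

lemma backJ_pow: "(g ^^ n) x \<in> J \<Longrightarrow> x \<in> J"
  by (induction n) (auto intro: backJ)

lemma nondeg_pow: "(g ^^ n) x \<in> J \<Longrightarrow> sph_deriv_norm (g ^^ n) x \<noteq> 0"
proof (induction n)
  case (Suc n)
  have "(g ^^ n) x \<in> J" using Suc.prems by (simp add: backJ)
  then show ?case
    using Suc sph_map_at_comp(2)[OF sph_map_at_funpow[OF gRat] Rat_sph_map_at[OF gRat], of n x] nondeg
    by (simp add: o_def)
qed (simp add: id_def[symmetric])

lemma scale_tendsto: "(\<lambda>n. z / lam ^ n) \<longlonglongrightarrow> 0"
proof -
  have "(\<lambda>n. z * (1 / lam) ^ n) \<longlonglongrightarrow> z * 0"
    using lam by (intro tendsto_intros LIMSEQ_power_zero) (auto simp: norm_divide divide_less_eq)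
  then show ?thesis by (simp add: power_divide)
qed

text \<open>\<open>\<phi>\<close> is an immersion near 0, and \<open>g ^^ n\<close> carries
  \<open>\<phi> (z / lam ^ n)\<close> to \<open>\<phi> z\<close>. By backward invariance that point
  lies in \<open>J\<close>, and \<open>g ^^ n\<close> is not critical there.\<close>

lemma sd_nonzero: "\<phi> z \<in> J \<Longrightarrow> sd \<phi> z \<noteq> 0"
proof -
  assume J: "\<phi> z \<in> J"
  have "(\<lambda>n. sd \<phi> (z / lam ^ n)) \<longlonglongrightarrow> sd \<phi> 0"
    using isCont_sd[OF holo] scale_tendsto by (rule isCont_tendsto_compose)
  then have "\<forall>\<^sub>F n in sequentially. sd \<phi> (z / lam ^ n) \<noteq> 0"
    using sd0 by (rule tendsto_imp_eventually_ne)
  then obtain n where n: "sd \<phi> (z / lam ^ n) \<noteq> 0" by (auto simp: eventually_sequentially)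
  have e: "lam ^ n * (z / lam ^ n) = z" using lam0 by simp
  then have "(g ^^ n) (\<phi> (z / lam ^ n)) \<in> J" using J funeq_pow[of n "z / lam ^ n"] by simp
  then have "sph_deriv_norm (g ^^ n) (\<phi> (z / lam ^ n)) \<noteq> 0" by (rule nondeg_pow)
  then show ?thesis using n sd_funeq_pow[of n "z / lam ^ n"] e by auto
qed

lemma nonconst: "\<phi> \<noteq> (\<lambda>z. c)"
  using sd0 by auto

text \<open>The fixed point is not critical, so 0 is a simple root of the numerator. With degree at
  least 2, another root remains, possibly at \<open>Infty\<close>.\<close>

lemma ex_other_preimage: "\<exists>q. q \<noteq> Fin 0 \<and> g q = Fin 0"
proof -
  obtain P Q n where g: "g = ratmap P Q" "coprime P Q" "n = max (degree P) (degree Q)" "n \<ge> 1"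
    "rat_degree g = n" using gRat by (rule RatE)
  have n: "n \<ge> 2" using g(5) deg by simp
  have P0: "poly P 0 = 0" using fix0 by (auto simp: g(1) sphere_quot_def split: if_splits)
  show ?thesis
  proof (cases "degree P \<le> 1")
    case True
    then have "degree Q = n" "coeff P n = 0" using g(3) n by (auto intro: coeff_eq_0)
    then have "g Infty = Fin 0"
      using n by (auto simp: g(1) Let_def sphere_quot_def simp flip: g(3))
    then show ?thesis by blast
  next
    case False
    obtain R where R: "P = [:0, 1:] * R" using P0 by (auto simp: poly_eq_0_iff_dvd elim!: dvdE)
    then have "degree R \<noteq> 0" using False by (auto simp: degree_mult_eq split: if_splits)
    then obtain z where z: "poly R z = 0" by (rule ex_poly_root)
    have "z \<noteq> 0"
    proof
      assume "z = 0"
      have "poly P = (\<lambda>u. u * poly R u)" using R by auto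
      then have "deriv (poly P) 0 = poly R 0"
        by (intro DERIV_imp_deriv) (auto intro!: derivative_eq_intros poly_DERIV)
      then have dP: "deriv (poly P) 0 = 0" using z \<open>z = 0\<close> by simp
      have "sd (\<lambda>u. sphere_quot (poly P u) (poly Q u)) 0 = 0"
        using sph_holo_sphere_quot(2)[of "poly P" 0 "poly Q"] coprime_no_common_root[OF g(2), of 0]
        by (simp add: analytic_poly dP P0)
      then have "sph_deriv_norm g (Fin 0) = 0"
        by (simp add: sph_deriv_norm_eq_sd chart_at_def g(1))
      then show False using nondeg zeroJ by blast
    qed
    moreover have "g (Fin z) = Fin 0"
      using z R coprime_no_common_root[OF g(2), of z] by (auto simp: g(1) sphere_quot_def)
    ultimately show ?thesis by (intro exI[of _ "Fin z"]) simp
  qed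
qed

text \<open>Otherwise \<open>\<phi>\<close> omits \<open>q1\<close>, since
  \<open>\<phi> z = q1\<close> gives \<open>\<phi> (lam * z) = Fin 0\<close> and hence
  \<open>z = 0\<close>. It then omits the successive preimages \<open>q2\<close> and
  \<open>q3\<close> too, against Picard.\<close>

lemma ex_nonzero_preimage: "\<exists>w. w \<noteq> 0 \<and> \<phi> w = Fin 0"
proof (rule ccontr)
  assume "\<not> ?thesis"
  then have only: "\<phi> w = Fin 0 \<Longrightarrow> w = 0" for w by blast
  obtain q1 where q1: "q1 \<noteq> Fin 0" "g q1 = Fin 0" using ex_other_preimage by blast
  obtain q2 where q2: "g q2 = q1" using Rat_surj[OF gRat] by blast
  obtain q3 where q3: "g q3 = q2" using Rat_surj[OF gRat] by blast
  have o1: "\<phi> z \<noteq> q1" for z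
  proof
    assume "\<phi> z = q1"
    then have "lam * z = 0" using only[of "lam * z"] by (simp add: funeq q1)
    then show False using lam0 \<open>\<phi> z = q1\<close> q1 phi0 by simp
  qed
  then have o2: "\<phi> z \<noteq> q2" for z using funeq[of z] q2 by metis
  then have o3: "\<phi> z \<noteq> q3" for z using funeq[of z] q3 by metis
  have "q1 \<noteq> q2" "q2 \<noteq> q3" "q1 \<noteq> q3" using q1 q2 q3 fix0 by auto
  then have "\<exists>c. \<phi> = (\<lambda>z. c)" using o1 o2 o3 by (intro sph_Picard[OF holo, of q1 q2 q3]) auto
  then show False using nonconst by blast
qed

lemma phi_preimage_lift:
  assumes "\<phi> w = Fin 0"
  obtains j where "j analytic_on {0}" "j 0 = w" "\<forall>\<^sub>F y in nhds 0. \<phi> (j y) = \<phi> y"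
proof -
  have "sd \<phi> w \<noteq> 0" using sd_nonzero assms zeroJ by simp
  then show ?thesis
    using that sph_holo_lift[OF holo holo, of w 0] assms phi0 by auto
qed

text \<open>The homoclinic point \<open>w\<close> is a limit of points \<open>z n = lam ^ n * y n\<close> with \<open>\<phi> (z n) = \<phi> (y n)\<close>;
  these come from periodic points, whose multipliers are known.\<close>

lemma sd_at_preimage:
  assumes w: "\<phi> w = Fin 0"
  shows "sd \<phi> w = sd \<phi> 0"
proof (cases "w = 0")
  case False
  obtain j where j: "j analytic_on {0}" "j 0 = w" "\<forall>\<^sub>F y in nhds 0. \<phi> (j y) = \<phi> y"
    using phi_preimage_lift[OF w] .
  \<comment> \<open>A cycle arises from \<open>lam ^ n * y = j y\<close>, that is,
    \<open>y / j y = 1 / lam ^ n\<close>. Since \<open>j 0 = w\<close> is not 0, this quotient is a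
    local coordinate at 0, and its inverse gives the solutions \<open>y n\<close>.\<close>
  let ?m = "\<lambda>y. y / j y"
  have m: "?m analytic_on {0}" using j(1,2) False by (intro analytic_intros) auto
  have jd: "(j has_field_derivative deriv j 0) (at 0)"
    using j(1) by (simp add: DERIV_deriv_iff_field_differentiable analytic_on_imp_differentiable_at)
  have dm: "deriv ?m 0 = 1 / w"
    using False j(2) jd by (intro DERIV_imp_deriv) (auto intro!: derivative_eq_intros simp: field_simps)
  have "deriv ?m 0 \<noteq> 0" unfolding dm using False by simp
  then obtain \<mu> where "\<mu> analytic_on {?m 0}" "\<mu> (?m 0) = 0" "\<forall>\<^sub>F t in nhds (?m 0). ?m (\<mu> t) = t"
    by (rule analytic_local_inverse[OF m])
  then have mu: "\<mu> analytic_on {0}" "\<mu> 0 = 0" "\<forall>\<^sub>F t in nhds 0. ?m (\<mu> t) = t" by simp_all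
  define y where "y n = \<mu> (1 / lam ^ n)" for n
  have y: "y \<longlonglongrightarrow> 0"
    using isCont_tendsto_compose[OF analytic_at_imp_isCont[OF mu(1)] scale_tendsto[of 1]] mu(2)
    by (simp add: y_def[abs_def])
  have jy: "(\<lambda>n. j (y n)) \<longlonglongrightarrow> w"
    using isCont_tendsto_compose[OF analytic_at_imp_isCont[OF j(1)] y] j(2) by simp
  have s1: "(\<lambda>n. sd \<phi> (j (y n))) \<longlonglongrightarrow> sd \<phi> w"
    using isCont_tendsto_compose[OF isCont_sd[OF holo] jy] .
  have s2: "(\<lambda>n. sd \<phi> (y n)) \<longlonglongrightarrow> sd \<phi> 0"
    using isCont_tendsto_compose[OF isCont_sd[OF holo] y] .
  have pos: "sd \<phi> w > 0" "sd \<phi> 0 > 0"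
    using sd_nonzero[of w] sd0 w zeroJ sd_nonneg[of \<phi>] by (auto simp: less_le)
  have "(\<lambda>n. (1 / cmod lam) ^ n) \<longlonglongrightarrow> 0"
    using lam by (intro LIMSEQ_power_zero) (auto simp: divide_less_eq)
  \<comment> \<open>Positivity of this difference will say that the multiplier of the cycle through
    \<open>\<phi> (y n)\<close> exceeds 1, as \<open>periodic\<close> demands.\<close>
  then have "(\<lambda>n. sd \<phi> (j (y n)) - (1 / cmod lam) ^ n * sd \<phi> (y n)) \<longlonglongrightarrow> sd \<phi> w - 0 * sd \<phi> 0"
    by (intro tendsto_diff tendsto_mult s1 s2)
  then have "\<forall>\<^sub>F n in sequentially. 0 < sd \<phi> (j (y n)) - (1 / cmod lam) ^ n * sd \<phi> (y n)"
    using pos by (intro order_tendstoD(1)) auto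
  moreover have "\<forall>\<^sub>F n in sequentially. 0 < sd \<phi> (y n)" using s2 pos by (intro order_tendstoD(1))
  moreover have "\<forall>\<^sub>F n in sequentially. \<phi> (j (y n)) = \<phi> (y n)"
    by (rule eventually_compose_filterlim[OF j(3) y])
  moreover have "\<forall>\<^sub>F n in sequentially. ?m (y n) = 1 / lam ^ n"
    unfolding y_def by (rule eventually_compose_filterlim[OF mu(3) scale_tendsto])
  moreover have "\<forall>\<^sub>F n in sequentially. j (y n) \<noteq> 0" using jy False by (rule tendsto_imp_eventually_ne)
  moreover have "\<forall>\<^sub>F n in sequentially. (1::nat) \<le> n" by (rule eventually_ge_at_top)
  ultimately have "\<forall>\<^sub>F n in sequentially. sd \<phi> (j (y n)) = sd \<phi> (y n)"
  proof eventually_elim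
    case (elim n)
    have z: "lam ^ n * y n = j (y n)" using elim(4,5) lam0 by (simp add: field_simps)
    have fixp: "(g ^^ n) (\<phi> (y n)) = \<phi> (y n)" using funeq_pow[of n "y n"] z elim(3) by simp
    have mult: "sph_deriv_norm (g ^^ n) (\<phi> (y n)) * sd \<phi> (y n) = cmod lam ^ n * sd \<phi> (j (y n))"
      using sd_funeq_pow[of n "y n"] z by simp
    have ln: "cmod lam ^ n > 0" using lam0 by simp
    have "sd \<phi> (y n) < cmod lam ^ n * sd \<phi> (j (y n))"
      using elim(1) ln by (simp add: power_divide field_simps)
    then have "1 * sd \<phi> (y n) < sph_deriv_norm (g ^^ n) (\<phi> (y n)) * sd \<phi> (y n)"
      using mult by simp
    then have "1 < sph_deriv_norm (g ^^ n) (\<phi> (y n))" using elim(2) by (simp add: mult_less_cancel_right)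
    \<comment> \<open>With this multiplier, \<open>cmod lam ^ n\<close> cancels from
      \<open>mult\<close> and leaves equal derivatives at the two points.\<close>
    then have "sph_deriv_norm (g ^^ n) (\<phi> (y n)) = cmod lam ^ n"
      using periodic[OF elim(6) fixp] deriv_fixed_point by simp
    then show ?case using mult lam0 by auto
  qed
  then have "(\<lambda>n. sd \<phi> (y n)) \<longlonglongrightarrow> sd \<phi> w"
    using s1 by (rule Lim_transform_eventually[rotated])
  then show ?thesis using s2 LIMSEQ_unique by blast
qed simp

text \<open>The points that \<open>\<phi>\<close> maps into the backward orbit of the fixed point.
  Closed under division by \<open>lam\<close>, this set accumulates at 0 along each of its nonzero
  points; no further density is used.\<close>

definition hom_pts :: "complex set" where
  "hom_pts = {z. \<exists>n. \<phi> (lam ^ n * z) = Fin 0}"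

lemma hom_pts_J: "z \<in> hom_pts \<Longrightarrow> \<phi> z \<in> J"
  unfolding hom_pts_def using zeroJ backJ_pow by (auto simp: funeq_pow) metis

lemma hom_pts_scale: "z \<in> hom_pts \<Longrightarrow> z / lam ^ n \<in> hom_pts"
proof -
  assume "z \<in> hom_pts"
  then obtain m where "\<phi> (lam ^ m * z) = Fin 0" by (auto simp: hom_pts_def)
  then have "\<phi> (lam ^ (m + n) * (z / lam ^ n)) = Fin 0" using lam0 by (simp add: power_add)
  then show ?thesis unfolding hom_pts_def by blast
qed

lemma zero_hom_pts: "0 \<in> hom_pts" "\<phi> w = Fin 0 \<Longrightarrow> w \<in> hom_pts"
  unfolding hom_pts_def using phi0 by (auto intro: exI[of _ 0])

lemma hom_pts_cong: "v \<in> hom_pts \<Longrightarrow> \<phi> v' = \<phi> v \<Longrightarrow> v' \<in> hom_pts"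
  unfolding hom_pts_def using funeq_pow by auto

text \<open>Both points are pushed forward to zeros of \<open>\<phi>\<close>, where
  \<open>sd_at_preimage\<close> applies. The factor coming from \<open>g ^^ n\<close> is the same
  nonzero number for both, because it depends only on \<open>\<phi> v\<close>.\<close>

lemma sd_hom_pts_cong:
  assumes v: "v \<in> hom_pts" and eq: "\<phi> v' = \<phi> v"
  shows "sd \<phi> v' = sd \<phi> v"
proof -
  obtain n where n: "\<phi> (lam ^ n * v) = Fin 0" using v by (auto simp: hom_pts_def)
  then have n': "\<phi> (lam ^ n * v') = Fin 0" using eq by (simp add: funeq_pow)
  have "sph_deriv_norm (g ^^ n) (\<phi> v) \<noteq> 0"
    using n funeq_pow[of n v] zeroJ by (intro nondeg_pow) simp
  moreover have "sph_deriv_norm (g ^^ n) (\<phi> v) * sd \<phi> v' = sph_deriv_norm (g ^^ n) (\<phi> v) * sd \<phi> v"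
    using sd_funeq_pow[of n v] sd_funeq_pow[of n v'] sd_at_preimage[OF n] sd_at_preimage[OF n'] eq by simp
  ultimately show ?thesis by simp
qed

end

subsection \<open>Local symmetries of the linearisation\<close>

text \<open>If \<open>\<mu> ^ s k\<close> converges, the quotient of the terms with indices
  \<open>2 k\<close> and \<open>k\<close> tends to 1. Strict monotonicity of \<open>s\<close> makes
  the difference of the two exponents at least \<open>k\<close>.\<close>

lemma unimodular_recurrence:
  fixes \<mu> :: complex
  assumes "cmod \<mu> = 1"
  obtains r where "filterlim r at_top sequentially" "(\<lambda>k. \<mu> ^ r k) \<longlonglongrightarrow> 1"
proof -
  have "bounded (range (\<lambda>n. \<mu> ^ n))"
    using assms by (auto simp: bounded_iff norm_power intro!: exI[of _ 1])
  then obtain l s where s: "strict_mono (s :: nat \<Rightarrow> nat)" "((\<lambda>n. \<mu> ^ n) \<circ> s) \<longlonglongrightarrow> l"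
    using bounded_imp_convergent_subsequence by blast
  have "(\<lambda>k. cmod (\<mu> ^ s k)) \<longlonglongrightarrow> cmod l" using s(2) by (intro tendsto_norm) (simp add: o_def)
  then have l: "cmod l = 1" using assms by (simp add: norm_power LIMSEQ_const_iff)
  have gap: "s k + j \<le> s (k + j)" for k j
  proof (induction j)
    case (Suc j)
    have "s (k + j) < s (k + Suc j)" using s(1) by (simp add: strict_mono_less)
    then show ?case using Suc by simp
  qed simp
  define r where "r k = s (k + k) - s k" for k
  have rk: "k \<le> r k" for k using gap[of k k] by (simp add: r_def)
  have "filterlim r at_top sequentially"
    by (rule filterlim_at_top_mono[OF filterlim_ident]) (simp add: rk)
  moreover have "(\<lambda>k. \<mu> ^ r k) \<longlonglongrightarrow> 1"
  proof -
    have d: "filterlim (\<lambda>k::nat. k + k) at_top sequentially"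
      by (rule filterlim_at_top_mono[OF filterlim_ident]) simp
    have "(\<lambda>k. \<mu> ^ s (k + k)) \<longlonglongrightarrow> l"
      using filterlim_compose[OF s(2) d] by (simp add: o_def)
    moreover have "(\<lambda>k. \<mu> ^ s k) \<longlonglongrightarrow> l" using s(2) by (simp add: o_def)
    ultimately have "(\<lambda>k. \<mu> ^ s (k + k) / \<mu> ^ s k) \<longlonglongrightarrow> l / l"
      using l by (intro tendsto_divide) auto
    moreover have "\<mu> ^ s (k + k) / \<mu> ^ s k = \<mu> ^ r k" for k
    proof -
      have "\<mu> ^ s (k + k) = \<mu> ^ r k * \<mu> ^ s k"
        using gap[of k k] by (simp add: r_def flip: power_add)
      moreover have "\<mu> \<noteq> 0" using assms by auto
      ultimately show ?thesis by simp
    qed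
    moreover have "l \<noteq> 0" using l by auto
    ultimately show ?thesis by simp
  qed
  ultimately show ?thesis by (rule that)
qed

text \<open>The Cayley transform turns the condition of modulus 1 into vanishing of a real part,
  which passes to leading terms. At \<open>t = -1\<close> the quotient is 0 by the convention for
  division by 0.\<close>

lemma Re_Cayley: "cmod t = 1 \<Longrightarrow> Re ((t - 1) / (t + 1)) = 0"
proof (cases "t + 1 = 0")
  case False
  assume t: "cmod t = 1"
  then have tt: "(Re t)\<^sup>2 + (Im t)\<^sup>2 = 1" by (simp add: cmod_def)
  have "Re ((t - 1) * cnj (t + 1)) = (Re t)\<^sup>2 + (Im t)\<^sup>2 - 1"
    by (simp add: power2_eq_square algebra_simps)
  then show ?thesis using tt complex_div_cnj[of "t - 1" "t + 1"]
    by (simp add: Re_divide_of_real)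
qed simp

context linearised
begin

text \<open>The condition holds at all \<open>y / lam ^ k\<close> with \<open>k\<close> large.
  Multiplied by the positive number \<open>cmod lam ^ (s * k)\<close> it reads
  \<open>Re (y ^ s * \<nu> ^ k * R (y / lam ^ k)) = 0\<close> with a unimodular
  \<open>\<nu>\<close>. Along exponents with \<open>\<nu> ^ k\<close> tending to 1, only the leading
  term survives.\<close>

lemma hom_pts_leading_term:
  assumes R: "isCont R 0"
    and ev: "\<forall>\<^sub>F y in nhds 0. y \<in> hom_pts \<longrightarrow> Re (y ^ s * R y) = 0"
    and y: "y \<in> hom_pts"
  shows "Re (R 0 * y ^ s) = 0"
proof -
  define \<nu> where "\<nu> = (of_real (cmod lam) / lam) ^ s"
  have "cmod \<nu> = 1" using lam0 by (simp add: \<nu>_def norm_power norm_divide)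
  then obtain r where r: "filterlim r at_top sequentially" "(\<lambda>k. \<nu> ^ r k) \<longlonglongrightarrow> 1"
    by (rule unimodular_recurrence)
  have yr: "(\<lambda>k. y / lam ^ r k) \<longlonglongrightarrow> 0"
    using filterlim_compose[OF scale_tendsto r(1)] .
  have "(\<lambda>k. Re (y ^ s * \<nu> ^ r k * R (y / lam ^ r k))) \<longlonglongrightarrow> Re (y ^ s * 1 * R 0)"
    by (intro tendsto_intros r(2) isCont_tendsto_compose[OF R yr])
  moreover have "\<forall>\<^sub>F k in sequentially. Re (y ^ s * \<nu> ^ r k * R (y / lam ^ r k)) = 0"
    using eventually_compose_filterlim[OF ev yr]
  proof eventually_elim
    case (elim k)
    then have z: "Re ((y / lam ^ r k) ^ s * R (y / lam ^ r k)) = 0"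
      using hom_pts_scale[OF y] by blast
    have "\<nu> ^ r k = of_real (cmod lam ^ (s * r k)) / (lam ^ r k) ^ s"
      by (simp add: \<nu>_def power_divide flip: power_mult) (simp add: mult.commute)
    then have "y ^ s * \<nu> ^ r k * R (y / lam ^ r k) =
        of_real (cmod lam ^ (s * r k)) * ((y / lam ^ r k) ^ s * R (y / lam ^ r k))"
      by (simp add: power_divide)
    then show ?case using z by (simp only: Re_complex_of_real times_complex.sel Im_complex_of_real)
  qed
  ultimately have "(\<lambda>k. 0) \<longlonglongrightarrow> Re (y ^ s * 1 * R 0)" by (rule Lim_transform_eventually)
  then show ?thesis by (simp add: LIMSEQ_const_iff mult.commute)
qed

lemma hom_pts_first_order:
  assumes q: "(q has_field_derivative b) (at 0)" and q0: "q 0 = 0"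
    and ev: "\<forall>\<^sub>F y in nhds 0. y \<in> hom_pts \<longrightarrow> Re (q y) = 0"
    and y: "y \<in> hom_pts"
  shows "Re (b * y) = 0"
proof -
  define R where "R y = (if y = 0 then b else q y / y)" for y
  have "((\<lambda>y. (q y - q 0) / (y - 0)) \<longlongrightarrow> b) (at 0)"
    using q by (simp add: has_field_derivative_iff)
  then have "(R \<longlongrightarrow> b) (at 0)"
    by (rule Lim_transform_eventually) (auto simp: eventually_at_filter R_def q0)
  then have R: "isCont R 0" by (simp add: isCont_def R_def)
  have qR: "q y = y ^ 1 * R y" for y by (simp add: R_def q0)
  have "\<forall>\<^sub>F y in nhds 0. y \<in> hom_pts \<longrightarrow> Re (y ^ 1 * R y) = 0" using ev by (simp only: qR)
  from hom_pts_leading_term[OF R this y] show ?thesis by (simp add: R_def)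
qed

text \<open>All points of \<open>hom_pts\<close> lie on a line through \<open>0\<close>; reflecting \<open>j\<close> in this line shows that
  \<open>j\<close> preserves it, so its derivative is real there.\<close>

lemma deriv_real_on_line:
  assumes j: "j holomorphic_on ball 0 r" and b: "b \<noteq> 0"
    and y0: "y \<longlonglongrightarrow> 0" and ynz: "\<And>n. y n \<noteq> 0"
    and yline: "\<And>n. Re (b * y n) = 0"
    and jline: "\<forall>\<^sub>F n in sequentially. Re (b * j (y n)) = 0"
    and r: "r > 0"
  shows "\<forall>\<^sub>F n in sequentially. deriv j (y n) \<in> \<real>"
proof -
  \<comment> \<open>In the coordinate \<open>t\<close> with \<open>y = \<i> * t / b\<close>, the
    line \<open>Re (b * y) = 0\<close> is the real axis and the reflection in it is
    \<open>cnj\<close>. So \<open>F\<close> and its reflection agree at the real points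
    \<open>t n\<close>, which accumulate at 0.\<close>
  define F where "F t = b * j (\<i> * t / b) / \<i>" for t
  define e where "e = r * cmod b"
  have e: "e > 0" using r b by (simp add: e_def)
  have inb: "\<i> * t / b \<in> ball 0 r" if "t \<in> ball 0 e" for t
    using that b by (simp add: e_def norm_divide norm_mult divide_less_eq)
  have "(\<lambda>t. j (\<i> * t / b)) holomorphic_on ball 0 e"
    using holomorphic_on_compose_gen[of "\<lambda>t. \<i> * t / b" "ball 0 e" j "ball 0 r"] j inb b
    by (force simp: o_def intro!: holomorphic_intros)
  then have F: "F holomorphic_on ball 0 e" unfolding F_def by (intro holomorphic_intros) auto
  have cb: "cnj ` ball 0 e = ball 0 e"
  proof -
    have "x \<in> cnj ` ball 0 e" if "x \<in> ball 0 e" for x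
      using that by (intro image_eqI[of _ _ "cnj x"]) auto
    then show ?thesis by auto
  qed
  have F2: "(cnj \<circ> F \<circ> cnj) holomorphic_on ball 0 e"
    using F by (intro holomorphic_on_compose_cnj_cnj) (auto simp: cb)
  define t where "t n = b * y n / \<i>" for n
  have t0: "t \<longlonglongrightarrow> 0"
    using tendsto_divide[OF tendsto_mult[OF tendsto_const y0] tendsto_const, of "\<i>" b] by (simp add: t_def[abs_def])
  have yt: "\<i> * t n / b = y n" for n using b by (simp add: t_def)
  have tr: "cnj (t n) = t n" for n
    using yline[of n] by (simp add: complex_eq_iff t_def)
  have Fr: "\<forall>\<^sub>F n in sequentially. cnj (F (t n)) = F (t n)"
    using jline by eventually_elim (simp add: complex_eq_iff F_def yt)
  have tball: "\<forall>\<^sub>F n in sequentially. t n \<in> ball 0 e"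
    using t0 e by (auto simp: tendsto_iff)
  define U where "U = {z \<in> ball 0 e. F z - (cnj \<circ> F \<circ> cnj) z = 0}"
  have evU: "\<forall>\<^sub>F n in sequentially. t n \<in> U"
    using Fr tball by eventually_elim (simp add: U_def tr)
  have lp: "0 islimpt U"
    unfolding islimpt_approachable
  proof (intro allI impI)
    fix d :: real assume "d > 0"
    then have "\<forall>\<^sub>F n in sequentially. dist (t n) 0 < d" using t0 by (auto simp: tendsto_iff)
    with evU have "\<forall>\<^sub>F n in sequentially. t n \<in> U \<and> dist (t n) 0 < d" by eventually_elim auto
    then obtain n where "t n \<in> U" "dist (t n) 0 < d" by (auto simp: eventually_sequentially)
    moreover have "t n \<noteq> 0" using ynz b by (simp add: t_def)
    ultimately show "\<exists>x'\<in>U. x' \<noteq> 0 \<and> dist x' 0 < d" by blast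
  qed
  have eq: "F z = (cnj \<circ> F \<circ> cnj) z" if "z \<in> ball 0 e" for z
  proof -
    have "F z - (cnj \<circ> F \<circ> cnj) z = 0"
    proof (rule analytic_continuation[of "\<lambda>z. F z - (cnj \<circ> F \<circ> cnj) z" "ball 0 e" U 0])
      show "(\<lambda>z. F z - (cnj \<circ> F \<circ> cnj) z) holomorphic_on ball 0 e"
        using F F2 by (rule holomorphic_on_diff)
    qed (use that lp e in \<open>auto simp: U_def\<close>)
    then show ?thesis by simp
  qed
  show ?thesis using tball
  proof eventually_elim
    case (elim n)
    have dF: "(F has_field_derivative deriv F (t n)) (at (t n))"
      using F elim by (intro holomorphic_derivI[of _ "ball 0 e"]) auto
    then have "((cnj \<circ> F \<circ> cnj) has_field_derivative cnj (deriv F (t n))) (at (t n))"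
      using has_field_derivative_cnj_cnj[of F _ "t n"] by (simp add: tr)
    moreover have "((cnj \<circ> F \<circ> cnj) has_field_derivative deriv F (t n)) (at (t n))"
      using dF open_ball[of "0::complex" e] elim eq
      by (rule has_field_derivative_transform_within_open)
    ultimately have "cnj (deriv F (t n)) = deriv F (t n)" by (rule DERIV_unique)
    moreover have "deriv F (t n) = deriv j (y n)"
    proof -
      have "(j has_field_derivative deriv j (\<i> * t n / b)) (at (\<i> * t n / b))"
        using j inb[OF elim] by (intro holomorphic_derivI[of _ "ball 0 r"]) auto
      moreover have "((\<lambda>t. \<i> * t / b) has_field_derivative \<i> / b) (at (t n))"
        using b by (auto intro!: derivative_eq_intros)
      ultimately have "((\<lambda>t. j (\<i> * t / b)) has_field_derivative deriv j (y n) * (\<i> / b)) (at (t n))"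
        using DERIV_chain2[of j "deriv j (y n)" "\<lambda>t. \<i> * t / b" "t n" "\<i> / b"] by (simp only: yt)
      then have "(F has_field_derivative b * (deriv j (y n) * (\<i> / b)) / \<i>) (at (t n))"
        unfolding F_def by (intro DERIV_cdivide DERIV_cmult)
      moreover have "b * (deriv j (y n) * (\<i> / b)) / \<i> = deriv j (y n)"
        using b by (simp, simp add: complex_eq_iff)
      ultimately show ?thesis by (metis DERIV_imp_deriv)
    qed
    ultimately show ?case by (metis Reals_cnj_iff)
  qed
qed

text \<open>Suppose \<open>j'\<close> is not constant. The leading term of the Cayley transform of
  \<open>j' / j' 0\<close> then constrains all of \<open>hom_pts\<close> by a homogeneous condition
  of degree \<open>s\<close>. As \<open>j\<close> preserves \<open>hom_pts\<close>, differentiating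
  this condition along \<open>j\<close> at 0 improves it to a line. On the line \<open>j'\<close> is
  real of modulus 1, hence locally equal to \<open>j' 0\<close>, which contradicts non-constancy. So
  \<open>j\<close> is affine with unimodular slope, and the identity theorem makes the symmetry
  global.\<close>

lemma local_symmetry:
  assumes w: "\<phi> w = Fin 0" "w \<noteq> 0"
  obtains \<rho> where "cmod \<rho> = 1" "\<And>z. \<phi> (w + \<rho> * z) = \<phi> z"
proof -
  obtain j where j: "j analytic_on {0}" "j 0 = w" "\<forall>\<^sub>F y in nhds 0. \<phi> (j y) = \<phi> y"
    using phi_preimage_lift[OF w(1)] .
  define u0 where "u0 = deriv j 0"
  have "\<forall>\<^sub>F y in nhds 0. \<forall>\<^sub>F v in nhds y. \<phi> (j v) = \<phi> v"
    using j(3) by (simp add: eventually_eventually)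
  moreover have "\<forall>\<^sub>F y in nhds 0. j analytic_on {y}"
  proof -
    obtain S where "open S" "0 \<in> S" "j holomorphic_on S" using j(1) analytic_at by blast
    then show ?thesis unfolding eventually_nhds by (auto intro: holomorphic_on_imp_analytic_at)
  qed
  ultimately have good: "\<forall>\<^sub>F y in nhds 0. j analytic_on {y} \<and>
      (y \<in> hom_pts \<longrightarrow> j y \<in> hom_pts \<and> cmod (deriv j y) = 1)"
    using j(3)
  proof eventually_elim
    case (elim y)
    have "j y \<in> hom_pts \<and> cmod (deriv j y) = 1" if y: "y \<in> hom_pts"
    proof
      show "j y \<in> hom_pts" using hom_pts_cong[OF y elim(3)] .
      have "sd \<phi> y = sd \<phi> (j y) * cmod (deriv j y)"
        using sph_holo_cong(2)[OF elim(1)] sph_holo_compose_analytic(2)[OF elim(2) holo] by simp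
      then show "cmod (deriv j y) = 1"
        using sd_hom_pts_cong[OF y elim(3)] sd_nonzero[OF hom_pts_J[OF y]] by simp
    qed
    then show ?case using elim(2) by blast
  qed
  then have u0: "cmod u0 = 1" unfolding u0_def
    using eventually_nhds_x_imp_x zero_hom_pts(1) by fastforce
  then have u00: "u0 \<noteq> 0" by auto
  have dj: "deriv j analytic_on {0}" using j(1) by (rule analytic_deriv)
  have "(deriv j \<longlongrightarrow> u0) (nhds 0)"
    using analytic_at_imp_isCont[OF dj] by (simp add: isCont_def tendsto_at_iff_tendsto_nhds u0_def)
  then have "((\<lambda>y. deriv j y / u0 + 1) \<longlongrightarrow> u0 / u0 + 1) (nhds 0)"
    using u00 by (intro tendsto_intros)
  then have "\<forall>\<^sub>F y in nhds 0. deriv j y / u0 + 1 \<noteq> 0"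
    by (rule tendsto_imp_eventually_ne) (use u00 in simp)
  with good have "\<forall>\<^sub>F y in nhds 0. deriv j y / u0 + 1 \<noteq> 0 \<and> j analytic_on {y} \<and>
      (y \<in> hom_pts \<longrightarrow> j y \<in> hom_pts \<and> cmod (deriv j y) = 1) \<and> \<phi> (j y) = \<phi> y"
    using j(3) by eventually_elim auto
  then obtain r where r: "r > 0" and good: "\<And>y. y \<in> ball 0 r \<Longrightarrow> deriv j y / u0 + 1 \<noteq> 0 \<and> j analytic_on {y} \<and>
      (y \<in> hom_pts \<longrightarrow> j y \<in> hom_pts \<and> cmod (deriv j y) = 1) \<and> \<phi> (j y) = \<phi> y"
    unfolding eventually_nhds_metric by auto
  have evr: "\<forall>\<^sub>F y in nhds 0. y \<in> ball (0::complex) r"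
    unfolding eventually_nhds_metric using r by (auto simp: dist_commute)
  have jh: "j holomorphic_on ball 0 r"
    using good by (meson analytic_imp_holomorphic analytic_on_analytic_at)
  have djh: "deriv j holomorphic_on ball 0 r" using jh by (simp add: holomorphic_deriv)
  define m where "m y = (deriv j y / u0 - 1) / (deriv j y / u0 + 1)" for y
  have mh: "m holomorphic_on ball 0 r"
    unfolding m_def using good u00
    by (intro holomorphic_on_divide holomorphic_on_add holomorphic_on_diff holomorphic_on_const djh) auto
  have m0: "m 0 = 0" using u00 by (simp add: m_def u0_def)
  have mzero: "m y = 0 \<longleftrightarrow> deriv j y = u0" if "y \<in> ball 0 r" for y
    using good[OF that] u00 by (auto simp: m_def)
  have "m constant_on ball 0 r"
  proof (rule ccontr)
    assume nc: "\<not> m constant_on ball 0 r"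
    have zin: "0 \<in> ball (0::complex) r" using r by simp
    obtain R e s where s: "0 < s" "0 < e" "ball (0::complex) e \<subseteq> ball 0 r" "R holomorphic_on ball 0 e"
        and mR: "\<And>y. y \<in> ball 0 e \<Longrightarrow> m y = (y - 0) ^ s * R y"
        and Rnz: "\<And>y. y \<in> ball 0 e \<Longrightarrow> R y \<noteq> 0"
      by (rule holomorphic_factor_zero_nonconstant[OF mh open_ball connected_ball zin m0 nc])
        (rule that, assumption+)
    have eve: "\<forall>\<^sub>F y in nhds 0. y \<in> ball (0::complex) e"
      unfolding eventually_nhds_metric using s(2) by (auto simp: dist_commute)
    have Rc: "isCont R 0"
      using s(2,4) by (metis analytic_at_ball analytic_at_imp_isCont)
    have R0: "R 0 \<noteq> 0" using Rnz s(2) by simp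
    have ev1: "\<forall>\<^sub>F y in nhds 0. y \<in> hom_pts \<longrightarrow> Re (y ^ s * R y) = 0"
      using eve
    proof eventually_elim
      case (elim y)
      have "Re (m y) = 0" if "y \<in> hom_pts"
        unfolding m_def using good[of y] elim s(3) that u0 by (intro Re_Cayley) (auto simp: norm_divide)
      then show ?case using mR[OF elim] by simp
    qed
    have lead: "Re (R 0 * y ^ s) = 0" if "y \<in> hom_pts" for y
      using hom_pts_leading_term[OF Rc ev1 that] .
    have whom: "w \<in> hom_pts" using zero_hom_pts(2) w(1) .
    \<comment> \<open>Near 0 both \<open>j y\<close> and \<open>w\<close> satisfy
      \<open>lead\<close>. Their difference has derivative \<open>b\<close> at 0, which is nonzero
      because \<open>w\<close> is.\<close>
    define b where "b = R 0 * (of_nat s * w ^ (s - 1) * u0)"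
    have b: "b \<noteq> 0" using R0 s(1) w(2) u00 by (simp add: b_def)
    have jd: "(j has_field_derivative u0) (at 0)"
      using j(1) by (simp add: u0_def DERIV_deriv_iff_field_differentiable analytic_on_imp_differentiable_at)
    have qd: "((\<lambda>y. R 0 * j y ^ s - R 0 * w ^ s) has_field_derivative b) (at 0)"
      unfolding b_def using jd j(2) by (auto intro!: derivative_eq_intros)
    have ev2: "\<forall>\<^sub>F y in nhds 0. y \<in> hom_pts \<longrightarrow> Re (R 0 * j y ^ s - R 0 * w ^ s) = 0"
      using evr by eventually_elim (use good lead whom in \<open>auto simp del: times_complex.sel\<close>)
    have line: "Re (b * y) = 0" if "y \<in> hom_pts" for y
      using hom_pts_first_order[OF qd _ ev2 that] j(2) by simp
    define y where "y n = w / lam ^ n" for n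
    have yh: "y n \<in> hom_pts" for n using hom_pts_scale[OF whom] by (simp add: y_def)
    have y0: "y \<longlonglongrightarrow> 0" using scale_tendsto[of w] by (simp add: y_def[abs_def])
    have ynz: "y n \<noteq> 0" for n using w(2) lam0 by (simp add: y_def)
    have yr: "\<forall>\<^sub>F n in sequentially. y n \<in> ball 0 r" using y0 r by (auto simp: tendsto_iff)
    have ye: "\<forall>\<^sub>F n in sequentially. y n \<in> ball 0 e" using y0 s(2) by (auto simp: tendsto_iff)
    have jl: "\<forall>\<^sub>F n in sequentially. Re (b * j (y n)) = 0"
      using yr by eventually_elim (use good yh line in blast)
    have real: "\<forall>\<^sub>F n in sequentially. deriv j (y n) \<in> \<real>"
      by (rule deriv_real_on_line[OF jh b y0 ynz line[OF yh] jl r])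
    have pm: "\<forall>\<^sub>F n in sequentially. deriv j (y n) \<in> {1, -1}"
      using real yr
    proof eventually_elim
      case (elim n)
      then obtain x where x: "deriv j (y n) = of_real x" by (auto elim: Reals_cases)
      then have "\<bar>x\<bar> = 1" using good[OF elim(2)] yh by simp
      then show ?case using x by (auto simp: abs_if split: if_splits)
    qed
    have lim: "(\<lambda>n. deriv j (y n)) \<longlonglongrightarrow> u0"
      using isCont_tendsto_compose[OF analytic_at_imp_isCont[OF dj] y0] by (simp add: u0_def)
    \<comment> \<open>The derivatives at the points \<open>y n\<close> are 1 or -1 and converge to
      \<open>u0\<close>; being within distance 2 of \<open>u0\<close>, they eventually equal
      it.\<close>
    have "u0 \<in> {1, -1}"
      using Lim_in_closed_set[OF _ pm _ lim] by simp
    have "\<forall>\<^sub>F n in sequentially. dist (deriv j (y n)) u0 < 2"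
      using lim by (auto simp: tendsto_iff)
    with pm yr ye have "\<forall>\<^sub>F n in sequentially. False"
    proof eventually_elim
      case (elim n)
      have "deriv j (y n) = u0"
        using elim(1,4) \<open>u0 \<in> {1, -1}\<close> by (auto simp: dist_norm)
      then have "m (y n) = 0" using mzero elim(2) by simp
      then show ?case using mR[OF elim(3)] Rnz[OF elim(3)] ynz by simp
    qed
    then show False by simp
  qed
  then have dconst: "deriv j y = u0" if "y \<in> ball 0 r" for y
    using m0 mzero[OF that] that r unfolding constant_on_def by (metis centre_in_ball)
  have jlin: "j y = w + u0 * y" if "y \<in> ball 0 r" for y
  proof -
    have "((\<lambda>y. j y - u0 * y) has_field_derivative 0) (at x within ball 0 r)" if "x \<in> ball 0 r" for x
    proof -
      have "(j has_field_derivative u0) (at x)"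
        using holomorphic_derivI[OF jh open_ball that] dconst[OF that] by simp
      then show ?thesis by (auto intro!: derivative_eq_intros intro: has_field_derivative_at_within)
    qed
    then obtain c where c: "\<And>x. x \<in> ball 0 r \<Longrightarrow> j x - u0 * x = c"
      using has_field_derivative_zero_constant[of "ball 0 r" "\<lambda>y. j y - u0 * y"] by auto
    have "c = w" using c[of 0] r j(2) by simp
    then show ?thesis using c[OF that] by (simp add: algebra_simps)
  qed
  have ev: "\<forall>\<^sub>F y in nhds 0. \<phi> (w + u0 * y) = \<phi> y"
    using evr by eventually_elim (use good jlin in force)
  have "\<phi> (w + u0 * z) = \<phi> z" for z
  proof (rule sph_holo_identity[OF _ holo ev])
    show "sph_holo (\<lambda>u. \<phi> (w + u0 * u)) z" for z
      by (rule sph_holo_compose_analytic(1)[OF _ holo]) (intro analytic_intros)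
  qed
  with u0 show ?thesis by (rule that)
qed

end

subsection \<open>Rational maps of degree at least two have critical points\<close>

lemma deriv_poly: "deriv (poly P) z = poly (pderiv P) z"
  by (rule DERIV_imp_deriv[OF poly_DERIV])

lemma deriv_hom_eval_0:
  assumes "n \<ge> 1"
  shows "deriv (hom_eval n P 1) 0 = coeff P (n - 1)"
proof -
  have "(hom_eval n P 1 has_field_derivative (\<Sum>i\<le>n. coeff P i * (of_nat (n - i) * 0 ^ (n - i - 1)))) (at 0)"
    unfolding hom_eval_def[abs_def] by (auto intro!: derivative_eq_intros simp: mult_ac)
  also have "(\<Sum>i\<le>n. coeff P i * (of_nat (n - i) * 0 ^ (n - i - 1))) =
      (\<Sum>i\<le>n. if i = n - 1 then coeff P (n - 1) else 0)"
  proof (rule sum.cong)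
    fix i assume i: "i \<in> {..n}"
    consider "i = n" | "i = n - 1" "i \<noteq> n" | "n - i - 1 > 0" using i by force
    then show "coeff P i * (of_nat (n - i) * 0 ^ (n - i - 1)) = (if i = n - 1 then coeff P (n - 1) else 0)"
    proof cases
      case 2
      then have "n - i = 1" using assms by simp
      then show ?thesis using 2 by simp
    qed (use assms in \<open>auto simp: zero_power\<close>)
  qed simp
  also have "\<dots> = coeff P (n - 1)" by simp
  finally show ?thesis by (rule DERIV_imp_deriv)
qed

text \<open>A Riemann-Hurwitz count by hand. As \<open>Infty\<close> is fixed and not critical,
  \<open>degree Q = n - 1\<close>. The Wronskian then has the nonzero coefficient
  \<open>coeff P n * coeff Q (n - 1)\<close> in degree \<open>2 * n - 2\<close>, yet it has no
  root.\<close>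

lemma immersion_fixing_Infty_degree:
  assumes g: "g \<in> Rat" and imm: "\<And>x. sph_deriv_norm g x \<noteq> 0" and inf: "g Infty = Infty"
  shows "rat_degree g = 1"
proof -
  obtain P Q n where g: "g = ratmap P Q" "coprime P Q" "n = max (degree P) (degree Q)" "n \<ge> 1"
    "rat_degree g = n" using g by (rule RatE)
  have Qn: "coeff Q n = 0" using inf by (auto simp: g(1) Let_def sphere_quot_def simp flip: g(3) split: if_splits)
  have Pn: "coeff P n \<noteq> 0" using Qn g(3,4) by (metis leading_coeff_0_iff max_def degree_0 not_one_le_zero)
  then have dP: "degree P = n" using g(3) le_degree[of P n] by auto
  have A0: "hom_eval n P 1 0 = coeff P n" "hom_eval n Q 1 0 = 0"
    by (simp_all add: hom_eval_at_infinity Qn)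
  have "sd (\<lambda>u. sphere_quot (hom_eval n P 1 u) (hom_eval n Q 1 u)) 0 \<noteq> 0"
    using imm[of Infty] unfolding sph_deriv_norm_eq_sd g(1)
    by (simp add: chart_at_def ratmap_at_Infty[OF g(3)] del: sphere_inv.simps(1))
  then have Qn1: "coeff Q (n - 1) \<noteq> 0"
    using Pn by (subst (asm) sph_holo_sphere_quot(2)) (auto simp: analytic_hom_eval A0 deriv_hom_eval_0[OF g(4)])
  have dQ: "degree Q = n - 1"
  proof (rule antisym)
    show "degree Q \<le> n - 1"
      using Qn g(3) by (intro degree_le) (metis Suc_pred' coeff_eq_0 dP g(4) le_neq_implies_less
          less_Suc_eq_le less_le_trans max.cobounded2 not_le zero_less_one)
    show "n - 1 \<le> degree Q" using Qn1 by (rule le_degree)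
  qed
  let ?W = "pderiv P * Q - P * pderiv Q"
  have W: "poly ?W z \<noteq> 0" for z
  proof
    assume z: "poly ?W z = 0"
    have "sd (\<lambda>u. sphere_quot (poly P u) (poly Q u)) z = 0"
      using sph_holo_sphere_quot(2)[of "poly P" z "poly Q"] coprime_no_common_root[OF g(2), of z] z
      by (simp add: analytic_poly deriv_poly)
    then show False using imm[of "Fin z"] by (simp add: sph_deriv_norm_eq_sd chart_at_def g(1))
  qed
  have "degree ?W = 0" using W ex_poly_root by metis
  show ?thesis
  proof (rule ccontr)
    assume "rat_degree g \<noteq> 1"
    then have n: "n \<ge> 2" using g(4,5) by simp
    have c1: "coeff (pderiv P * Q) ((n - 1) + (n - 1)) = (of_nat n * coeff P n) * coeff Q (n - 1)"
      using coeff_mult_degree_le[of "pderiv P" "n - 1" Q "n - 1"] dP dQ g(4)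
      by (simp add: degree_pderiv coeff_pderiv)
    have e: "(n - 1) + (n - 1) = n + (n - 2)" using n by simp
    have "coeff (pderiv Q) (n - 2) = of_nat (n - 1) * coeff Q (n - 1)"
      using n by (simp add: coeff_pderiv numeral_2_eq_2 Suc_diff_Suc flip: of_nat_Suc)
    then have c2: "coeff (P * pderiv Q) ((n - 1) + (n - 1)) = coeff P n * (of_nat (n - 1) * coeff Q (n - 1))"
      unfolding e using coeff_mult_degree_le[of P n "pderiv Q" "n - 2"] dP dQ
      by (simp add: degree_pderiv)
    have "coeff ?W ((n - 1) + (n - 1)) = (of_nat n - of_nat (n - 1)) * (coeff P n * coeff Q (n - 1))"
      by (simp only: coeff_diff c1 c2) (simp add: algebra_simps)
    also have "of_nat n - of_nat (n - 1) = (1::complex)" using g(4) by (simp add: of_nat_diff)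
    finally have "coeff ?W ((n - 1) + (n - 1)) \<noteq> 0" using Pn Qn1 by simp
    then have "(n - 1) + (n - 1) \<le> degree ?W" by (rule le_degree)
    then show False using \<open>degree ?W = 0\<close> n by simp
  qed
qed

lemma immersion_degree:
  assumes g: "g \<in> Rat" and imm: "\<And>x. sph_deriv_norm g x \<noteq> 0"
  shows "rat_degree g = 1"
proof -
  obtain M where M: "M \<in> Aut_sphere" "M (g Infty) = Infty"
  proof (cases "g Infty = Fin 0")
    case True
    then show ?thesis using ex_Aut_0_Infty[of "Fin 1" "g Infty"] that by auto
  next
    case False
    then show ?thesis using ex_Aut_0_Infty[of "Fin 0" "g Infty"] that by auto
  qed
  note MR = Aut_sphereD[OF M(1)]
  have "rat_degree (M \<circ> g) = 1"
    using Rat_compose(1)[OF MR(1) g] Rat_deriv_comp[OF MR(1) g] MR(7) imm M(2)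
    by (intro immersion_fixing_Infty_degree) auto
  then show ?thesis using Rat_compose(2)[OF MR(1) g] MR(5) by simp
qed

subsection \<open>The periods of the linearisation\<close>

lemma discrete_subgroup_real:
  fixes S :: "real set"
  assumes diff: "\<And>x y. x \<in> S \<Longrightarrow> y \<in> S \<Longrightarrow> x - y \<in> S" and one: "a \<in> S" "a > 0"
    and e: "e > 0" "\<And>x. x \<in> S \<Longrightarrow> 0 < x \<Longrightarrow> e \<le> x"
  obtains m where "m > 0" "m \<in> S" "\<And>t. t \<in> S \<Longrightarrow> \<exists>k::int. t = of_int k * m"
proof -
  let ?P = "{x \<in> S. 0 < x}"
  define m where "m = Inf ?P"
  have ne: "?P \<noteq> {}" using one by auto
  have bd: "bdd_below ?P" by (rule bdd_belowI[of _ 0]) auto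
  have low: "m \<le> x" if "x \<in> S" "0 < x" for x
    unfolding m_def using that bd by (intro cInf_lower) auto
  have me: "e \<le> m" unfolding m_def using ne e by (intro cInf_greatest) auto
  have mS: "m \<in> S"
  proof (rule ccontr)
    assume "m \<notin> S"
    \<comment> \<open>If the infimum were not attained, two elements of \<open>S\<close> just above
      it would differ by less than \<open>e\<close>.\<close>
    obtain x where x: "x \<in> S" "0 < x" "x < m + e"
      using cInf_lessD[OF ne, of "m + e"] e(1) unfolding m_def by auto
    then have "m < x" using low[of x] \<open>m \<notin> S\<close> by (metis less_le)
    then obtain y where y: "y \<in> S" "0 < y" "y < x"
      using cInf_lessD[OF ne, of x] unfolding m_def by auto
    have "e \<le> x - y" using e(2) diff x y by simp
    then show False using low[of y] y x by simp
  qed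
  have z: "0 \<in> S" using diff[OF mS mS] by simp
  have negS: "x \<in> S \<Longrightarrow> - x \<in> S" for x using diff[OF z, of x] by simp
  have nat: "of_nat n * m \<in> S" for n
  proof (induction n)
    case (Suc n)
    have "of_nat n * m - (- m) \<in> S" using Suc negS[OF mS] by (rule diff)
    then show ?case by (simp add: algebra_simps)
  qed (simp add: z)
  have int: "of_int k * m \<in> S" for k
  proof (cases k)
    case (nonneg n)
    then show ?thesis using nat[of n] by simp
  next
    case (neg n)
    have "- (of_nat (Suc n) * m) \<in> S" by (rule negS[OF nat])
    then show ?thesis using neg by (simp del: of_nat_Suc)
  qed
  show ?thesis
  proof (rule that[OF _ mS])
    show mpos: "m > 0" using me e(1) by simp
    fix t assume t: "t \<in> S"
    define k where "k = \<lfloor>t / m\<rfloor>"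
    have "of_int k * m \<le> t" "t < (of_int k + 1) * m"
      using mpos floor_divide_lower[OF mpos, of t] floor_divide_upper[OF mpos, of t] by (auto simp: k_def)
    moreover have False if "0 < t - of_int k * m"
      using low[OF diff[OF t int, of k] that] calculation by (simp add: distrib_right)
    ultimately have "t = of_int k * m" by fastforce
    then show "\<exists>k::int. t = of_int k * m" ..
  qed
qed

context linearised
begin

definition periods :: "complex set" where
  "periods = {t. \<forall>z. \<phi> (z + t) = \<phi> z}"

lemma periods_diff: "s \<in> periods \<Longrightarrow> t \<in> periods \<Longrightarrow> s - t \<in> periods"
  unfolding periods_def by (auto simp: algebra_simps) (metis add.commute diff_add_cancel add_diff_eq)

lemma periods_zero: "0 \<in> periods"
  by (simp add: periods_def)

lemma periods_uminus: "t \<in> periods \<Longrightarrow> - t \<in> periods"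
  using periods_diff[OF periods_zero] by simp

lemma periods_add: "s \<in> periods \<Longrightarrow> t \<in> periods \<Longrightarrow> s + t \<in> periods"
  using periods_diff[of s "- t"] periods_uminus by simp

lemma periods_nat: "t \<in> periods \<Longrightarrow> of_nat n * t \<in> periods"
  by (induction n) (auto simp: periods_zero algebra_simps intro: periods_add)

lemma periods_int: "t \<in> periods \<Longrightarrow> of_int k * t \<in> periods"
  by (cases k) (auto simp: periods_nat periods_uminus simp del: of_nat_Suc)

lemma periods_zeros: "t \<in> periods \<Longrightarrow> \<phi> t = Fin 0"
  unfolding periods_def using phi0 by (metis (mono_tags, lifting) add.left_neutral mem_Collect_eq)

lemma periods_lam: "t \<in> periods \<Longrightarrow> lam * t \<in> periods"
proof -
  assume t: "t \<in> periods"
  have "\<phi> (z + lam * t) = \<phi> z" for z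
  proof -
    have "\<phi> (z + lam * t) = \<phi> (lam * (z / lam + t))" using lam0 by (simp add: distrib_left)
    also have "\<dots> = g (\<phi> (z / lam))" using t by (simp add: funeq periods_def)
    also have "\<dots> = \<phi> z" using lam0 by (simp flip: funeq)
    finally show ?thesis .
  qed
  then show ?thesis by (simp add: periods_def)
qed

lemma periods_discrete: "\<exists>e>0. \<forall>t\<in>periods. t \<noteq> 0 \<longrightarrow> e \<le> cmod t"
proof -
  obtain e where e: "e > 0" "inj_on \<phi> (ball 0 e)"
    using sph_holo_locally_injective[OF holo sd0] .
  have "e \<le> cmod t" if "t \<in> periods" "t \<noteq> 0" for t
  proof (rule ccontr)
    assume "\<not> ?thesis"
    then have "t = 0" using e periods_zeros[OF that(1)] phi0 by (intro inj_onD[OF e(2)]) auto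
    then show False using that by simp
  qed
  then show ?thesis using e(1) by blast
qed

text \<open>If \<open>\<phi>\<close> maps the plane into \<open>J\<close>, then Liouville forces
  \<open>J\<close> to be the whole sphere. But \<open>g\<close> has no critical point in
  \<open>J\<close>, so it would be an immersion, of degree 1.\<close>

lemma sphere_not_J: "\<exists>z. \<phi> z \<notin> J"
proof (rule ccontr)
  assume "\<not> ?thesis"
  then have all: "\<phi> z \<in> J" for z by blast
  have "J = UNIV"
  proof (rule ccontr)
    assume "J \<noteq> UNIV"
    then obtain y where "y \<in> - J" by blast
    then have "\<exists>c. \<phi> = (\<lambda>z. c)"
      using closedJ all by (intro sph_Liouville[OF holo, of "- J" y]) auto
    then show False using nonconst by blast
  qed
  then have "rat_degree g = 1" using nondeg gRat by (intro immersion_degree) auto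
  then show False using deg by simp
qed

text \<open>Dividing by \<open>lam ^ n\<close> shrinks the error, so \<open>z\<close> is a limit of
  points \<open>t n / lam ^ n\<close> of \<open>hom_pts\<close>, which \<open>\<phi>\<close> maps
  into the closed set \<open>J\<close>.\<close>

lemma J_approx:
  assumes "\<And>n. \<exists>t\<in>periods. cmod (lam ^ n * z - t) \<le> C"
  shows "\<phi> z \<in> J"
proof -
  obtain t where t: "\<And>n. t n \<in> periods" "\<And>n. cmod (lam ^ n * z - t n) \<le> C"
    using assms by metis
  have tJ: "\<phi> (t n / lam ^ n) \<in> J" for n
    using hom_pts_J hom_pts_scale zero_hom_pts(2) periods_zeros t(1) by blast
  have b: "cmod (t n / lam ^ n - z) \<le> C * (1 / cmod lam) ^ n" for n
  proof -
    have "t n / lam ^ n - z = - ((lam ^ n * z - t n) / lam ^ n)"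
      using lam0 by (simp add: diff_divide_distrib)
    then have "cmod (t n / lam ^ n - z) = cmod (lam ^ n * z - t n) / cmod lam ^ n"
      by (simp add: norm_divide norm_power)
    also have "\<dots> \<le> C / cmod lam ^ n" using t(2) by (intro divide_right_mono) auto
    finally show ?thesis by (simp add: power_divide)
  qed
  have "(\<lambda>n. C * (1 / cmod lam) ^ n) \<longlonglongrightarrow> C * 0"
    using lam by (intro tendsto_intros LIMSEQ_realpow_zero) (auto simp: divide_less_eq)
  then have "(\<lambda>n. t n / lam ^ n - z) \<longlonglongrightarrow> 0"
    using Lim_null_comparison[OF always_eventually[OF allI[OF b]]] by simp
  then have "(\<lambda>n. t n / lam ^ n) \<longlonglongrightarrow> z" by (simp add: LIM_zero_iff)
  then have "(\<lambda>n. \<phi> (t n / lam ^ n)) \<longlonglongrightarrow> \<phi> z"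
    by (rule isCont_tendsto_compose[OF sph_holo_imp_isCont[OF holo]])
  then show ?thesis by (rule closed_sequentially[OF closedJ tJ])
qed

text \<open>Two independent periods have a bounded fundamental parallelogram, so every point of the
  plane satisfies \<open>J_approx\<close>, against \<open>sphere_not_J\<close>. This excludes the
  doubly periodic case.\<close>

lemma periods_collinear:
  assumes a: "a \<in> periods" "a \<noteq> 0" and b: "b \<in> periods"
  shows "b / a \<in> \<real>"
proof (rule ccontr)
  assume nr: "b / a \<notin> \<real>"
  then have im: "Im (b / a) \<noteq> 0" by (simp add: complex_is_Real_iff)
  have near: "\<exists>t\<in>periods. cmod (u - t) \<le> cmod a + cmod b" for u
  proof -
    define c v where "c = b / a" and "v = u / a"
    define y where "y = Im v / Im c"
    define x where "x = Re v - y * Re c"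
    have "v = of_real x + of_real y * c"
      using im by (simp add: complex_eq_iff x_def y_def flip: c_def)
    then have "u / a = of_real x + of_real y * (b / a)" by (simp only: c_def v_def)
    then have "u = (of_real x + of_real y * (b / a)) * a" by (simp only: nonzero_divide_eq_eq[OF a(2)])
    then have u: "u = of_real x * a + of_real y * b" using a(2) by (simp add: distrib_right)
    let ?t = "of_int \<lfloor>x\<rfloor> * a + of_int \<lfloor>y\<rfloor> * b"
    have "u - ?t = of_real (frac x) * a + of_real (frac y) * b"
      by (simp add: u frac_def algebra_simps)
    also have "cmod \<dots> \<le> frac x * cmod a + frac y * cmod b"
      by (rule norm_triangle_le) (simp add: norm_mult frac_ge_0)
    also have "\<dots> \<le> 1 * cmod a + 1 * cmod b"
      by (intro add_mono mult_right_mono) (auto simp: less_imp_le frac_lt_1)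
    finally have "cmod (u - ?t) \<le> cmod a + cmod b" by simp
    moreover have "?t \<in> periods" using a b by (intro periods_add periods_int)
    ultimately show ?thesis by blast
  qed
  then show False using sphere_not_J J_approx by metis
qed

text \<open>Conjugating the symmetry \<open>w + \<rho> * z\<close> by multiplication with
  \<open>lam\<close> gives the symmetry \<open>lam * w + \<rho> * z\<close>. Both have the same
  linear part, so they differ by a translation, namely by \<open>(lam - 1) * w\<close>.\<close>

lemma zero_gives_period:
  assumes sym: "\<And>z. \<phi> (w + \<rho> * z) = \<phi> z" and r: "cmod \<rho> = 1"
  shows "(lam - 1) * w \<in> periods"
proof -
  have r0: "\<rho> \<noteq> 0" using r by auto
  have "\<phi> (z + (lam - 1) * w) = \<phi> z" for z
  proof -
    let ?v = "(z - w) / \<rho>"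
    have "z + (lam - 1) * w = lam * (w + \<rho> * (?v / lam))"
      using r0 lam0 by (simp add: field_simps)
    then have "\<phi> (z + (lam - 1) * w) = g (\<phi> (?v / lam))" by (simp add: funeq sym del: times_divide_eq_right)
    also have "\<dots> = \<phi> ?v" using lam0 by (simp flip: funeq)
    also have "\<dots> = \<phi> (w + \<rho> * ?v)" by (simp only: sym)
    also have "w + \<rho> * ?v = z" using r0 by simp
    finally show ?thesis .
  qed
  then show ?thesis by (simp add: periods_def)
qed

text \<open>All periods lie on one real line, which multiplication by \<open>lam\<close> preserves,
  so \<open>lam\<close> is real and discreteness gives a generator \<open>\<tau>\<close>. A zero
  \<open>v\<close> carries a symmetry \<open>v + r * z\<close>, under which
  \<open>r * \<tau>\<close> is again a period. Thus \<open>r\<close> is 1 or -1, and once -1 is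
  excluded \<open>v\<close> is itself a period.\<close>

theorem zeros_lattice:
  obtains \<tau> L where "\<tau> \<noteq> 0" "periods = {of_int k * \<tau> | k. True}"
    "\<And>z. \<phi> z = Fin 0 \<longleftrightarrow> (\<exists>k::int. z = of_int k * \<tau>)" "lam = of_int L"
proof -
  have l1: "lam - 1 \<noteq> 0" using lam by auto
  obtain w where w: "w \<noteq> 0" "\<phi> w = Fin 0" using ex_nonzero_preimage by blast
  obtain \<rho> where \<rho>: "cmod \<rho> = 1" "\<And>z. \<phi> (w + \<rho> * z) = \<phi> z" using local_symmetry[OF w(2,1)] by blast
  define a where "a = (lam - 1) * w"
  have a: "a \<in> periods" "a \<noteq> 0"
    using zero_gives_period[OF \<rho>(2,1)] l1 w(1) by (auto simp: a_def)
  have ainR: "b \<in> periods \<Longrightarrow> \<exists>x. b = of_real x * a" for b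
    using periods_collinear[OF a] a(2) by (metis Reals_cases nonzero_divide_eq_eq)
  obtain l where l: "lam * a = of_real l * a" using ainR[OF periods_lam[OF a(1)]] by blast
  then have lr: "lam = of_real l" using a(2) by simp
  \<comment> \<open>Only points on this line are known to map into \<open>J\<close>; the midpoint
    \<open>v / 2\<close> below will be one of them.\<close>
  have lineJ: "\<phi> (of_real x * a) \<in> J" for x
  proof (rule J_approx)
    fix n
    let ?t = "of_int \<lfloor>l ^ n * x\<rfloor> * a"
    have "lam ^ n * (of_real x * a) - ?t = of_real (frac (l ^ n * x)) * a"
      by (simp add: lr frac_def algebra_simps)
    also have "cmod \<dots> \<le> 1 * cmod a"
      by (simp only: norm_mult norm_of_real) (intro mult_right_mono, auto simp: less_imp_le frac_lt_1 frac_ge_0)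
    finally show "\<exists>t\<in>periods. cmod (lam ^ n * (of_real x * a) - t) \<le> cmod a"
      using periods_int[OF a(1)] by auto
  qed
  obtain e where e: "e > 0" "\<And>t. t \<in> periods \<Longrightarrow> t \<noteq> 0 \<Longrightarrow> e \<le> cmod t" using periods_discrete by blast
  let ?S = "{x. of_real x * a \<in> periods}"
  obtain m where m: "m > 0" "m \<in> ?S" "\<And>t. t \<in> ?S \<Longrightarrow> \<exists>k::int. t = of_int k * m"
  proof (rule discrete_subgroup_real[of ?S 1 "e / cmod a"])
    show "x - y \<in> ?S" if "x \<in> ?S" "y \<in> ?S" for x y
      using periods_diff[of "of_real x * a" "of_real y * a"] that by (simp add: algebra_simps)
    show "e / cmod a \<le> x" if "x \<in> ?S" "0 < x" for x
      using e(2)[of "of_real x * a"] that a(2) by (simp add: norm_mult divide_le_eq)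
  qed (use a e in auto)
  define \<tau> where "\<tau> = of_real m * a"
  have t0: "\<tau> \<noteq> 0" using m(1) a(2) by (simp add: \<tau>_def)
  have tp: "\<tau> \<in> periods" using m(2) by (simp add: \<tau>_def)
  have per: "periods = {of_int k * \<tau> | k. True}"
  proof (intro equalityI subsetI)
    fix b assume b: "b \<in> periods"
    then obtain x where x: "b = of_real x * a" using ainR by blast
    then obtain k :: int where "x = of_int k * m" using m(3)[of x] b by auto
    then show "b \<in> {of_int k * \<tau> | k. True}" by (auto simp: x \<tau>_def)
  next
    fix b assume "b \<in> {of_int k * \<tau> | k. True}"
    then show "b \<in> periods" using periods_int[OF tp] by auto
  qed
  have zp: "v \<in> periods" if v: "\<phi> v = Fin 0" for v
  proof (cases "v = 0")
    case False
    obtain r where r: "cmod r = 1" "\<And>z. \<phi> (v + r * z) = \<phi> z" using local_symmetry[OF v False] by blast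
    have r0: "r \<noteq> 0" using r by auto
    have "\<phi> (z + r * \<tau>) = \<phi> z" for z
    proof -
      let ?u = "(z - v) / r"
      have "z + r * \<tau> = v + r * (?u + \<tau>)" using r0 by (simp add: field_simps)
      then have "\<phi> (z + r * \<tau>) = \<phi> ?u" using tp by (simp only: r(2)) (simp add: periods_def)
      also have "\<dots> = \<phi> (v + r * ?u)" by (simp only: r(2))
      finally show ?thesis using r0 by simp
    qed
    then have "r * \<tau> \<in> periods" by (simp add: periods_def)
    then obtain k :: int where "r * \<tau> = of_int k * \<tau>" unfolding per by blast
    then have rk: "r = of_int k" using t0 by simp
    then have "\<bar>k\<bar> = 1" using r(1) by simp
    then have "k = 1 \<or> k = -1" by auto
    \<comment> \<open>The symmetry \<open>v - z\<close> fixes \<open>v / 2\<close> and makes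
      \<open>\<phi>\<close> non-injective around it. But \<open>v / 2\<close> lies on the line, so
      \<open>\<phi>\<close> is an immersion there.\<close>
    moreover have "k \<noteq> -1"
    proof
      assume "k = -1"
      then have sym: "\<phi> (v - z) = \<phi> z" for z using r(2)[of z] rk by simp
      obtain x where "(lam - 1) * v = of_real x * a"
        using ainR[OF zero_gives_period[OF r(2,1)]] by blast
      then have "v = of_real x * a / (lam - 1)" using l1 by (simp add: field_simps)
      then have "v / 2 = of_real (x / (l - 1) / 2) * a" by (simp add: lr)
      then have "\<phi> (v / 2) \<in> J" by (simp only: lineJ)
      then obtain d where d: "d > 0" "inj_on \<phi> (ball (v / 2) d)"
        using sph_holo_locally_injective[OF holo sd_nonzero] by blast
      have "v / 2 - of_real (d / 2) = v / 2 + of_real (d / 2)"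
      proof (rule inj_onD[OF d(2)])
        have "v / 2 - of_real (d / 2) = v - (v / 2 + of_real (d / 2))" by simp
        then show "\<phi> (v / 2 - of_real (d / 2)) = \<phi> (v / 2 + of_real (d / 2))" by (simp only: sym)
      qed (use d(1) in \<open>auto simp: dist_norm norm_divide\<close>)
      then show False using d(1) by simp
    qed
    ultimately have "r = 1" using rk by simp
    then show ?thesis using r(2) by (simp add: periods_def add.commute)
  qed (simp add: periods_zero)
  obtain L :: int where "lam * \<tau> = of_int L * \<tau>" using periods_lam[OF tp] unfolding per by blast
  then have lamL: "lam = of_int L" using t0 by simp
  have "\<phi> z = Fin 0 \<longleftrightarrow> (\<exists>k::int. z = of_int k * \<tau>)" for z
    using zp[of z] periods_zeros[of z] unfolding per by blast
  from that[OF t0 per this lamL] show ?thesis .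
qed

end

subsection \<open>Identifying the rational map\<close>

lemma sphere_inv_Rat: "sphere_inv \<in> Rat"
proof -
  have "sphere_inv = mob 0 1 1 0"
  proof
    fix x
    obtain a b where x: "x = sphere_quot a b" "a \<noteq> 0 \<or> b \<noteq> 0" by (rule sphere_quot_cases)
    have "mob 0 1 1 0 x = sphere_quot b a" using mob_sphere_quot[of 0 0 1 1 a b] x by simp
    then show "sphere_inv x = mob 0 1 1 0 x" using x by (auto simp: sphere_quot_def)
  qed
  then show ?thesis using mob_Rat[of 0 0 1 1] by simp
qed

lemma sphere_inv_eq_Infty_iff: "sphere_inv x = Infty \<longleftrightarrow> x = Fin 0"
  by (metis sphere_inv.simps(2) sphere_inv_inv)

lemma Rat_eqI:
  assumes "f \<in> Rat" "h \<in> Rat" and eq: "\<And>u. u \<noteq> 0 \<Longrightarrow> f (Fin u) = h (Fin u)"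
  shows "f = h"
proof
  fix x
  have lim: "f (k (Fin 0)) = h (k (Fin 0))"
    if k: "k \<in> {id, sphere_inv}" and e: "\<And>u. u \<noteq> 0 \<Longrightarrow> f (k (Fin u)) = h (k (Fin u))" for k
  proof (rule tendsto_unique)
    have "((\<lambda>u. Fin u) \<longlongrightarrow> Fin 0) (at 0)" by (intro tendsto_Fin tendsto_ident_at)
    then have kl: "((\<lambda>u. k (Fin u)) \<longlongrightarrow> k (Fin 0)) (at 0)"
      using k tendsto_sphere_inv by auto
    show "((\<lambda>u. f (k (Fin u))) \<longlongrightarrow> f (k (Fin 0))) (at 0)"
      using kl by (rule isCont_tendsto_compose[OF Rat_isCont[OF assms(1)]])
    have "((\<lambda>u. h (k (Fin u))) \<longlongrightarrow> h (k (Fin 0))) (at 0)"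
      using kl by (rule isCont_tendsto_compose[OF Rat_isCont[OF assms(2)]])
    then show "((\<lambda>u. f (k (Fin u))) \<longlongrightarrow> h (k (Fin 0))) (at 0)"
      by (rule Lim_transform_eventually) (auto simp: eventually_at_filter e)
  qed simp
  show "f x = h x"
  proof (cases x)
    case (Fin z)
    then show ?thesis using eq lim[of id] by (cases "z = 0") auto
  next
    case Infty
    have "f (sphere_inv (Fin 0)) = h (sphere_inv (Fin 0))"
    proof (rule lim)
      fix u :: complex assume "u \<noteq> 0"
      then show "f (sphere_inv (Fin u)) = h (sphere_inv (Fin u))"
        using eq[of "1 / u"] by (simp add: sphere_quot_def)
    qed simp
    then show ?thesis using Infty by (simp add: sphere_quot_def)
  qed
qed

section \<open>Descent of the linearisation to the punctured plane\<close>

context linearised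
begin

text \<open>Read through a local inverse of \<open>\<phi>\<close>, one step is multiplication by
  \<open>lam * lam\<close>, so an orbit can converge to the fixed point only by being equal to it.
  Two applications of \<open>g\<close> make up a step because the multiplier will be an integer of
  either sign.\<close>

lemma repelled:
  assumes step: "\<And>n. x (Suc n) = g (g (x n))" and lim: "x \<longlonglongrightarrow> Fin 0"
  shows "\<exists>n. x n = Fin 0"
proof -
  let ?h = "sph_repr \<phi> 0"
  have h: "?h analytic_on {0}" "\<forall>\<^sub>F u in nhds 0. \<phi> u = Fin (?h u)"
    using sph_holo_repr[OF holo[of 0]] phi0 by (auto simp: chart_at_def)
  have h0: "?h 0 = 0" by (simp add: sph_repr_def phi0 chart_at_def)
  have d: "deriv ?h 0 \<noteq> 0" using sph_holo_deriv_nonzero[OF holo sd0] .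
  obtain \<kappa> where "\<kappa> analytic_on {?h 0}" "\<kappa> (?h 0) = 0" "\<forall>\<^sub>F y in nhds (?h 0). ?h (\<kappa> y) = y"
      "\<forall>\<^sub>F v in nhds 0. \<kappa> (?h v) = v"
    using analytic_local_inverse[OF h(1) d] by blast
  then have k: "\<kappa> analytic_on {0}" "\<kappa> 0 = 0" "\<forall>\<^sub>F y in nhds 0. ?h (\<kappa> y) = y"
      "\<forall>\<^sub>F v in nhds 0. \<kappa> (?h v) = v" by (simp_all add: h0)
  define v where "v n = \<kappa> (to_complex (x n))" for n
  have c0: "(\<lambda>n. to_complex (x n)) \<longlonglongrightarrow> 0"
    using tendsto_to_complex[OF lim] by simp
  have v0: "v \<longlonglongrightarrow> 0"
    using isCont_tendsto_compose[OF analytic_at_imp_isCont[OF k(1)] c0] k(2) by (simp add: v_def[abs_def])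
  have lv0: "(\<lambda>n. lam * (lam * v n)) \<longlonglongrightarrow> 0"
    using tendsto_mult[OF tendsto_const tendsto_mult[OF tendsto_const v0], of lam lam] by simp
  have "\<forall>\<^sub>F n in sequentially. \<phi> (v n) = x n \<and> v (Suc n) = lam * (lam * v n)"
    using tendsto_eventually_not_Infty[OF lim] eventually_compose_filterlim[OF k(3) c0]
      eventually_compose_filterlim[OF h(2) v0] eventually_compose_filterlim[OF k(4) lv0]
      eventually_compose_filterlim[OF h(2) lv0]
  proof eventually_elim
    case (elim n)
    have a: "\<phi> (v n) = x n" using elim by (simp add: v_def Fin_to_complex)
    then have "x (Suc n) = \<phi> (lam * (lam * v n))" by (simp add: step funeq)
    then show ?case using a elim(4,5) by (simp add: v_def[of "Suc n"])
  qed
  then obtain N where N: "\<And>n. n \<ge> N \<Longrightarrow> \<phi> (v n) = x n \<and> v (Suc n) = lam * (lam * v n)"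
    by (auto simp: eventually_sequentially)
  have grow: "cmod (v N) \<le> cmod (v (N + n))" for n
  proof (induction n)
    case (Suc n)
    have "1 * (1 * cmod (v (N + n))) \<le> cmod lam * (cmod lam * cmod (v (N + n)))"
      using lam by (intro mult_mono) auto
    then show ?case using Suc N[of "N + n"] by (simp add: norm_mult)
  qed simp
  have "(\<lambda>n. cmod (v (N + n))) \<longlonglongrightarrow> cmod 0"
    using LIMSEQ_ignore_initial_segment[OF v0, of N] by (intro tendsto_norm) (simp add: add.commute)
  then have "cmod (v N) \<le> 0" using grow by (intro LIMSEQ_le_const) auto
  then have "x N = Fin 0" using N[of N] phi0 by simp
  then show ?thesis ..
qed

text \<open>\<open>\<phi>\<close> descends to the quotient of the plane by its periods, which \<open>exp\<close> identifies with the punctured plane.\<close>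

definition descend :: "complex \<Rightarrow> complex \<Rightarrow> riemann_sphere" where
  "descend \<tau> u = \<phi> (\<tau> * Ln u / (2 * pi * \<i>))"

text \<open>Other logarithms differ by multiples of \<open>2 * pi * \<i>\<close>, which become
  multiples of the period, so the branch is immaterial.\<close>

lemma descend_exp:
  assumes "\<tau> \<in> periods"
  shows "descend \<tau> (exp s) = \<phi> (\<tau> * s / (2 * pi * \<i>))"
proof -
  have "exp (Ln (exp s)) = exp s" by simp
  then obtain n :: int where n: "Ln (exp s) = s + (of_int (2 * n) * pi) * \<i>"
    unfolding exp_eq by blast
  have "\<tau> * Ln (exp s) / (2 * pi * \<i>) = \<tau> * s / (2 * pi * \<i>) + of_int n * \<tau>"
  proof -
    have "\<tau> * ((of_int (2 * n) * pi) * \<i>) / (2 * pi * \<i>) = of_int n * \<tau>"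
      by (subst nonzero_divide_eq_eq) (simp_all add: mult_ac)
    then show ?thesis unfolding n by (simp only: distrib_left add_divide_distrib)
  qed
  then show ?thesis using periods_int[OF assms, of n] by (simp only: descend_def) (simp add: periods_def)
qed

lemma descend_holo:
  assumes t: "\<tau> \<in> periods" and u: "u \<noteq> 0"
  shows "sph_holo (descend \<tau>) u"
    and "sd (descend \<tau>) u = sd \<phi> (\<tau> * Ln u / (2 * pi * \<i>)) * (cmod \<tau> / (2 * pi * cmod u))"
proof -
  \<comment> \<open>This branch of the logarithm is holomorphic near \<open>u\<close> even when
    \<open>u\<close> lies on the cut of \<open>Ln\<close>.\<close>
  let ?k = "\<lambda>v. \<tau> * (Ln (v / u) + Ln u) / (2 * pi * \<i>)"
  have an: "?k analytic_on {u}"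
  proof -
    have "(\<lambda>v. Ln (v / u)) analytic_on {u}" using u by (intro analytic_intros) auto
    then show ?thesis using u by (intro analytic_intros) auto
  qed
  have "((\<lambda>v. Ln (v / u)) has_field_derivative 1 / u) (at u)"
    using u by (auto intro!: derivative_eq_intros)
  then have "(?k has_field_derivative \<tau> * (1 / u + 0) / (2 * pi * \<i>)) (at u)"
    by (intro DERIV_cdivide DERIV_cmult DERIV_add DERIV_const)
  then have "deriv ?k u = \<tau> * (1 / u + 0) / (2 * pi * \<i>)" by (rule DERIV_imp_deriv)
  then have dk: "cmod (deriv ?k u) = cmod \<tau> / (2 * pi * cmod u)"
    by (simp add: norm_divide norm_mult)
  have ku: "?k u = \<tau> * Ln u / (2 * pi * \<i>)" using u by simp
  have "\<forall>\<^sub>F v in nhds u. v \<noteq> 0" using u by (simp add: t1_space_nhds)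
  then have ev: "\<forall>\<^sub>F v in nhds u. descend \<tau> v = \<phi> (?k v)"
  proof eventually_elim
    case (elim v)
    have "exp (Ln (v / u) + Ln u) = v" using elim u by (simp add: exp_add)
    then show ?case using descend_exp[OF t, of "Ln (v / u) + Ln u"] by simp
  qed
  show "sph_holo (descend \<tau>) u"
    using sph_holo_cong(1)[OF ev] sph_holo_compose_analytic(1)[OF an holo] by simp
  show "sd (descend \<tau>) u = sd \<phi> (\<tau> * Ln u / (2 * pi * \<i>)) * (cmod \<tau> / (2 * pi * cmod u))"
    using sph_holo_cong(2)[OF ev] sph_holo_compose_analytic(2)[OF an holo] dk ku by simp
qed

end

locale linearised_lattice = linearised +
  fixes \<tau> :: complex and L :: int
  assumes tau0: "\<tau> \<noteq> 0" and per: "\<tau> \<in> periods"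
    and zeros: "\<And>z. \<phi> z = Fin 0 \<longleftrightarrow> (\<exists>k::int. z = of_int k * \<tau>)" and lamL: "lam = of_int L"
begin

lemma descend_zero_iff:
  assumes "u \<noteq> 0"
  shows "descend \<tau> u = Fin 0 \<longleftrightarrow> u = 1"
proof
  assume "descend \<tau> u = Fin 0"
  then obtain k :: int where "\<tau> * Ln u / (2 * pi * \<i>) = of_int k * \<tau>"
    unfolding descend_def zeros by blast
  then have "\<tau> * Ln u = of_int k * \<tau> * (2 * pi * \<i>)" by (simp add: divide_eq_eq)
  then have "Ln u = of_int k * (2 * pi * \<i>)" using tau0 by simp
  then have "u = exp (of_int k * (2 * pi * \<i>))" using assms exp_Ln by metis
  also have "\<dots> = 1" unfolding exp_eq_1 by auto
  finally show "u = 1" .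
qed (simp add: descend_def phi0)

text \<open>\<open>exp (of_int L * Ln u)\<close> is the power of \<open>u\<close> with integer
  exponent \<open>L\<close>, written uniformly for both signs.\<close>

lemma descend_conj: "g (descend \<tau> u) = descend \<tau> (exp (of_int L * Ln u))"
proof -
  have "g (descend \<tau> u) = \<phi> (lam * (\<tau> * Ln u / (2 * pi * \<i>)))" by (simp only: descend_def funeq)
  also have "lam * (\<tau> * Ln u / (2 * pi * \<i>)) = \<tau> * (of_int L * Ln u) / (2 * pi * \<i>)"
    by (simp add: lamL mult_ac)
  also have "\<phi> \<dots> = descend \<tau> (exp (of_int L * Ln u))" by (rule descend_exp[OF per, symmetric])
  finally show ?thesis .
qed

lemma L_gt: "\<bar>L\<bar> > 1"
proof -
  have "real_of_int \<bar>L\<bar> > 1" using lam by (simp add: lamL)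
  then show ?thesis by linarith
qed

lemma norm_exp_L:
  assumes "u \<noteq> 0" "cmod u \<noteq> 1"
  shows "cmod (exp (of_int L * Ln u)) \<noteq> 1"
proof -
  have "Re (of_int L * Ln u) = of_int L * ln (cmod u)" using assms(1) by simp
  moreover have "ln (cmod u) \<noteq> 0" using assms by simp
  ultimately show ?thesis using L_gt by (auto simp: norm_exp_eq_Re)
qed

text \<open>Off the unit circle \<open>descend\<close> omits \<open>Fin 0\<close>, hence also the
  preimages \<open>q1\<close> and \<open>q2\<close>, as taking powers preserves
  \<open>cmod u \<noteq> 1\<close>. The reciprocal is therefore holomorphic near 0 and omits two
  values, and the great Picard theorem leaves a finite limit or a pole. A pole would mean that
  \<open>descend\<close> tends to the repelling fixed point.\<close>

lemma descend_limit: "\<exists>l. ((\<lambda>u. to_complex (sphere_inv (descend \<tau> u))) \<longlongrightarrow> l) (at 0)"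
proof -
  let ?F = "descend \<tau>"
  let ?R = "\<lambda>u. to_complex (sphere_inv (?F u))"
  let ?D = "ball 0 1 - {0::complex}"
  obtain q1 where q1: "q1 \<noteq> Fin 0" "g q1 = Fin 0" using ex_other_preimage by blast
  obtain q2 where q2: "g q2 = q1" using Rat_surj[OF gRat] by blast
  have q20: "q2 \<noteq> Fin 0" using q2 q1 fix0 by auto
  have q12: "q1 \<noteq> q2" using q1 q2 by auto
  have o1: "?F u \<noteq> q1" if "u \<noteq> 0" "cmod u \<noteq> 1" for u
    using descend_conj[of u] descend_zero_iff[of "exp (of_int L * Ln u)"] norm_exp_L[OF that] q1(2)
    by (metis exp_not_eq_zero norm_one)
  have o2: "?F u \<noteq> q2" if "u \<noteq> 0" "cmod u \<noteq> 1" for u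
    using descend_conj[of u] o1[OF exp_not_eq_zero norm_exp_L[OF that]] q2 by metis
  have o0: "?F u \<noteq> Fin 0" if "u \<noteq> 0" "cmod u \<noteq> 1" for u
    using descend_zero_iff[OF that(1)] that(2) by auto
  have FR: "sphere_inv (?F u) = Fin (?R u)" if "u \<noteq> 0" "cmod u \<noteq> 1" for u
    using o0[OF that] by (simp add: Fin_to_complex sphere_inv_eq_Infty_iff)
  have "sph_holo (\<lambda>u. sphere_inv (?F u)) u" if "u \<noteq> 0" for u
    using descend_holo(1)[OF per that] Rat_sph_map_at[OF sphere_inv_Rat] by (rule sph_holo_compose(1))
  then have hol: "?R holomorphic_on ?D"
    by (intro sph_holo_finite_holomorphic) (use o0 sphere_inv_eq_Infty_iff in auto)
  define r1 r2 where "r1 = to_complex (sphere_inv q1)" and "r2 = to_complex (sphere_inv q2)"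
  have r: "sphere_inv q1 = Fin r1" "sphere_inv q2 = Fin r2"
    using q1(1) q20 by (auto simp: r1_def r2_def Fin_to_complex sphere_inv_eq_Infty_iff)
  have omit: "?R u \<noteq> r1 \<and> ?R u \<noteq> r2" if "u \<in> ?D" for u
    using FR[of u] o1[of u] o2[of u] r that by (metis Diff_iff insert_iff less_irrefl mem_ball_0 sphere_inv_inv)
  have r12: "r1 \<noteq> r2" using r q12 by (metis sphere_inv_inv)
  define G where "G u = ?R u - r1" for u
  have Gh: "G holomorphic_on ?D" unfolding G_def using hol by (intro holomorphic_intros)
  have Gne: "G u \<noteq> 0 \<and> G u \<noteq> r2 - r1" if "u \<in> ?D" for u using omit[OF that] by (simp add: G_def)
  have r21: "0 \<noteq> r2 - r1" using r12 by simp
  obtain l where l: "(G \<longlongrightarrow> l) (at 0) \<or> ((inverse \<circ> G) \<longlongrightarrow> l) (at 0)"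
    using great_Picard[OF open_ball _ r21 Gh Gne] by auto
  have RG: "?R u = G u + r1" for u by (simp add: G_def)
  have evD: "\<forall>\<^sub>F u in at 0. u \<in> ?D"
    unfolding eventually_at_filter eventually_nhds_metric by (auto intro!: exI[of _ 1])
  consider "(G \<longlongrightarrow> l) (at 0)" | "((inverse \<circ> G) \<longlongrightarrow> l) (at 0)" "l \<noteq> 0" | "((inverse \<circ> G) \<longlongrightarrow> 0) (at 0)"
    using l by blast
  then show ?thesis
  proof cases
    case 1
    then have "(?R \<longlongrightarrow> l + r1) (at 0)" unfolding RG by (intro tendsto_intros)
    then show ?thesis ..
  next
    case 2
    then have "((\<lambda>u. inverse ((inverse \<circ> G) u)) \<longlongrightarrow> inverse l) (at 0)" by (intro tendsto_inverse)
    then have "(G \<longlongrightarrow> inverse l) (at 0)" by simp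
    then have "(?R \<longlongrightarrow> inverse l + r1) (at 0)" unfolding RG by (intro tendsto_intros)
    then show ?thesis ..
  next
    case 3
    then have i0: "((\<lambda>u. inverse (G u)) \<longlongrightarrow> 0) (at 0)" by (simp add: o_def)
    then have "((\<lambda>u. 1 + r1 * inverse (G u)) \<longlongrightarrow> 1 + r1 * 0) (at 0)" by (intro tendsto_intros)
    then have i1: "((\<lambda>u. 1 + r1 * inverse (G u)) \<longlongrightarrow> 1) (at 0)" by simp
    \<comment> \<open>With \<open>i = inverse (G u)\<close> one has
      \<open>1 / (G u + r1) = i / (1 + r1 * i)\<close>, which tends to 0 with
      \<open>i\<close>.\<close>
    have "((\<lambda>u. Fin (inverse (G u) * inverse (1 + r1 * inverse (G u)))) \<longlongrightarrow> Fin (0 * inverse 1)) (at 0)"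
      by (intro tendsto_intros i0 i1) auto
    moreover have "\<forall>\<^sub>F u in at 0. Fin (inverse (G u) * inverse (1 + r1 * inverse (G u))) = ?F u"
      using evD tendsto_imp_eventually_ne[OF i1, of 0, OF one_neq_zero]
    proof eventually_elim
      case (elim u)
      have G: "G u \<noteq> 0" using Gne elim(1) by blast
      have "?R u = G u * (1 + r1 * inverse (G u))" using G by (simp add: RG distrib_left)
      moreover have "?F u = sphere_inv (Fin (?R u))"
        using FR[of u] elim(1) by (metis Diff_iff insert_iff less_irrefl mem_ball_0 sphere_inv_inv)
      ultimately show ?case using G elim(2) by (simp add: sphere_quot_def inverse_eq_divide)
    qed
    ultimately have F0: "(?F \<longlongrightarrow> Fin 0) (at 0)"
      using Lim_transform_eventually by fastforce
    define N where "N = nat (L * L)"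
    have LL: "L * L > 1"
      using L_gt by (metis abs_mult_self_eq less_1_mult)
    then have N: "N \<ge> 2" "lam * lam = of_nat N" by (auto simp: N_def lamL)
    have FN: "?F (u ^ N) = g (g (?F u))" if "u \<noteq> 0" for u
    proof -
      have "u ^ N = exp (of_nat N * Ln u)" using that by (simp add: exp_of_nat_mult)
      then have "?F (u ^ N) = \<phi> (\<tau> * (of_nat N * Ln u) / (2 * pi * \<i>))" using descend_exp[OF per] by simp
      also have "\<tau> * (of_nat N * Ln u) / (2 * pi * \<i>) = lam * (lam * (\<tau> * Ln u / (2 * pi * \<i>)))"
        by (simp add: mult_ac flip: N(2))
      finally show ?thesis by (simp only: funeq descend_def)
    qed
    \<comment> \<open>Each term is the \<open>N\<close>-th power of the preceding one, so
      \<open>descend\<close> turns the sequence into an orbit of \<open>g \<circ> g\<close>. The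
      terms stay off 1, so this orbit never meets \<open>Fin 0\<close>, against
      \<open>repelled\<close>.\<close>
    define u where "u n = (1 / 2 :: complex) ^ (N ^ n)" for n
    have "n \<le> N ^ n" for n
    proof -
      have "n < 2 ^ n" by (rule less_exp)
      also have "2 ^ n \<le> N ^ n" using N(1) by (rule power_mono) simp
      finally show ?thesis by simp
    qed
    then have "filterlim (\<lambda>n. N ^ n) at_top sequentially"
      by (intro filterlim_at_top_mono[OF filterlim_ident] always_eventually) auto
    then have u0: "u \<longlonglongrightarrow> 0"
      unfolding u_def by (rule filterlim_compose[OF LIMSEQ_power_zero, rotated]) (simp add: norm_divide)
    have une: "u n \<noteq> 0" for n by (simp add: u_def)
    have "filterlim u (at 0) sequentially" using u0 une by (simp add: filterlim_at)
    then have x0: "(\<lambda>n. ?F (u n)) \<longlonglongrightarrow> Fin 0" using F0 by (rule filterlim_compose[rotated])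
    have "u (Suc n) = u n ^ N" for n by (simp add: u_def mult.commute flip: power_mult)
    then have "\<exists>n. ?F (u n) = Fin 0" using FN[OF une] x0 by (intro repelled) auto
    then obtain n where "u n = 1" using descend_zero_iff[OF une] by blast
    then have "cmod (1 / 2) ^ (N ^ n) = 1" unfolding u_def by (metis norm_one norm_power)
    moreover have "cmod (1 / 2) ^ (N ^ n) < 1"
      using N(1) by (intro power_less_one_iff[THEN iffD2]) (auto simp: norm_divide)
    ultimately show ?thesis by simp
  qed
qed

end

context linearised_lattice
begin

text \<open>Replacing \<open>\<tau>\<close> by its negative replaces \<open>u\<close> by
  \<open>1 / u\<close>; so the limit at 0 also serves at infinity.\<close>

lemma linearised_lattice_uminus: "linearised_lattice g J lam \<phi> (- \<tau>) L"
proof (intro_locales, unfold_locales)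
  show "- \<tau> \<noteq> 0" "- \<tau> \<in> periods" "lam = of_int L"
    using tau0 per lamL periods_uminus by auto
  show "\<phi> z = Fin 0 \<longleftrightarrow> (\<exists>k::int. z = of_int k * - \<tau>)" for z
    unfolding zeros
  proof safe
    fix k :: int
    show "\<exists>k'. of_int k * \<tau> = of_int k' * - \<tau>" "\<exists>k'. of_int k * - \<tau> = of_int k' * \<tau>"
      by (rule exI[of _ "- k"], simp)+
  qed
qed

text \<open>The reciprocal of \<open>descend\<close> has a single pole, at 1, and finite limits at 0
  and at infinity. Multiplied by \<open>u - 1\<close> it becomes an entire function of at most
  linear growth, that is, an affine one.\<close>

lemma descend_Moebius:
  obtains \<alpha> \<beta> where "\<alpha> + \<beta> \<noteq> 0"
    "\<And>u. u \<noteq> 0 \<Longrightarrow> descend \<tau> u = sphere_quot (u - 1) (\<alpha> + \<beta> * u)"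
proof -
  let ?F = "descend \<tau>"
  define R where "R u = to_complex (sphere_inv (?F u))" for u
  have FR: "sphere_inv (?F u) = Fin (R u)" if "u \<noteq> 0" "u \<noteq> 1" for u
    using descend_zero_iff[OF that(1)] that(2) by (simp add: R_def Fin_to_complex sphere_inv_eq_Infty_iff)
  have "sph_holo (\<lambda>u. sphere_inv (?F u)) u" if "u \<noteq> 0" for u
    using descend_holo(1)[OF per that] Rat_sph_map_at[OF sphere_inv_Rat] by (rule sph_holo_compose(1))
  then have hol: "R holomorphic_on UNIV - {0, 1}"
    unfolding R_def by (intro sph_holo_finite_holomorphic)
      (use descend_zero_iff sphere_inv_eq_Infty_iff in auto)
  obtain l where l: "(R \<longlongrightarrow> l) (at 0)" using descend_limit unfolding R_def by blast
  obtain l' where l': "((\<lambda>v. R (1 / v)) \<longlongrightarrow> l') (at 0)"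
  proof -
    interpret neg: linearised_lattice g J lam \<phi> "- \<tau>" L by (rule linearised_lattice_uminus)
    obtain l' where "((\<lambda>u. to_complex (sphere_inv (descend (- \<tau>) u))) \<longlongrightarrow> l') (at 0)"
      using neg.descend_limit by blast
    moreover have "descend (- \<tau>) u = ?F (1 / u)" if "u \<noteq> 0" for u
    proof -
      have "1 / u = exp (- Ln u)" using that by (simp add: exp_minus inverse_eq_divide)
      then show ?thesis using descend_exp[OF per, of "- Ln u"] by (simp add: descend_def)
    qed
    ultimately have "((\<lambda>v. R (1 / v)) \<longlongrightarrow> l') (at 0)"
      unfolding R_def by (elim Lim_transform_eventually) (simp add: eventually_at_filter)
    then show ?thesis by (rule that)
  qed
  have F1: "?F 1 = Fin 0" using descend_zero_iff[of 1] by simp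
  have "sd ?F 1 \<noteq> 0"
    using descend_holo(2)[OF per, of 1] sd0 tau0 by simp
  let ?h = "sph_repr ?F 1"
  have holo1: "sph_holo ?F 1" using descend_holo(1)[OF per] by simp
  have h: "?h analytic_on {1}" "\<forall>\<^sub>F u in nhds 1. ?F u = Fin (?h u)"
    using sph_holo_repr[OF holo1] F1 by (auto simp: chart_at_def)
  have h1: "?h 1 = 0" by (simp add: sph_repr_def F1 chart_at_def)
  have dh: "deriv ?h 1 \<noteq> 0" using sph_holo_deriv_nonzero[OF holo1 \<open>sd ?F 1 \<noteq> 0\<close>] .
  \<comment> \<open>The zero of \<open>descend\<close> at 1 is simple, so its reciprocal has a
    simple pole there, with residue \<open>c\<close>.\<close>
  define c where "c = 1 / deriv ?h 1"
  have c0: "c \<noteq> 0" using dh by (simp add: c_def)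
  have "(?h has_field_derivative deriv ?h 1) (at 1)"
    using h(1) by (simp add: DERIV_deriv_iff_field_differentiable analytic_on_imp_differentiable_at)
  then have "((\<lambda>u. 1 / ((?h u - ?h 1) / (u - 1))) \<longlongrightarrow> c) (at 1)"
    unfolding c_def has_field_derivative_iff using dh by (intro tendsto_divide tendsto_const)
  moreover have "\<forall>\<^sub>F u in at 1. 1 / ((?h u - ?h 1) / (u - 1)) = (u - 1) * R u"
  proof -
    have "\<forall>\<^sub>F u in at 1. ?F u = Fin (?h u)" using h(2) by (simp add: eventually_at_filter eventually_mono)
    moreover have "\<forall>\<^sub>F u in at (1::complex). u \<noteq> 1 \<and> u \<noteq> 0"
      unfolding eventually_at_filter
      by (rule eventually_mono[OF t1_space_nhds[of 1 "0::complex"]]) auto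
    ultimately show ?thesis
    proof eventually_elim
      case (elim u)
      have "?h u \<noteq> 0" using elim descend_zero_iff[of u] by auto
      then have "R u = 1 / ?h u" using elim(1) by (simp add: R_def sphere_quot_def)
      then show ?case by (simp add: h1)
    qed
  qed
  ultimately have lim1: "((\<lambda>u. (u - 1) * R u) \<longlongrightarrow> c) (at 1)" by (rule Lim_transform_eventually)
  have lim0: "((\<lambda>u. (u - 1) * R u) \<longlongrightarrow> (0 - 1) * l) (at 0)" by (intro tendsto_intros l)
  \<comment> \<open>The value at 0 is the limit \<open>(0 - 1) * l\<close>; both exceptional values
    are the ones that make \<open>Q\<close> continuous.\<close>
  define Q where "Q u = (if u = 0 then - l else if u = 1 then c else (u - 1) * R u)" for u
  have Qh': "Q holomorphic_on UNIV - {0, 1}"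
  proof -
    have "(\<lambda>u. (u - 1) * R u) holomorphic_on UNIV - {0, 1}" by (intro holomorphic_intros hol)
    then show ?thesis by (rule holomorphic_transform) (auto simp: Q_def)
  qed
  have Qc: "isCont Q u" for u
  proof -
    have ev: "\<forall>\<^sub>F v in at u. v \<noteq> 0 \<and> v \<noteq> 1" if "u = 0 \<or> u = 1"
      using that t1_space_nhds[of 1 "0::complex"] t1_space_nhds[of 0 "1::complex"]
      unfolding eventually_at_filter by (auto elim: eventually_mono)
    consider "u = 0" | "u = 1" | "u \<noteq> 0" "u \<noteq> 1" by blast
    then show ?thesis
    proof cases
      case 1
      have "(Q \<longlongrightarrow> - l) (at 0)"
        by (rule Lim_transform_eventually[of "\<lambda>u. (u - 1) * R u"])
          (use lim0 ev 1 in \<open>auto simp: Q_def elim!: eventually_mono\<close>)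
      then show ?thesis using 1 by (simp add: isCont_def Q_def)
    next
      case 2
      have "(Q \<longlongrightarrow> c) (at 1)"
        by (rule Lim_transform_eventually[OF lim1])
          (use ev 2 in \<open>auto simp: Q_def elim!: eventually_mono\<close>)
      then show ?thesis using 2 by (simp add: isCont_def Q_def)
    next
      case 3
      have "open (UNIV - {0, 1 :: complex})" by (simp add: open_Diff)
      then show ?thesis using Qh' 3
        by (meson DiffI UNIV_I analytic_at_imp_isCont empty_iff holomorphic_on_imp_analytic_at insert_iff)
    qed
  qed
  have Qh: "Q holomorphic_on UNIV"
    using Qc Qh' by (intro no_isolated_singularity[of UNIV Q "{0, 1}"])
      (auto simp: continuous_on_eq_continuous_at)
  have "\<forall>\<^sub>F v in at 0. dist (R (1 / v)) l' < 1" using l' by (simp add: tendsto_iff)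
  then obtain \<delta> where \<delta>: "\<delta> > 0" "\<And>v. v \<noteq> 0 \<Longrightarrow> cmod v < \<delta> \<Longrightarrow> cmod (R (1 / v)) \<le> cmod l' + 1"
  proof -
    obtain \<delta> where d: "\<delta> > 0" "\<And>v. v \<noteq> 0 \<Longrightarrow> dist v 0 < \<delta> \<Longrightarrow> dist (R (1 / v)) l' < 1"
      using \<open>\<forall>\<^sub>F v in at 0. dist (R (1 / v)) l' < 1\<close> unfolding eventually_at by auto
    have "cmod (R (1 / v)) \<le> cmod l' + 1" if "v \<noteq> 0" "cmod v < \<delta>" for v
      using d(2)[of v] that norm_triangle_ineq2[of "R (1 / v)" l'] by (simp add: dist_norm)
    with d(1) show ?thesis by (rule that)
  qed
  define B where "B = cmod l' + 1"
  \<comment> \<open>The radius \<open>max 2 (2 / \<delta>)\<close> puts \<open>1 / u\<close> within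
    \<open>\<delta>\<close>, where \<open>R\<close> is bounded by \<open>B\<close>, and keeps
    \<open>u\<close> off 0 and 1.\<close>
  have Qsum: "Q u = (\<Sum>k\<le>1. (deriv ^^ k) Q 0 / fact k * u ^ k)" for u
  proof (rule Liouville_polynomial[OF Qh])
    fix u :: complex assume u: "max 2 (2 / \<delta>) \<le> cmod u"
    then have un: "u \<noteq> 0" "u \<noteq> 1" "cmod u \<ge> 2" by auto
    have "2 / \<delta> \<le> cmod u" using u by simp
    then have "2 \<le> cmod u * \<delta>" using \<delta>(1) by (simp add: divide_le_eq)
    then have "cmod (1 / u) < \<delta>" using un by (simp add: norm_divide divide_less_eq mult.commute)
    then have Rb: "cmod (R u) \<le> B" using \<delta>(2)[of "1 / u"] un by (simp add: B_def)
    have "cmod (u - 1) \<le> 2 * cmod u" using norm_triangle_ineq4[of u 1] un by simp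
    then have "cmod (Q u) \<le> (2 * cmod u) * B"
      using Rb un by (simp add: Q_def norm_mult mult_mono)
    then show "cmod (Q u) \<le> (2 * B) * cmod u ^ 1" by (simp add: mult_ac)
  qed
  have Qlin: "Q u = Q 0 + deriv Q 0 * u" for u
  proof -
    have "(\<Sum>k\<le>1. (deriv ^^ k) Q 0 / fact k * u ^ k) = Q 0 + deriv Q 0 * u" by simp
    with Qsum[of u] show ?thesis by (rule trans)
  qed
  show ?thesis
  proof (rule that[of "Q 0" "deriv Q 0"])
    show "Q 0 + deriv Q 0 \<noteq> 0" using Qlin[of 1] c0 by (simp add: Q_def)
    fix u :: complex assume u: "u \<noteq> 0"
    show "?F u = sphere_quot (u - 1) (Q 0 + deriv Q 0 * u)"
    proof (cases "u = 1")
      case True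
      have e: "Q 0 + deriv Q 0 * u = c" using Qlin[of u] True by (simp add: Q_def)
      show ?thesis unfolding e using True F1 c0 by (simp add: sphere_quot_def)
    next
      case False
      have "?F u = sphere_quot 1 (R u)" using FR[OF u False] by (metis sphere_inv.simps(1) sphere_inv_inv)
      also have "\<dots> = sphere_quot (u - 1) ((u - 1) * R u)"
        using False sphere_quot_scale[of "u - 1" 1 "R u"] by simp
      also have "(u - 1) * R u = Q u" using u False by (simp add: Q_def)
      finally show ?thesis by (simp only: Qlin[symmetric])
    qed
  qed
qed

text \<open>\<open>M\<close> is the Moebius map that \<open>descend\<close> turned out to be. It
  conjugates \<open>g\<close> to the power map of exponent \<open>L\<close> off 0, hence everywhere
  by continuity, and the degree is the absolute value of \<open>L = lam\<close>.\<close>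

lemma conjugate_to_power:
  obtains M where "M \<in> Aut_sphere" "cmod lam = rat_degree g"
    "inv M \<circ> g \<circ> M = ratmap (monom 1 (rat_degree g)) 1 \<or> inv M \<circ> g \<circ> M = ratmap 1 (monom 1 (rat_degree g))"
proof -
  obtain \<alpha> \<beta> where ab: "\<alpha> + \<beta> \<noteq> 0"
    and F: "\<And>u. u \<noteq> 0 \<Longrightarrow> descend \<tau> u = sphere_quot (u - 1) (\<alpha> + \<beta> * u)"
    using descend_Moebius by blast
  have det: "1 * \<alpha> \<noteq> (- 1) * \<beta>" using ab by (simp add: eq_neg_iff_add_eq_0)
  define M where "M = mob 1 (-1) \<beta> \<alpha>"
  have MA: "M \<in> Aut_sphere" unfolding M_def by (rule mob_Aut[OF det])
  note MR = Aut_sphereD[OF MA]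
  have MF: "M (Fin u) = descend \<tau> u" if "u \<noteq> 0" for u
    using mob_sphere_quot[OF det, of u 1] by (simp add: M_def F[OF that] sphere_quot_def[of u 1] add.commute)
  let ?G = "inv M \<circ> g \<circ> M"
  have GR: "?G \<in> Rat" "rat_degree ?G = rat_degree g"
    using Rat_compose(1)[OF Rat_compose(1)[OF MR(2) gRat] MR(1)]
      Rat_compose(2)[OF Rat_compose(1)[OF MR(2) gRat] MR(1)] Rat_compose(2)[OF MR(2) gRat] MR(5,6) by auto
  have G: "?G (Fin u) = Fin (exp (of_int L * Ln u))" if "u \<noteq> 0" for u
  proof -
    have "g (M (Fin u)) = M (Fin (exp (of_int L * Ln u)))"
      by (simp only: MF[OF that] MF[OF exp_not_eq_zero] descend_conj)
    then show ?thesis by (simp add: MR(3))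
  qed
  define n where "n = nat \<bar>L\<bar>"
  have n: "n \<ge> 2" "real n = \<bar>of_int L\<bar>" using L_gt by (auto simp: n_def)
  have c1: "coprime (monom 1 n) (1 :: complex poly)" "coprime (1 :: complex poly) (monom 1 n)" by auto
  have d1: "max (degree (monom (1::complex) n)) (degree (1 :: complex poly)) = n"
    "max (degree (1 :: complex poly)) (degree (monom (1::complex) n)) = n" by (auto simp: degree_monom_eq)
  have R1: "ratmap (monom 1 n) 1 \<in> Rat" "ratmap 1 (monom 1 n) \<in> Rat"
    "rat_degree (ratmap (monom 1 n) 1) = n" "rat_degree (ratmap 1 (monom 1 n)) = n"
    using c1 d1 n(1) rat_degree_ratmap[OF c1(1)] rat_degree_ratmap[OF c1(2)] by (auto intro!: RatI)
  have eq: "?G = ratmap (monom 1 n) 1 \<or> ?G = ratmap 1 (monom 1 n)"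
  proof (cases "L \<ge> 0")
    case True
    have "?G (Fin u) = ratmap (monom 1 n) 1 (Fin u)" if "u \<noteq> 0" for u
    proof -
      have "of_int L = (of_nat n :: complex)" using True by (simp add: n_def)
      then show ?thesis using G[OF that] that
        by (simp add: exp_of_nat_mult poly_monom sphere_quot_def)
    qed
    then show ?thesis using Rat_eqI[OF GR(1) R1(1)] by blast
  next
    case False
    have "?G (Fin u) = ratmap 1 (monom 1 n) (Fin u)" if "u \<noteq> 0" for u
    proof -
      have "of_int L = - (of_nat n :: complex)" using False by (simp add: n_def)
      then show ?thesis using G[OF that] that
        by (simp add: exp_minus exp_of_nat_mult poly_monom sphere_quot_def inverse_eq_divide)
    qed
    then show ?thesis using Rat_eqI[OF GR(1) R1(2)] by blast
  qed
  then have deg_n: "rat_degree g = n" using GR(2) R1(3,4) by metis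
  have "cmod lam = rat_degree g" using n(2) by (simp add: lamL deg_n)
  then show ?thesis using that[OF MA] eq deg_n by simp
qed

end

theorem (in linearised) linearised_rigidity:
  obtains M where "M \<in> Aut_sphere" "cmod lam = rat_degree g"
    "inv M \<circ> g \<circ> M = ratmap (monom 1 (rat_degree g)) 1 \<or> inv M \<circ> g \<circ> M = ratmap 1 (monom 1 (rat_degree g))"
proof -
  obtain \<tau> L where t: "\<tau> \<noteq> 0" "periods = {of_int k * \<tau> | k. True}"
    "\<And>z. \<phi> z = Fin 0 \<longleftrightarrow> (\<exists>k::int. z = of_int k * \<tau>)" "lam = of_int L"
    using zeros_lattice by blast
  have "\<tau> \<in> periods" unfolding t(2) by (intro CollectI exI[of _ 1]) auto
  then interpret linearised_lattice g J lam \<phi> \<tau> L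
    using t by unfold_locales auto
  show ?thesis using conjugate_to_power that by blast
qed

subsection \<open>Rigidity at an arbitrary repelling fixed point\<close>

lemma Aut_compose:
  assumes "\<phi> \<in> Aut_sphere" "\<psi> \<in> Aut_sphere"
  shows "\<phi> \<circ> \<psi> \<in> Aut_sphere" "inv (\<phi> \<circ> \<psi>) = inv \<psi> \<circ> inv \<phi>"
proof -
  note A = Aut_sphereD[OF assms(1)] Aut_sphereD[OF assms(2)]
  have R: "\<phi> \<circ> \<psi> \<in> Rat" "inv \<psi> \<circ> inv \<phi> \<in> Rat" using A by (auto intro: Rat_compose(1))
  show "\<phi> \<circ> \<psi> \<in> Aut_sphere" "inv (\<phi> \<circ> \<psi>) = inv \<psi> \<circ> inv \<phi>"
    using Aut_sphereI[OF R] A by (auto simp: o_def)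
qed

lemma conj_funpow:
  assumes "\<phi> \<in> Aut_sphere"
  shows "((\<phi> \<circ> g \<circ> inv \<phi>) ^^ n) = \<phi> \<circ> (g ^^ n) \<circ> inv \<phi>"
proof (induction n)
  case 0
  then show ?case using Aut_sphereD(4)[OF assms] by auto
next
  case (Suc n)
  then show ?case using Aut_sphereD(3)[OF assms] by (auto simp: fun_eq_iff)
qed

lemma conj_deriv_fixed:
  assumes \<phi>: "\<phi> \<in> Aut_sphere" and h: "\<And>x. sph_map_at h x" and fixp: "h y = y"
  shows "sph_deriv_norm (\<phi> \<circ> h \<circ> inv \<phi>) (\<phi> y) = sph_deriv_norm h y"
proof -
  note A = Aut_sphereD[OF \<phi>]
  note m = Rat_sph_map_at[OF A(1)] Rat_sph_map_at[OF A(2)]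
  have 1: "sph_deriv_norm (\<phi> \<circ> h) y = sph_deriv_norm \<phi> y * sph_deriv_norm h y"
    using sph_map_at_comp(2)[OF h m(1), of y] fixp by simp
  have "sph_deriv_norm (\<phi> \<circ> h \<circ> inv \<phi>) (\<phi> y) = sph_deriv_norm (\<phi> \<circ> h) y * sph_deriv_norm (inv \<phi>) (\<phi> y)"
    using sph_map_at_comp(2)[OF m(2) sph_map_at_comp(1)[OF h m(1)], of "\<phi> y"] by (simp only: A(3))
  moreover have "sph_deriv_norm (inv \<phi>) (\<phi> y) * sph_deriv_norm \<phi> y = 1"
  proof -
    have "inv \<phi> \<circ> \<phi> = id" using A(3) by auto
    then show ?thesis using sph_map_at_comp(2)[OF m(1) m(2), of y] by simp
  qed
  ultimately show ?thesis using 1 by (simp add: mult_ac)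
qed

text \<open>An automorphism moves \<open>p\<close> to 0. The spherical norm of the derivative is not
  invariant under it, but at periodic points the distortion factors cancel, and
  \<open>periodic\<close> speaks only of those.\<close>

theorem rigidity:
  assumes gRat: "g \<in> Rat" and deg: "rat_degree g \<ge> 2"
    and closedJ: "closed J" and backJ: "\<And>x. g x \<in> J \<Longrightarrow> x \<in> J"
    and nondeg: "\<And>x. x \<in> J \<Longrightarrow> sph_deriv_norm g x \<noteq> 0"
    and p: "p \<in> J" "g p = p" "sph_deriv_norm g p > 1"
    and periodic: "\<And>x n. n \<ge> 1 \<Longrightarrow> (g ^^ n) x = x \<Longrightarrow> sph_deriv_norm (g ^^ n) x > 1 \<Longrightarrow>
      sph_deriv_norm (g ^^ n) x = sph_deriv_norm g p ^ n"
  shows "sph_deriv_norm g p = rat_degree g"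
    and "\<exists>\<phi>\<in>Aut_sphere. \<phi> \<circ> g \<circ> inv \<phi> = ratmap (monom 1 (rat_degree g)) 1 \<or>
      \<phi> \<circ> g \<circ> inv \<phi> = ratmap 1 (monom 1 (rat_degree g))"
proof -
  obtain \<alpha> where \<alpha>: "\<alpha> \<in> Aut_sphere" "\<alpha> p = Fin 0"
  proof (cases "p = Infty")
    case True
    then show ?thesis using ex_Aut_0_Infty[of p "Fin 0"] that by auto
  next
    case False
    then show ?thesis using ex_Aut_0_Infty[of p Infty] that by auto
  qed
  note A = Aut_sphereD[OF \<alpha>(1)]
  define h where "h = \<alpha> \<circ> g \<circ> inv \<alpha>"
  define K where "K = inv \<alpha> -` J"
  have hR: "h \<in> Rat" "rat_degree h = rat_degree g"
    using Rat_compose(1)[OF Rat_compose(1)[OF A(1) gRat] A(2)]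
      Rat_compose(2)[OF Rat_compose(1)[OF A(1) gRat] A(2)] Rat_compose(2)[OF A(1) gRat] A(5,6)
    by (auto simp: h_def)
  have pinv: "inv \<alpha> (Fin 0) = p" using A(3)[of p] \<alpha>(2) by simp
  have hn: "h ^^ n = \<alpha> \<circ> (g ^^ n) \<circ> inv \<alpha>" for n unfolding h_def by (rule conj_funpow[OF \<alpha>(1)])
  have Dh: "sph_deriv_norm (h ^^ n) x = sph_deriv_norm (g ^^ n) (inv \<alpha> x)" if "(g ^^ n) (inv \<alpha> x) = inv \<alpha> x" for n x
    using conj_deriv_fixed[OF \<alpha>(1) sph_map_at_funpow[OF gRat] that] A(4)[of x] by (simp add: hn)
  have D0: "sph_deriv_norm h (Fin 0) = sph_deriv_norm g p"
    using Dh[of 1 "Fin 0"] p(2) by (simp add: pinv)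
  have fixh: "h (Fin 0) = Fin 0" using p(2) \<alpha>(2) by (simp add: h_def pinv)
  obtain lam \<phi> where K: "cmod lam > 1" "\<And>z. sph_holo \<phi> z" "\<phi> 0 = Fin 0" "sd \<phi> 0 \<noteq> 0"
    "\<And>z. \<phi> (lam * z) = h (\<phi> z)"
    using Koenigs[OF hR(1) fixh] p(3) D0 by metis
  interpret linearised h K lam \<phi>
  proof
    show "closed K" unfolding K_def
      by (rule closed_vimage[OF closedJ Rat_continuous_on[OF A(2)]])
    show "x \<in> K" if "h x \<in> K" for x using that backJ A(3) by (simp add: K_def h_def)
    show "sph_deriv_norm h x \<noteq> 0" if "x \<in> K" for x
    proof -
      have "sph_deriv_norm h x = sph_deriv_norm \<alpha> (g (inv \<alpha> x)) * sph_deriv_norm g (inv \<alpha> x) * sph_deriv_norm (inv \<alpha>) x"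
        unfolding h_def using Rat_deriv_comp[OF Rat_compose(1)[OF A(1) gRat] A(2)] Rat_deriv_comp[OF A(1) gRat] by simp
      then show ?thesis
        using nondeg that A(7) Aut_sphereD(7)[OF A(8)] by (auto simp: K_def)
    qed
    show "Fin 0 \<in> K" using p(1) by (simp add: K_def pinv)
    show "sph_deriv_norm (h ^^ n) x = sph_deriv_norm h (Fin 0) ^ n"
      if "n \<ge> 1" "(h ^^ n) x = x" "sph_deriv_norm (h ^^ n) x > 1" for x n
    proof -
      have e: "(g ^^ n) (inv \<alpha> x) = inv \<alpha> x" using that(2) A(3) unfolding hn by (metis comp_apply)
      show ?thesis using periodic[OF that(1) e] that(3) by (simp add: Dh[OF e] D0)
    qed
  qed (use hR deg fixh K in auto)
  obtain M where M: "M \<in> Aut_sphere" "cmod lam = rat_degree h"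
    "inv M \<circ> h \<circ> M = ratmap (monom 1 (rat_degree h)) 1 \<or> inv M \<circ> h \<circ> M = ratmap 1 (monom 1 (rat_degree h))"
    by (rule linearised_rigidity)
  show "sph_deriv_norm g p = rat_degree g"
    using M(2) deriv_fixed_point D0 hR(2) by simp
  note B = Aut_sphereD[OF M(1)]
  have "inv (inv M \<circ> \<alpha>) = inv \<alpha> \<circ> M" using Aut_compose(2)[OF B(8) \<alpha>(1)] B(9) by simp
  then have "(inv M \<circ> \<alpha>) \<circ> g \<circ> inv (inv M \<circ> \<alpha>) = inv M \<circ> h \<circ> M" by (simp add: h_def o_assoc)
  then show "\<exists>\<phi>\<in>Aut_sphere. \<phi> \<circ> g \<circ> inv \<phi> = ratmap (monom 1 (rat_degree g)) 1 \<or>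
      \<phi> \<circ> g \<circ> inv \<phi> = ratmap 1 (monom 1 (rat_degree g))"
    using M(3) Aut_compose(1)[OF B(8) \<alpha>(1)] hR(2) by metis
qed

subsection \<open>Fixed points in the Julia set\<close>

lemma sph_holo_chart: "sph_holo (\<lambda>u. chart_at p (Fin u)) z"
  by (rule sph_holo_intro[where c = "chart_at p" and h = "\<lambda>u. u", OF _ chart_at_cases])
    (auto intro: analytic_intros)

definition chart_repr :: "(riemann_sphere \<Rightarrow> riemann_sphere) \<Rightarrow> riemann_sphere \<Rightarrow> complex \<Rightarrow> complex" where
  "chart_repr g p = sph_repr (\<lambda>u. g (chart_at p (Fin u))) (to_complex (chart_at p p))"

text \<open>The complex multiplier at a fixed point. Its modulus \<open>sph_deriv_norm\<close>
  cannot tell the parabolic value 1 from other neutral ones.\<close>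

definition multiplier :: "(riemann_sphere \<Rightarrow> riemann_sphere) \<Rightarrow> riemann_sphere \<Rightarrow> complex" where
  "multiplier g p = deriv (chart_repr g p) (to_complex (chart_at p p))"

lemma chart_repr_props:
  assumes g: "\<And>x. sph_map_at g x" and p: "g p = p"
  defines "w \<equiv> to_complex (chart_at p p)"
  shows "chart_repr g p analytic_on {w}" "chart_repr g p w = w"
    "\<forall>\<^sub>F u in nhds w. g (chart_at p (Fin u)) = chart_at p (Fin (chart_repr g p u))"
    "cmod (multiplier g p) = sph_deriv_norm g p"
    "chart_repr g p u = to_complex (chart_at p (g (chart_at p (Fin u))))"
proof -
  have h: "sph_holo (\<lambda>u. g (chart_at p (Fin u))) w"
    using g[of p] by (simp add: sph_map_at_def w_def)
  show "chart_repr g p analytic_on {w}"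
    "\<forall>\<^sub>F u in nhds w. g (chart_at p (Fin u)) = chart_at p (Fin (chart_repr g p u))"
    using sph_holo_repr[OF h] p by (auto simp: chart_repr_def w_def)
  show "chart_repr g p w = w" by (simp add: chart_repr_def sph_repr_def w_def p)
  show "chart_repr g p u = to_complex (chart_at p (g (chart_at p (Fin u))))"
    by (simp add: chart_repr_def sph_repr_def p)
  have e: "sph_repr (\<lambda>u. g (chart_at p (Fin u))) w = chart_repr g p" by (simp add: chart_repr_def w_def)
  have "1 + (cmod w)\<^sup>2 > 0" by (simp add: add_pos_nonneg)
  then show "cmod (multiplier g p) = sph_deriv_norm g p"
    unfolding sph_deriv_norm_eq_sd sd_def multiplier_def
    by (simp add: e \<open>chart_repr g p w = w\<close> flip: w_def)
qed

text \<open>Iterating \<open>G u = u + (u - w) ^ m * e u\<close> multiplies the leading coefficient \<open>e w\<close> by a geometric sum.\<close>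

lemma iterate_leading_coefficient:
  fixes G :: "complex \<Rightarrow> complex"
  assumes G: "isCont G w" "G w = w" and Gd: "(G has_field_derivative \<mu>) (at w)"
    and e: "isCont e w" and Ge: "\<forall>\<^sub>F u in nhds w. G u = u + (u - w) ^ m * e u"
  shows "\<exists>en. isCont en w \<and> en w = e w * (\<Sum>k<n. (\<mu> ^ m) ^ k) \<and>
    (\<forall>\<^sub>F u in nhds w. (G ^^ n) u = u + (u - w) ^ m * en u)"
proof (induction n)
  case 0
  show ?case by (rule exI[of _ "\<lambda>u. 0"]) simp
next
  case (Suc n)
  then obtain en where en: "isCont en w" "en w = e w * (\<Sum>k<n. (\<mu> ^ m) ^ k)"
    "\<forall>\<^sub>F u in nhds w. (G ^^ n) u = u + (u - w) ^ m * en u" by blast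
  define q where "q u = (if u = w then \<mu> else (G u - w) / (u - w))" for u
  have "((\<lambda>u. (G u - G w) / (u - w)) \<longlongrightarrow> \<mu>) (at w)" using Gd by (simp add: has_field_derivative_iff)
  then have "(q \<longlongrightarrow> \<mu>) (at w)"
    by (rule Lim_transform_eventually) (auto simp: eventually_at_filter q_def G(2))
  then have q: "isCont q w" by (simp add: isCont_def q_def)
  have Gq: "G u - w = (u - w) * q u" for u using G(2) by (simp add: q_def)
  have eG: "isCont (\<lambda>u. en (G u)) w" using isCont_o2[OF G(1)] en(1) G(2) by simp
  let ?e = "\<lambda>u. q u ^ m * en (G u) + e u"
  have "\<forall>\<^sub>F u in nhds w. (G ^^ n) (G u) = G u + (G u - w) ^ m * en (G u)"
    using eventually_nhds_isCont[OF G(1)] en(3) G(2) by simp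
  then have "\<forall>\<^sub>F u in nhds w. (G ^^ Suc n) u = u + (u - w) ^ m * ?e u"
    using Ge
  proof eventually_elim
    case (elim u)
    have "(G ^^ Suc n) u = (G ^^ n) (G u)" by (simp add: funpow_swap1)
    also have "\<dots> = G u + (u - w) ^ m * q u ^ m * en (G u)"
      using elim(1) by (simp only: Gq power_mult_distrib)
    finally show ?case using elim(2) by (simp add: algebra_simps)
  qed
  moreover have "isCont ?e w" by (intro continuous_intros q eG e)
  moreover have "?e w = e w * (\<Sum>k<Suc n. (\<mu> ^ m) ^ k)"
    by (simp add: q_def G(2) en(2) sum.lessThan_Suc_shift sum_distrib_left algebra_simps del: sum.lessThan_Suc)
  ultimately show ?case by blast
qed

lemma geometric_unbounded:
  fixes t :: complex
  assumes "cmod t > 1 \<or> t = 1"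
  shows "\<exists>N. \<forall>n\<ge>N. cmod (\<Sum>k<n. t ^ k) > B"
proof (cases "t = 1")
  case True
  obtain N :: nat where N: "real N > B" using reals_Archimedean2 by blast
  then show ?thesis using True by (intro exI[of _ N]) auto
next
  case False
  then have t: "cmod t > 1" using assms by simp
  obtain N where N: "B * cmod (t - 1) + 1 < cmod t ^ N" using real_arch_pow[OF t] by blast
  have "cmod (\<Sum>k<n. t ^ k) > B" if "n \<ge> N" for n
  proof -
    have "cmod t ^ N \<le> cmod t ^ n" using t that by (intro power_increasing) auto
    moreover have "cmod (t ^ n) - 1 \<le> cmod (t ^ n - 1)" using norm_triangle_ineq2[of "t ^ n" 1] by simp
    moreover have "(\<Sum>k<n. t ^ k) = (t ^ n - 1) / (t - 1)" using False by (rule geometric_sum)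
    ultimately show ?thesis using N False by (simp add: norm_divide norm_power less_divide_eq)
  qed
  then show ?thesis by blast
qed

text \<open>Repelling and parabolic points are treated alike. If the iterates were normal near
  \<open>p\<close>, a subsequence would stay in one chart disc, and a Cauchy estimate would bound
  the leading coefficient of \<open>G ^^ n - id\<close>. That coefficient is a fixed nonzero number
  times \<open>\<Sum>k<n. (\<mu> ^ m) ^ k\<close>, which is unbounded when \<open>\<mu>\<close> has
  modulus above 1 or equals 1.\<close>

lemma not_normal_fixed_point:
  assumes g: "g \<in> Rat" "rat_degree g \<ge> 2" and p: "g p = p"
    and mult: "cmod (multiplier g p) > 1 \<or> multiplier g p = 1"
    and H: "\<And>n. n \<ge> 1 \<Longrightarrow> g ^^ n \<in> H"
  shows "p \<in> julia H"
proof -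
  have "p \<notin> fatou H"
  proof
    assume "p \<in> fatou H"
    then obtain U where U: "open U" "p \<in> U" "normal_family_on U H" by (auto simp: fatou_def)
    define w where "w = to_complex (chart_at p p)"
    let ?c = "\<lambda>u. chart_at p (Fin u)"
    define G where "G = chart_repr g p"
    define \<mu> where "\<mu> = multiplier g p"
    have cw: "?c w = p" by (simp add: w_def)
    have gs: "sph_map_at g x" for x using g(1) by (rule Rat_sph_map_at)
    have G: "G analytic_on {w}" "G w = w" "\<forall>\<^sub>F u in nhds w. g (?c u) = ?c (G u)"
      using chart_repr_props(1-3)[of g p] gs p by (simp_all add: G_def w_def)
    have Gc: "isCont G w" using G(1) by (rule analytic_at_imp_isCont)
    have Gd: "(G has_field_derivative \<mu>) (at w)"
      using G(1) by (simp add: \<mu>_def multiplier_def DERIV_deriv_iff_field_differentiable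
          analytic_on_imp_differentiable_at flip: G_def w_def)
    have inj: "inj ?c" by (rule injI) (metis chart_at_chart_at riemann_sphere.inject)
    obtain S where S: "open S" "w \<in> S" "G holomorphic_on S" using G(1) analytic_at by blast
    obtain r where r: "r > 0" "ball w r \<subseteq> S" using S(1,2) openE by blast
    have hol: "(\<lambda>u. G u - u) holomorphic_on ball w r"
      using S(3) r(2) by (intro holomorphic_intros) (auto intro: holomorphic_on_subset)
    have "\<not> (\<lambda>u. G u - u) constant_on ball w r"
    proof
      assume "(\<lambda>u. G u - u) constant_on ball w r"
      then obtain c where c: "\<And>u. u \<in> ball w r \<Longrightarrow> G u - u = c" unfolding constant_on_def by blast
      have "c = 0" using c[of w] r(1) G(2) by simp
      have "\<forall>\<^sub>F u in nhds w. u \<in> ball w r" unfolding eventually_nhds_metric using r(1) by (auto simp: dist_commute)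
      then have "\<forall>\<^sub>F u in nhds w. g (?c u) = ?c u"
        using G(3) by eventually_elim (use c \<open>c = 0\<close> in simp)
      then have "\<forall>\<^sub>F u in nhds w. (\<lambda>u. g (?c u)) u = ?c u" by simp
      moreover note hc = sph_holo_chart[of p]
      moreover have "sph_holo (\<lambda>u. g (?c u)) z" for z
        using sph_holo_compose(1)[OF hc gs] .
      ultimately have all: "g (?c u) = ?c u" for u using sph_holo_identity[of "\<lambda>u. g (?c u)" ?c w u] by simp
      have id: "id \<in> Rat" "rat_degree id = 1"
        using Rat_compose[OF Aut_sphereD(1,2)[OF mob_Aut[of 1 1 0 0]]] Aut_sphereD(4-6)[OF mob_Aut[of 1 1 0 0]]
        by (auto simp: o_def id_def)
      have "g = id"
      proof (rule Rat_eqI[OF g(1) id(1)])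
        fix u :: complex assume "u \<noteq> 0"
        then show "g (Fin u) = id (Fin u)"
          using all[of u] all[of "1 / u"] by (cases "p = Infty") (auto simp: chart_at_def sphere_quot_def)
      qed
      then show False using g(2) id(2) by simp
    qed
    note nc = this
    have zin: "w \<in> ball w r" and Gw0: "G w - w = 0" using r(1) G(2) by auto
    obtain e r' m where m: "0 < m" "0 < r'" "ball w r' \<subseteq> ball w r" "e holomorphic_on ball w r'"
        "\<And>u. u \<in> ball w r' \<Longrightarrow> G u - u = (u - w) ^ m * e u" "\<And>u. u \<in> ball w r' \<Longrightarrow> e u \<noteq> 0"
      by (rule holomorphic_factor_zero_nonconstant[OF hol open_ball connected_ball zin Gw0 nc])
        (rule that, assumption+)
    have ew: "e w \<noteq> 0" using m(2,6) by simp
    have ec: "isCont e w" using m(2,4) by (metis analytic_at_ball analytic_at_imp_isCont)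
    have evr: "\<forall>\<^sub>F u in nhds w. u \<in> ball w r'" unfolding eventually_nhds_metric using m(2) by (auto simp: dist_commute)
    then have Ge: "\<forall>\<^sub>F u in nhds w. G u = u + (u - w) ^ m * e u"
      by eventually_elim (use m(5) in \<open>simp add: algebra_simps\<close>)
    have Gn: "\<forall>\<^sub>F u in nhds w. (g ^^ n) (?c u) = ?c ((G ^^ n) u)" for n
    proof (induction n)
      case (Suc n)
      have "\<forall>\<^sub>F u in nhds w. (g ^^ n) (?c (G u)) = ?c ((G ^^ n) (G u))"
        using eventually_nhds_isCont[OF Gc] Suc G(2) by simp
      then show ?case using G(3) by eventually_elim (simp add: funpow_swap1)
    qed simp
    \<comment> \<open>A normal subsequence of the iterates is uniformly bounded near \<open>p\<close> in the chart.\<close>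
    have "\<exists>r f. strict_mono r \<and> (\<forall>K. compact K \<and> K \<subseteq> U \<longrightarrow>
        uniform_limit K (\<lambda>n. g ^^ Suc (r n)) f sequentially)"
      using U(3)[unfolded normal_family_on_def, rule_format, of "\<lambda>n. g ^^ Suc n"] H[of "Suc n" for n]
      by (simp del: funpow.simps)
    then obtain s f where s: "strict_mono s"
        "\<And>K. compact K \<Longrightarrow> K \<subseteq> U \<Longrightarrow> uniform_limit K (\<lambda>n. g ^^ Suc (s n)) f sequentially"
      by meson
    have cc: "continuous_on A ?c" for A
      using continuous_on_compose[OF continuous_Fin continuous_chart_at] by (simp add: o_def)
    have "open (?c -` U)" using U(1) cc by (rule open_vimage)
    moreover have "w \<in> ?c -` U" using U(2) cw by simp
    ultimately obtain \<rho> where \<rho>: "\<rho> > 0" "cball w \<rho> \<subseteq> ?c -` U" by (meson open_contains_cball)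
    let ?K = "?c ` cball w \<rho>"
    have "compact ?K" using cc by (intro compact_continuous_image) auto
    then have ul: "uniform_limit ?K (\<lambda>n. g ^^ Suc (s n)) f sequentially" using \<rho>(2) by (intro s(2)) auto
    have gnc: "continuous_on A (g ^^ n)" for A n
      using sph_map_at_imp_isCont[OF sph_map_at_funpow[OF g(1)]] by (simp add: continuous_at_imp_continuous_on)
    have fc: "continuous_on ?K f"
      by (rule uniform_limit_theorem[OF _ ul]) (use gnc in \<open>auto simp del: funpow.simps\<close>)
    have pK: "p \<in> ?K" using \<rho>(1) cw by (metis centre_in_cball image_eqI less_imp_le)
    have pn: "(g ^^ n) p = p" for n using p by (induction n) auto
    have fp: "f p = p"
      using tendsto_uniform_limitI[OF ul pK] pn by (simp add: LIMSEQ_const_iff del: funpow.simps)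
    let ?V = "?c ` ball w 1"
    have "open (chart_at p ` Fin ` ball w 1)" by (intro open_chart_image open_Fin_image open_ball)
    then have oV: "open ?V" by (simp add: image_image)
    have "p \<in> ?V" using cw by (metis centre_in_ball image_eqI zero_less_one)
    then obtain \<epsilon> where \<epsilon>: "\<epsilon> > 0" "ball p \<epsilon> \<subseteq> ?V" using oV openE by blast
    have fcc: "continuous_on (cball w \<rho>) (\<lambda>u. f (?c u))"
      using continuous_on_compose2[OF fc cc] by blast
    have e2: "0 < \<epsilon> / 2" and wK: "w \<in> cball w \<rho>" using \<epsilon>(1) \<rho>(1) by auto
    have "\<exists>d>0. \<forall>u\<in>cball w \<rho>. dist u w < d \<longrightarrow> dist (f (?c u)) (f (?c w)) < \<epsilon> / 2"
      using fcc[unfolded continuous_on_iff, rule_format, OF wK e2] .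
    then obtain d where d: "d > 0" "\<And>u. u \<in> cball w \<rho> \<Longrightarrow> dist u w < d \<Longrightarrow> dist (f (?c u)) (f (?c w)) < \<epsilon> / 2"
      by blast
    have "\<forall>\<^sub>F n in sequentially. \<forall>x\<in>?K. dist ((g ^^ Suc (s n)) x) (f x) < \<epsilon> / 2"
      using ul[unfolded uniform_limit_iff, rule_format, OF e2] .
    then obtain N where N: "\<And>n x. n \<ge> N \<Longrightarrow> x \<in> ?K \<Longrightarrow> dist ((g ^^ Suc (s n)) x) (f x) < \<epsilon> / 2"
      unfolding eventually_sequentially by blast
    define \<delta> where "\<delta> = min \<rho> (d / 2)"
    have \<delta>: "\<delta> > 0" "\<delta> \<le> \<rho>" "\<delta> < d" using \<rho>(1) d(1) by (auto simp: \<delta>_def)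
    \<comment> \<open>On the circle of radius \<open>\<delta>\<close> the iterate is within 1 of
      \<open>w\<close> and the point itself at distance \<open>\<delta>\<close>; the denominator
      comes from dividing by \<open>(u - w) ^ m\<close>.\<close>
    define B where "B = (1 + \<delta>) / \<delta> ^ m"
    have bound: "cmod (e w) * cmod (\<Sum>k<Suc (s n). (\<mu> ^ m) ^ k) \<le> B" if n: "n \<ge> N" for n
    proof -
      let ?n = "Suc (s n)"
      define E where "E u = to_complex (chart_at p ((g ^^ ?n) (?c u)))" for u
      have inV: "(g ^^ ?n) (?c u) \<in> ?V" if "u \<in> cball w \<delta>" for u
      proof -
        have u: "u \<in> cball w \<rho>" "dist u w < d" using that \<delta> by (auto simp: dist_commute)
        have "dist (f (?c u)) p < \<epsilon> / 2" using d(2)[OF u] cw fp by simp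
        moreover have "dist ((g ^^ ?n) (?c u)) (f (?c u)) < \<epsilon> / 2" using N[OF n] u(1) by blast
        ultimately have "dist ((g ^^ ?n) (?c u)) p < \<epsilon>" by (metis dist_commute dist_triangle_half_l)
        then show ?thesis using \<epsilon>(2) by (auto simp: dist_commute)
      qed
      have Eb: "cmod (E u - w) < 1" "(g ^^ ?n) (?c u) = ?c (E u)" if u: "u \<in> cball w \<delta>" for u
      proof -
        obtain v where v: "v \<in> ball w 1" "(g ^^ ?n) (?c u) = ?c v" using inV[OF u] by blast
        then have "E u = v" by (simp add: E_def del: funpow.simps)
        then show "cmod (E u - w) < 1" "(g ^^ ?n) (?c u) = ?c (E u)"
          using v by (auto simp: dist_norm norm_minus_commute simp del: funpow.simps)
      qed
      have Eh: "E holomorphic_on cball w \<delta>"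
      proof -
        have "E analytic_on {u}" if u: "u \<in> cball w \<delta>" for u
        proof -
          let ?H = "\<lambda>u. chart_at p ((g ^^ ?n) (?c u))"
          have h0: "sph_holo (\<lambda>u. (g ^^ ?n) (?c u)) u"
            by (rule sph_holo_compose(1)[OF sph_holo_chart sph_map_at_funpow[OF g(1)]])
          have "chart_at p = id \<or> chart_at p = sphere_inv" by (simp add: chart_at_def)
          then have "sph_holo ?H u"
            using h0 sph_holo_compose(1)[OF h0 Rat_sph_map_at[OF sphere_inv_Rat]] by (auto simp del: funpow.simps)
          moreover have "?H u \<noteq> Infty" using Eb(2)[OF u] by (simp del: funpow.simps)
          ultimately show ?thesis unfolding E_def by (rule sph_holo_finite_analytic)
        qed
        then show ?thesis by (meson analytic_imp_holomorphic analytic_on_analytic_at)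
      qed
      obtain en where en: "isCont en w" "en w = e w * (\<Sum>k<?n. (\<mu> ^ m) ^ k)"
        "\<forall>\<^sub>F u in nhds w. (G ^^ ?n) u = u + (u - w) ^ m * en u"
        using iterate_leading_coefficient[OF Gc G(2) Gd ec Ge, of ?n] by blast
      have Een: "\<forall>\<^sub>F u in nhds w. E u - u = (u - w) ^ m * en u"
        using en(3) Gn[of ?n] by eventually_elim (simp add: E_def del: funpow.simps)
      \<comment> \<open>The quotient has a removable singularity at \<open>w\<close>, with the
        leading coefficient \<open>en w\<close> as its value. Cauchy's inequality of order 0 bounds
        it by the values on the circle.\<close>
      define q where "q u = (if u = w then en w else (E u - u) / (u - w) ^ m)" for u
      have "\<forall>\<^sub>F u in nhds w. q u = en u"
        using Een by eventually_elim (auto simp: q_def)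
      then have qc: "isCont q w" using en(1) isCont_cong by blast
      have qh': "q holomorphic_on ball w \<delta> - {w}"
      proof -
        have "(\<lambda>u. (E u - u) / (u - w) ^ m) holomorphic_on ball w \<delta> - {w}"
          using Eh by (intro holomorphic_intros) (auto elim!: holomorphic_on_subset)
        then show ?thesis by (rule holomorphic_transform) (auto simp: q_def)
      qed
      have qcb: "continuous_on (cball w \<delta>) q"
        unfolding continuous_on_eq_continuous_within
      proof
        fix u assume u: "u \<in> cball w \<delta>"
        show "continuous (at u within cball w \<delta>) q"
        proof (cases "u = w")
          case True
          then show ?thesis using qc by (simp add: continuous_at_imp_continuous_at_within)
        next
          case False
          have "continuous_on (cball w \<delta> - {w}) (\<lambda>u. (E u - u) / (u - w) ^ m)"
            using holomorphic_on_imp_continuous_on[OF Eh]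
            by (intro continuous_intros) (auto elim!: continuous_on_subset)
          then have "continuous_on (cball w \<delta> - {w}) q" by (rule continuous_on_eq) (simp add: q_def)
          then have "continuous (at u within cball w \<delta> - {w}) q"
            using u False by (simp add: continuous_on_eq_continuous_within)
          moreover have "at u within cball w \<delta> - {w} = at u within cball w \<delta>"
            using False by (intro at_within_nhd[of _ "- {w}"]) auto
          ultimately show ?thesis by (simp add: continuous_within)
        qed
      qed
      have qh: "q holomorphic_on ball w \<delta>"
        by (rule no_isolated_singularity[OF continuous_on_subset[OF qcb ball_subset_cball] qh']) auto
      have "cmod ((deriv ^^ 0) q w) \<le> fact 0 * B / \<delta> ^ 0"
      proof (rule Cauchy_inequality[OF qh qcb \<delta>(1)])
        fix u assume u: "cmod (w - u) = \<delta>"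
        then have uin: "u \<in> cball w \<delta>" "u \<noteq> w" using \<delta>(1) by (auto simp: dist_norm)
        have "cmod (E u - u) \<le> cmod (E u - w) + cmod (w - u)"
          using norm_triangle_ineq[of "E u - w" "w - u"] by simp
        then have "cmod (E u - u) \<le> 1 + \<delta>" using Eb(1)[OF uin(1)] u by simp
        then show "cmod (q u) \<le> B"
          using uin(2) u \<delta>(1) by (simp add: q_def B_def norm_divide norm_power norm_minus_commute divide_right_mono)
      qed
      then show ?thesis using en(2) by (simp add: q_def norm_mult)
    qed
    have "cmod (\<mu> ^ m) > 1 \<or> \<mu> ^ m = 1"
      using mult m(1) by (auto simp: \<mu>_def norm_power one_less_power)
    then obtain N' where N': "\<And>n. n \<ge> N' \<Longrightarrow> cmod (\<Sum>k<n. (\<mu> ^ m) ^ k) > B / cmod (e w)"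
      using geometric_unbounded by metis
    have "Suc (s (max N N')) \<ge> N'" using strict_mono_imp_increasing[OF s(1), of "max N N'"] by simp
    from N'[OF this] have "B < cmod (e w) * cmod (\<Sum>k<Suc (s (max N N')). (\<mu> ^ m) ^ k)"
      using ew by (simp add: divide_less_eq mult.commute)
    then show False using bound[of "max N N'"] by simp
  qed
  then show ?thesis by (simp add: julia_def)
qed

subsection \<open>Existence of a repelling or parabolic fixed point\<close>

text \<open>Lagrange interpolation of \<open>Q\<close> at the roots of \<open>N\<close>, read off in the coefficient of degree \<open>degree N - 1\<close>.\<close>

lemma sum_residues:
  fixes N Q :: "complex poly"
  assumes deg: "degree Q < degree N" and simple: "\<And>z. poly N z = 0 \<Longrightarrow> poly (pderiv N) z \<noteq> 0"
  shows "(\<Sum>z | poly N z = 0. poly Q z / poly (pderiv N) z) = coeff Q (degree N - 1) / lead_coeff N"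
    and "card {z. poly N z = 0} = degree N"
proof -
  let ?S = "{z. poly N z = 0}"
  let ?l = "lead_coeff N"
  have N0: "N \<noteq> 0" using deg by auto
  then have fin: "finite ?S" by (rule poly_roots_finite)
  have l0: "?l \<noteq> 0" using N0 by simp
  have "rsquarefree N" unfolding rsquarefree_roots using simple by blast
  then have Ndec: "N = smult ?l (\<Prod>z\<in>?S. [:-z, 1:])"
    using complex_poly_decompose_rsquarefree[of N] by simp
  define B where "B s = (\<Prod>t\<in>?S - {s}. [:-t, 1:])" for s :: complex
  have degprod: "degree (\<Prod>t\<in>T. [:-t, 1:]) = card T \<and> lead_coeff (\<Prod>t\<in>T. [:-t, 1:]) = 1" if "finite T" for T :: "complex set"
    using that
  proof (induction T)
    case (insert x T)
    have ne: "(\<Prod>t\<in>T. [:-t, 1:]) \<noteq> 0" using insert by (metis leading_coeff_0_iff zero_neq_one)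
    have "degree ([:-x, 1:] * (\<Prod>t\<in>T. [:-t, 1:])) = 1 + degree (\<Prod>t\<in>T. [:-t, 1:])"
      using ne by (subst degree_mult_eq) auto
    moreover have "lead_coeff ([:-x, 1:] * (\<Prod>t\<in>T. [:-t, 1:])) = lead_coeff (\<Prod>t\<in>T. [:-t, 1:])"
      by (subst lead_coeff_mult) simp
    ultimately show ?case using insert by (auto simp del: mult_pCons_left)
  qed simp
  have "degree N = degree (smult ?l (\<Prod>z\<in>?S. [:-z, 1:]))" using Ndec by simp
  then show card: "card ?S = degree N" using degprod[OF fin] N0 by simp
  have Bs: "degree (B s) = degree N - 1" "coeff (B s) (degree N - 1) = 1" if "s \<in> ?S" for s
  proof -
    have "card (?S - {s}) = degree N - 1" using card fin that by simp
    then show "degree (B s) = degree N - 1" "coeff (B s) (degree N - 1) = 1"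
      using degprod[of "?S - {s}"] fin by (auto simp: B_def)
  qed
  have B0: "poly (B s) t = 0" if "s \<in> ?S" "t \<in> ?S" "t \<noteq> s" for s t
    unfolding B_def poly_prod using fin that by (intro prod_zero) auto
  have dN: "poly (pderiv N) s = ?l * poly (B s) s" if s: "s \<in> ?S" for s
  proof -
    have "N = smult ?l ([:-s, 1:] * B s)"
      unfolding B_def by (subst Ndec) (simp only: prod.remove[OF fin s])
    then have "pderiv N = smult ?l ([:-s, 1:] * pderiv (B s) + B s * pderiv [:-s, 1:])"
      by (metis pderiv_mult pderiv_smult)
    then show ?thesis by (simp add: pderiv_pCons)
  qed
  have Bn: "poly (B s) s \<noteq> 0" if "s \<in> ?S" for s using dN[OF that] simple that by auto
  define T where "T = Q - (\<Sum>s\<in>?S. smult (poly Q s / poly (B s) s) (B s))"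
  have degT: "degree T \<le> degree N - 1"
  proof -
    have "degree (\<Sum>s\<in>?S. smult (poly Q s / poly (B s) s) (B s)) \<le> degree N - 1"
      using fin Bs(1) by (intro degree_sum_le) (auto intro: order_trans[OF degree_smult_le])
    then show ?thesis unfolding T_def using deg by (intro degree_diff_le) auto
  qed
  have T0: "poly T t = 0" if t: "t \<in> ?S" for t
  proof -
    have "(\<Sum>s\<in>?S. poly Q s / poly (B s) s * poly (B s) t) = (\<Sum>s\<in>?S. if s = t then poly Q t else 0)"
      using B0 Bn t by (intro sum.cong) auto
    also have "\<dots> = poly Q t" using fin t by simp
    finally show ?thesis by (simp add: T_def poly_sum)
  qed
  have "T = 0"
  proof (rule ccontr)
    assume "T \<noteq> 0"
    then have "card {z. poly T z = 0} \<le> degree T" "finite {z. poly T z = 0}"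
      by (auto simp: card_poly_roots_bound poly_roots_finite)
    moreover have "card ?S \<le> card {z. poly T z = 0}"
      using T0 calculation(2) by (intro card_mono) auto
    ultimately show False using degT card deg by simp
  qed
  then have "coeff T (degree N - 1) = 0" by simp
  then have "coeff Q (degree N - 1) = (\<Sum>s\<in>?S. poly Q s / poly (B s) s * coeff (B s) (degree N - 1))"
    unfolding T_def by (simp add: coeff_sum)
  also have "\<dots> = (\<Sum>s\<in>?S. ?l * (poly Q s / poly (pderiv N) s))"
    using Bs(2) dN l0 by (intro sum.cong) auto
  also have "\<dots> = ?l * (\<Sum>s\<in>?S. poly Q s / poly (pderiv N) s)" by (rule sum_distrib_left[symmetric])
  finally show "(\<Sum>z | poly N z = 0. poly Q z / poly (pderiv N) z) = coeff Q (degree N - 1) / ?l"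
    using l0 by simp
qed

text \<open>The Moebius map \<open>1 / (1 - \<mu>)\<close> sends the unit disc onto the half plane
  of real part above 1/2.\<close>

lemma Re_inverse_ge_half:
  assumes "cmod \<mu> \<le> 1" "\<mu> \<noteq> 1"
  shows "Re (1 / (1 - \<mu>)) \<ge> 1 / 2"
proof -
  have "(cmod \<mu>)\<^sup>2 \<le> 1" using assms(1) by (simp add: power_le_one)
  then have n: "(Re \<mu>)\<^sup>2 + (Im \<mu>)\<^sup>2 \<le> 1" by (simp add: cmod_power2)
  let ?d = "(1 - Re \<mu>)\<^sup>2 + (Im \<mu>)\<^sup>2"
  have "1 - \<mu> \<noteq> 0" using assms(2) by simp
  then have "(cmod (1 - \<mu>))\<^sup>2 > 0" by simp
  then have d: "?d > 0" by (simp add: cmod_power2)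
  have "Re (1 / (1 - \<mu>)) = (1 - Re \<mu>) / ?d" by (simp add: Re_divide)
  moreover have "?d \<le> 2 * (1 - Re \<mu>)" using n by (simp add: power2_eq_square algebra_simps)
  ultimately show ?thesis using d by (simp add: le_divide_eq)
qed

text \<open>By the holomorphic fixed point formula the numbers \<open>1 / (1 - multiplier)\<close>
  over all fixed points add up to 1. If every multiplier had modulus at most 1 and differed from 1,
  there would be \<open>n + 1 \<ge> 3\<close> simple fixed points, each contributing real part at
  least 1/2.\<close>

lemma ex_nonattracting_fixed_point:
  assumes gR: "g \<in> Rat" and deg: "rat_degree g \<ge> 2"
  shows "\<exists>p. g p = p \<and> (cmod (multiplier g p) > 1 \<or> multiplier g p = 1)"
proof (rule ccontr)
  assume "\<not> ?thesis"
  then have att: "cmod (multiplier g p) \<le> 1 \<and> multiplier g p \<noteq> 1" if "g p = p" for p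
    using that not_le by blast
  obtain P Q n where g: "g = ratmap P Q" "coprime P Q" "n = max (degree P) (degree Q)" "n \<ge> 1"
    "rat_degree g = n" using gR by (rule RatE)
  have n2: "n \<ge> 2" using g(5) deg by simp
  have dP: "degree P \<le> n" "degree Q \<le> n" using g(3) by auto
  \<comment> \<open>Its roots are the finite fixed points. There \<open>pderiv N\<close> takes the
    value \<open>Q\<close> times \<open>1 - multiplier\<close>, so \<open>Q / pderiv N\<close> is
    the summand of the formula.\<close>
  define N where "N = [:0, 1:] * Q - P"
  have root: "poly N s = 0 \<Longrightarrow> poly Q s \<noteq> 0 \<and> g (Fin s) = Fin s \<and>
      poly (pderiv N) s = poly Q s * (1 - multiplier g (Fin s))" for s
  proof -
    assume "poly N s = 0"
    then have e: "poly P s = s * poly Q s" by (simp add: N_def)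
    then have Q0: "poly Q s \<noteq> 0" using coprime_no_common_root[OF g(2), of s] by auto
    have fixs: "g (Fin s) = Fin s" using Q0 e by (simp add: g(1) sphere_quot_def)
    have "\<forall>\<^sub>F u in nhds s. poly Q u \<noteq> 0"
      using Q0 analytic_at_imp_isCont[OF analytic_poly[of Q "{s}"]]
      by (intro tendsto_imp_eventually_ne) (auto simp: isCont_def tendsto_at_iff_tendsto_nhds)
    then have ev: "\<forall>\<^sub>F u in nhds s. chart_repr g (Fin s) u = poly P u / poly Q u"
      by eventually_elim (use fixs in \<open>simp add: chart_repr_def sph_repr_def chart_at_def g(1) sphere_quot_def\<close>)
    have "multiplier g (Fin s) = deriv (\<lambda>u. poly P u / poly Q u) s"
      by (simp add: multiplier_def chart_at_def deriv_cong_ev[OF ev refl])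
    also have "\<dots> = (poly (pderiv P) s * poly Q s - poly P s * poly (pderiv Q) s) / (poly Q s * poly Q s)"
      using Q0 by (intro DERIV_imp_deriv DERIV_divide poly_DERIV)
    finally have "poly Q s * (poly Q s * multiplier g (Fin s)) = poly Q s * (poly (pderiv P) s - s * poly (pderiv Q) s)"
      using Q0 e by (simp add: field_simps)
    then have m1: "poly Q s * multiplier g (Fin s) = poly (pderiv P) s - s * poly (pderiv Q) s"
      using Q0 by simp
    have m2: "poly (pderiv N) s = poly Q s + s * poly (pderiv Q) s - poly (pderiv P) s"
      by (simp add: N_def pderiv_mult pderiv_diff pderiv_pCons)
    have "poly (pderiv N) s = poly Q s * (1 - multiplier g (Fin s))"
      unfolding right_diff_distrib m1 m2 by simp
    then show ?thesis using Q0 fixs by blast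
  qed
  have simple: "poly (pderiv N) z \<noteq> 0" if "poly N z = 0" for z using root[OF that] att by auto
  have quot: "poly Q z / poly (pderiv N) z = 1 / (1 - multiplier g (Fin z))" if "poly N z = 0" for z
    using root[OF that] by simp
  have half: "Re (\<Sum>z | poly N z = 0. poly Q z / poly (pderiv N) z) \<ge> real (card {z. poly N z = 0}) / 2"
  proof -
    have "1 / 2 \<le> Re (poly Q z / poly (pderiv N) z)" if "poly N z = 0" for z
      unfolding quot[OF that] using root[OF that] att by (intro Re_inverse_ge_half) auto
    then have "(\<Sum>z | poly N z = 0. 1 / 2) \<le> (\<Sum>z | poly N z = 0. Re (poly Q z / poly (pderiv N) z))"
      by (intro sum_mono) simp
    then show ?thesis by simp
  qed
  have cN: "coeff N (Suc k) = coeff Q k - coeff P (Suc k)" for k by (simp add: N_def)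
  have dN: "degree N \<le> Suc n"
    unfolding N_def using dP by (intro degree_diff_le) (auto simp: degree_pCons_le intro: order_trans[OF degree_pCons_le])
  show False
  proof (cases "coeff Q n = 0")
    case False
    have cQ: "coeff N (Suc n) = coeff Q n" unfolding cN using dP by (simp add: coeff_eq_0)
    then have d: "degree N = Suc n" using dN False le_degree[of N "Suc n"] by auto
    have "(\<Sum>z | poly N z = 0. poly Q z / poly (pderiv N) z) = 1"
      using sum_residues(1)[of Q N] simple d dP cQ False by simp
    moreover have "card {z. poly N z = 0} = Suc n" using sum_residues(2)[of Q N] simple d dP by simp
    ultimately show False using half n2 by simp
  next
    case True
    \<comment> \<open>Now \<open>Infty\<close> is fixed as well, with multiplier
      \<open>\<mu>\<close>. The \<open>n\<close> finite fixed points add up to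
      \<open>1 - 1 / (1 - \<mu>)\<close>, of real part at most 1/2, whereas \<open>n / 2\<close> is
      at least 1.\<close>
    have Pn: "coeff P n \<noteq> 0"
      using True g(3,4) by (metis leading_coeff_0_iff max_def degree_0 not_one_le_zero)
    have inf: "g Infty = Infty" using True by (simp add: g(1) Let_def sphere_quot_def flip: g(3))
    have A0: "hom_eval n P 1 0 = coeff P n" "hom_eval n Q 1 0 = 0"
      by (simp_all add: hom_eval_at_infinity True)
    define \<mu> where "\<mu> = coeff Q (n - 1) / coeff P n"
    have an: "hom_eval n P 1 analytic_on {0}" "hom_eval n Q 1 analytic_on {0}" by (rule analytic_hom_eval)+
    have "multiplier g Infty = \<mu>"
    proof -
      have "\<forall>\<^sub>F u in nhds 0. hom_eval n P 1 u \<noteq> 0"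
        by (rule eventually_nhds_isCont[OF analytic_at_imp_isCont[OF an(1)] t1_space_nhds])
          (use Pn A0 in simp)
      then have ev: "\<forall>\<^sub>F u in nhds 0. chart_repr g Infty u = hom_eval n Q 1 u / hom_eval n P 1 u"
      proof eventually_elim
        case (elim u)
        have "chart_repr g Infty u = to_complex (sphere_inv (g (sphere_inv (Fin u))))"
          using inf by (simp add: chart_repr_def sph_repr_def chart_at_def sphere_quot_def)
        also have "g (sphere_inv (Fin u)) = sphere_quot (hom_eval n P 1 u) (hom_eval n Q 1 u)"
          unfolding g(1) by (rule ratmap_at_Infty[OF g(3)])
        finally show ?case using elim by (auto simp: sphere_quot_def)
      qed
      have "multiplier g Infty = deriv (\<lambda>u. hom_eval n Q 1 u / hom_eval n P 1 u) 0"
        by (simp add: multiplier_def chart_at_def deriv_cong_ev[OF ev refl])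
      also have "\<dots> = (deriv (hom_eval n Q 1) 0 * hom_eval n P 1 0 - hom_eval n Q 1 0 * deriv (hom_eval n P 1) 0)
          / (hom_eval n P 1 0 * hom_eval n P 1 0)"
        using an A0 Pn by (intro DERIV_imp_deriv DERIV_divide)
          (auto simp: DERIV_deriv_iff_field_differentiable analytic_on_imp_differentiable_at)
      finally show ?thesis using A0 Pn by (simp add: deriv_hom_eval_0[OF g(4)] \<mu>_def)
    qed
    then have \<mu>: "cmod \<mu> \<le> 1" "\<mu> \<noteq> 1" using att[OF inf] by auto
    have Q1: "coeff Q (n - 1) = \<mu> * coeff P n" using Pn by (simp add: \<mu>_def)
    have nn: "Suc (n - 1) = n" using n2 by simp
    have cn: "coeff N n = (\<mu> - 1) * coeff P n" using cN[of "n - 1", unfolded nn] Q1 by (simp add: algebra_simps)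
    have "coeff N (Suc n) = 0" unfolding cN using dP True by (simp add: coeff_eq_0)
    then have "degree N \<noteq> Suc n" by (metis leading_coeff_0_iff degree_0 nat.distinct(1))
    then have d: "degree N = n" using dN cn \<mu>(2) Pn le_degree[of N n] by auto
    have dQ: "degree Q < n"
      using True dP(2) n2 by (metis leading_coeff_0_iff degree_0 le_neq_implies_less not_numeral_le_zero)
    have "(\<Sum>z | poly N z = 0. poly Q z / poly (pderiv N) z) = \<mu> / (\<mu> - 1)"
      using sum_residues(1)[of Q N] simple d dQ cn Q1 Pn by simp
    also have "\<dots> = 1 - 1 / (1 - \<mu>)" using \<mu>(2) by (simp add: divide_simps) (simp add: algebra_simps)
    finally have "Re (\<Sum>z | poly N z = 0. poly Q z / poly (pderiv N) z) \<le> 1 / 2"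
      using Re_inverse_ge_half[OF \<mu>] by (simp del: Re_divide)
    moreover have "card {z. poly N z = 0} = n" using sum_residues(2)[of Q N] simple d dQ by simp
    ultimately show False using half n2 by simp
  qed
qed

subsection \<open>Fibrewise Julia sets\<close>

lemma closed_julia: "closed (julia H)"
proof -
  have "open (fatou H)"
    by (subst open_subopen) (auto simp: fatou_def)
  then show ?thesis by (simp add: julia_def closed_Compl)
qed

lemma normal_family_on_mono:
  assumes "H \<subseteq> H'" "normal_family_on U H'"
  shows "normal_family_on U H"
  unfolding normal_family_on_def
proof (intro allI impI)
  fix h :: "nat \<Rightarrow> riemann_sphere \<Rightarrow> riemann_sphere"
  assume "\<forall>n. h n \<in> H"
  then have "\<forall>n. h n \<in> H'" using assms(1) by blast
  then show "\<exists>r g. strict_mono r \<and> (\<forall>K. compact K \<and> K \<subseteq> U \<longrightarrow> uniform_limit K (\<lambda>n. h (r n)) g sequentially)"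
    using assms(2)[unfolded normal_family_on_def, THEN spec[of _ h]] by simp
qed

lemma julia_mono:
  assumes "H \<subseteq> H'"
  shows "julia H \<subseteq> julia H'"
  using normal_family_on_mono[OF assms] by (auto simp: julia_def fatou_def)

text \<open>\<open>f\<close> is inserted because the words of a fibre have length at least 1: the
  first letter alone is not a word composed with that letter. A sequence hitting \<open>f\<close>
  infinitely often has a constant subsequence.\<close>

lemma normal_family_precompose:
  assumes N: "normal_family_on U H" and f: "continuous_on UNIV f"
  shows "normal_family_on (f -` U) (insert f ((\<lambda>h. h \<circ> f) ` H))"
  unfolding normal_family_on_def
proof (intro allI impI)
  fix h :: "nat \<Rightarrow> riemann_sphere \<Rightarrow> riemann_sphere"
  assume h: "\<forall>n. h n \<in> insert f ((\<lambda>h. h \<circ> f) ` H)"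
  show "\<exists>r g. strict_mono r \<and> (\<forall>K. compact K \<and> K \<subseteq> f -` U \<longrightarrow> uniform_limit K (\<lambda>n. h (r n)) g sequentially)"
  proof (cases "infinite {n. h n = f}")
    case True
    let ?r = "enumerate {n. h n = f}"
    have "strict_mono ?r" using True by (simp add: strict_mono_enumerate)
    moreover have "h (?r n) = f" for n using enumerate_in_set[OF True, of n] by simp
    ultimately show ?thesis by (intro exI[of _ ?r] exI[of _ f]) (auto intro: uniform_limit_const)
  next
    case False
    then obtain N0 where N0: "\<And>n. h n = f \<Longrightarrow> n < N0"
      using finite_nat_set_iff_bounded by auto
    have "\<exists>k\<in>H. h (n + N0) = k \<circ> f" for n using h N0[of "n + N0"] by fastforce
    then obtain k where k: "\<And>n. k n \<in> H" "\<And>n. h (n + N0) = k n \<circ> f" by metis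
    obtain r g where r: "strict_mono r"
      "\<forall>K. compact K \<and> K \<subseteq> U \<longrightarrow> uniform_limit K (\<lambda>n. k (r n)) g sequentially"
      using N[unfolded normal_family_on_def, rule_format, of k] k(1) by blast
    show ?thesis
    proof (intro exI[of _ "\<lambda>n. r n + N0"] exI[of _ "g \<circ> f"] conjI allI impI)
      show "strict_mono (\<lambda>n. r n + N0)" using r(1) by (simp add: strict_mono_def)
      fix K assume K: "compact K \<and> K \<subseteq> f -` U"
      then have "compact (f ` K)" using f by (auto intro!: compact_continuous_image elim: continuous_on_subset)
      then have "uniform_limit (f ` K) (\<lambda>n. k (r n)) g sequentially" using r(2) K by auto
      then show "uniform_limit K (\<lambda>n. h (r n + N0)) (g \<circ> f) sequentially"
        unfolding uniform_limit_iff by (simp add: k(2))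
    qed
  qed
qed

text \<open>An open map carries a ball to a neighbourhood of \<open>f z\<close>. As \<open>f\<close>
  need not be injective, the limit on the image is read off at a chosen preimage; uniformity on a
  compact ball makes any choice work.\<close>

lemma normal_family_open_image:
  assumes N: "normal_family_on U H'" and U: "open U" "z \<in> U"
    and HH: "\<And>h. h \<in> H \<Longrightarrow> h \<circ> f \<in> H'" and f: "f \<in> Rat"
  shows "\<exists>V. open V \<and> f z \<in> V \<and> normal_family_on V H"
proof -
  obtain e where e: "e > 0" "cball z e \<subseteq> U" using U by (meson open_contains_cball)
  let ?V = "f ` ball z e"
  have "normal_family_on ?V H"
    unfolding normal_family_on_def
  proof (intro allI impI)
    fix h :: "nat \<Rightarrow> riemann_sphere \<Rightarrow> riemann_sphere" assume "\<forall>n. h n \<in> H"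
    then have "\<forall>n. h n \<circ> f \<in> H'" using HH by blast
    then obtain r g where r: "strict_mono r"
      "\<forall>K. compact K \<and> K \<subseteq> U \<longrightarrow> uniform_limit K (\<lambda>n. h (r n) \<circ> f) g sequentially"
      using N[unfolded normal_family_on_def, rule_format, of "\<lambda>n. h n \<circ> f"] by blast
    have "compact (cball z e)"
      using compact_Int_closed[OF compact_sphere closed_cball, of z e] by simp
    then have ul: "uniform_limit (cball z e) (\<lambda>n. h (r n) \<circ> f) g sequentially" using r(2) e(2) by blast
    define g' where "g' y = g (SOME x. x \<in> ball z e \<and> f x = y)" for y
    have "uniform_limit ?V (\<lambda>n. h (r n)) g' sequentially"
      unfolding uniform_limit_iff
    proof (intro allI impI)
      fix d :: real assume "d > 0"
      then have "\<forall>\<^sub>F n in sequentially. \<forall>x\<in>cball z e. dist ((h (r n) \<circ> f) x) (g x) < d"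
        using ul unfolding uniform_limit_iff by blast
      then show "\<forall>\<^sub>F n in sequentially. \<forall>y\<in>?V. dist (h (r n) y) (g' y) < d"
      proof eventually_elim
        case (elim n)
        show ?case
        proof
          fix y assume "y \<in> ?V"
          then have "\<exists>x. x \<in> ball z e \<and> f x = y" by blast
          from someI_ex[OF this] have x: "(SOME x. x \<in> ball z e \<and> f x = y) \<in> ball z e"
            "f (SOME x. x \<in> ball z e \<and> f x = y) = y" by auto
          then have "dist ((h (r n) \<circ> f) (SOME x. x \<in> ball z e \<and> f x = y)) (g' y) < d"
            unfolding g'_def by (intro elim[rule_format]) (meson ball_subset_cball subsetD)
          then show "dist (h (r n) y) (g' y) < d" using x(2) by simp
        qed
      qed
    qed
    then show "\<exists>r g. strict_mono r \<and> (\<forall>K. compact K \<and> K \<subseteq> ?V \<longrightarrow> uniform_limit K (\<lambda>n. h (r n)) g sequentially)"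
      using r(1) uniform_limit_on_subset by blast
  qed
  moreover have "open ?V" using Rat_open_map[OF f open_ball] .
  moreover have "f z \<in> ?V" using e(1) by simp
  ultimately show ?thesis by blast
qed

lemma word_comp_add: "word_comp f \<omega> (n + m) = word_comp f (\<lambda>k. \<omega> (k + m)) n \<circ> word_comp f \<omega> m"
  by (induction n) (auto simp: o_assoc)

lemma word_comp_shift: "word_comp f \<omega> (Suc n) = word_comp f (\<lambda>k. \<omega> (Suc k)) n \<circ> f (\<omega> 0)"
  using word_comp_add[of f \<omega> n 1] by simp

lemma skew_product_iterate:
  "(skew_product f ^^ n) (\<omega>, x) = ((\<lambda>k. \<omega> (k + n)), word_comp f \<omega> n x)"
  by (induction n) (auto simp: skew_product_def)

lemma word_comp_Rat:
  assumes "\<And>i. f i \<in> Rat"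
  shows "n \<ge> 1 \<Longrightarrow> word_comp f \<omega> n \<in> Rat"
proof (induction n)
  case (Suc n)
  show ?case
  proof (cases "n = 0")
    case False
    then have "word_comp f \<omega> n \<in> Rat" using Suc.IH by simp
    from Rat_compose(1)[OF assms this] show ?thesis by (simp only: word_comp.simps)
  qed (use assms in simp)
qed simp

lemma word_comp_sph_map_at:
  assumes "\<And>i. f i \<in> Rat"
  shows "sph_map_at (word_comp f \<omega> n) x"
proof (cases "n = 0")
  case True
  then show ?thesis using sph_map_at_funpow[OF assms, of 0] by simp
next
  case False
  then show ?thesis by (intro Rat_sph_map_at word_comp_Rat assms) simp
qed

lemma word_comp_deriv:
  assumes "\<And>i. f i \<in> Rat"
  shows "sph_deriv_norm (word_comp f \<omega> n) x = (\<Prod>k<n. sph_deriv_norm (f (\<omega> k)) (word_comp f \<omega> k x))"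
proof (induction n)
  case (Suc n)
  then show ?case
    using sph_map_at_comp(2)[OF word_comp_sph_map_at[where f = f and \<omega> = \<omega> and n = n and x = x, OF assms]
        Rat_sph_map_at[OF assms[of "\<omega> n"]]]
    by (simp add: mult.commute o_def)
qed (simp add: sph_deriv_norm_id[unfolded id_def])

lemma julia_fibre_forward:
  assumes "\<And>i. f i \<in> Rat" "z \<in> julia_fibre f \<omega>"
  shows "f (\<omega> 0) z \<in> julia_fibre f (\<lambda>k. \<omega> (Suc k))"
proof (rule ccontr)
  let ?g = "f (\<omega> 0)" and ?H = "{word_comp f (\<lambda>k. \<omega> (Suc k)) n | n. n \<ge> 1}"
  assume "?g z \<notin> julia_fibre f (\<lambda>k. \<omega> (Suc k))"
  then obtain U where U: "open U" "?g z \<in> U" "normal_family_on U ?H"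
    by (auto simp: julia_fibre_def julia_def fatou_def)
  have c: "continuous_on UNIV ?g" using assms(1) by (rule Rat_continuous_on)
  have N: "normal_family_on (?g -` U) (insert ?g ((\<lambda>h. h \<circ> ?g) ` ?H))"
    using normal_family_precompose[OF U(3) c] .
  have "{word_comp f \<omega> n | n. n \<ge> 1} \<subseteq> insert ?g ((\<lambda>h. h \<circ> ?g) ` ?H)"
  proof
    fix h assume "h \<in> {word_comp f \<omega> n | n. n \<ge> 1}"
    then obtain n where n: "n \<ge> 1" "h = word_comp f \<omega> n" by blast
    then obtain m where m: "n = Suc m" by (cases n) auto
    show "h \<in> insert ?g ((\<lambda>h. h \<circ> ?g) ` ?H)"
    proof (cases "m = 0")
      case True
      then show ?thesis using n m by simp
    next
      case False
      have "h = word_comp f (\<lambda>k. \<omega> (Suc k)) m \<circ> ?g" using n(2) m word_comp_shift[of f \<omega> m] by simp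
      moreover have "word_comp f (\<lambda>k. \<omega> (Suc k)) m \<in> ?H" using False by (auto simp: Suc_le_eq)
      ultimately show ?thesis by blast
    qed
  qed
  then have "normal_family_on (?g -` U) {word_comp f \<omega> n | n. n \<ge> 1}"
    using N by (rule normal_family_on_mono)
  moreover have "open (?g -` U)" using U(1) c by (rule open_vimage)
  ultimately have "z \<in> fatou {word_comp f \<omega> n | n. n \<ge> 1}" using U(2) by (auto simp: fatou_def)
  then show False using assms(2) by (simp add: julia_fibre_def julia_def)
qed

lemma julia_fibre_backward:
  assumes f: "\<And>i. f i \<in> Rat" and z: "f (\<omega> 0) z \<in> julia_fibre f (\<lambda>k. \<omega> (Suc k))"
  shows "z \<in> julia_fibre f \<omega>"
proof (rule ccontr)
  let ?g = "f (\<omega> 0)" and ?H = "{word_comp f (\<lambda>k. \<omega> (Suc k)) n | n. n \<ge> 1}"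
  let ?H' = "{word_comp f \<omega> n | n. n \<ge> 1}"
  assume "z \<notin> julia_fibre f \<omega>"
  then obtain U where U: "open U" "z \<in> U" "normal_family_on U ?H'"
    by (auto simp: julia_fibre_def julia_def fatou_def)
  have "h \<circ> ?g \<in> ?H'" if hH: "h \<in> ?H" for h
  proof -
    obtain n where "h = word_comp f (\<lambda>k. \<omega> (Suc k)) n" using hH by blast
    then have "h \<circ> ?g = word_comp f \<omega> (Suc n)" using word_comp_shift[of f \<omega> n] by simp
    then show ?thesis by (intro CollectI exI[of _ "Suc n"]) simp
  qed
  then have "\<exists>V. open V \<and> ?g z \<in> V \<and> normal_family_on V ?H"
    using normal_family_open_image[OF U(3,1,2) _ f] by blast
  then have "?g z \<in> fatou ?H" by (auto simp: fatou_def)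
  then show False using z by (simp add: julia_fibre_def julia_def)
qed

lemma julia_fibre_backward_iterate:
  assumes f: "\<And>i. f i \<in> Rat"
  shows "word_comp f \<omega> n z \<in> julia_fibre f (\<lambda>k. \<omega> (k + n)) \<Longrightarrow> z \<in> julia_fibre f \<omega>"
proof (induction n arbitrary: \<omega> z)
  case (Suc n)
  have "word_comp f (\<lambda>k. \<omega> (Suc k)) n (f (\<omega> 0) z) \<in> julia_fibre f (\<lambda>k. \<omega> (Suc (k + n)))"
  proof -
    have "word_comp f \<omega> (Suc n) z = word_comp f (\<lambda>k. \<omega> (Suc k)) n (f (\<omega> 0) z)"
      unfolding word_comp_shift by simp
    with Suc.prems show ?thesis by (simp only: add_Suc_right)
  qed
  then have "f (\<omega> 0) z \<in> julia_fibre f (\<lambda>k. \<omega> (Suc k))"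
    using Suc.IH[of "\<lambda>k. \<omega> (Suc k)"] by simp
  then show ?case by (rule julia_fibre_backward[OF f])
qed simp

lemma word_comp_semigroup: "n \<ge> 1 \<Longrightarrow> word_comp f \<omega> n \<in> semigroup_gen f"
proof -
  assume n: "n \<ge> 1"
  have "word_comp f \<omega> n = foldr (\<lambda>i h. f i \<circ> h) (rev (map \<omega> [0..<n])) id"
    by (induction n) auto
  then show ?thesis unfolding semigroup_gen_def using n
    by (intro CollectI exI[of _ "rev (map \<omega> [0..<n])"]) auto
qed

lemma julia_fibre_subset: "julia_fibre f \<omega> \<subseteq> julia (semigroup_gen f)"
  unfolding julia_fibre_def by (rule julia_mono) (use word_comp_semigroup in blast)

subsection \<open>The Julia set of the skew product\<close>

lemma topspace_skew [simp]: "topspace skew_topology = UNIV"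
  by (simp add: skew_topology_def)

lemma julia_fibre_skew: "z \<in> julia_fibre f \<omega> \<Longrightarrow> (\<omega>, z) \<in> julia_skew f"
  unfolding julia_skew_def by (rule subsetD[OF closure_of_subset]) auto

lemma continuous_snd_skew: "continuous_map skew_topology euclidean snd"
  unfolding skew_topology_def by (rule continuous_map_snd)

lemma continuous_letter: "continuous_map skew_topology (discrete_topology UNIV) (\<lambda>x. fst x k)"
proof -
  have "continuous_map (product_topology (\<lambda>_. discrete_topology UNIV) UNIV) (discrete_topology UNIV) (\<lambda>\<omega>. \<omega> k)"
    by (rule continuous_map_product_projection) simp
  from continuous_map_compose[OF continuous_map_fst this]
  show ?thesis by (simp add: skew_topology_def o_def)
qed

lemma skew_product_continuous:
  assumes "\<And>i. f i \<in> Rat"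
  shows "continuous_map skew_topology skew_topology (skew_product f)"
proof -
  have 1: "continuous_map skew_topology (product_topology (\<lambda>_. discrete_topology UNIV) UNIV) (\<lambda>x n. fst x (Suc n))"
    using continuous_letter by (auto simp: continuous_map_componentwise_UNIV)
  have 2: "continuous_map skew_topology euclidean (\<lambda>x. f (fst x 0) (snd x))"
    unfolding continuous_map
  proof (intro conjI allI impI)
    fix V :: "riemann_sphere set" assume "openin euclidean V"
    then have V: "open V" by simp
    have op: "openin skew_topology {x \<in> topspace skew_topology. fst x 0 = i \<and> f i (snd x) \<in> V}" for i
    proof -
      have "openin skew_topology {x \<in> topspace skew_topology. fst x 0 \<in> {i}}"
        by (rule openin_continuous_map_preimage[OF continuous_letter]) simp
      moreover have "openin skew_topology {x \<in> topspace skew_topology. snd x \<in> f i -` V}"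
        using open_vimage[OF V Rat_continuous_on[OF assms]]
        by (intro openin_continuous_map_preimage[OF continuous_snd_skew]) simp
      ultimately have "openin skew_topology ({x \<in> topspace skew_topology. fst x 0 \<in> {i}} \<inter>
          {x \<in> topspace skew_topology. snd x \<in> f i -` V})" by (rule openin_Int)
      then show ?thesis by (rule back_subst) auto
    qed
    have "{x \<in> topspace skew_topology. f (fst x 0) (snd x) \<in> V} =
        (\<Union>i. {x \<in> topspace skew_topology. fst x 0 = i \<and> f i (snd x) \<in> V})" by auto
    then show "openin skew_topology {x \<in> topspace skew_topology. f (fst x 0) (snd x) \<in> V}"
      using op by (simp only:) (rule openin_Union, auto)
  qed simp
  have "skew_product f = (\<lambda>x. ((\<lambda>n. fst x (Suc n)), f (fst x 0) (snd x)))"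
    by (auto simp: skew_product_def fun_eq_iff)
  moreover have "continuous_map skew_topology (prod_topology (product_topology (\<lambda>_. discrete_topology UNIV) UNIV) euclidean)
      (\<lambda>x. ((\<lambda>n. fst x (Suc n)), f (fst x 0) (snd x)))"
    using 1 2 by (simp add: continuous_map_pairwise o_def)
  ultimately show ?thesis by (metis skew_topology_def)
qed

lemma julia_skew_forward:
  assumes f: "\<And>i. f i \<in> Rat" and x: "x \<in> julia_skew f"
  shows "(skew_product f ^^ n) x \<in> julia_skew f"
proof -
  let ?S = "\<Union>\<omega>. {\<omega>} \<times> julia_fibre f \<omega>"
  have "skew_product f ` julia_skew f \<subseteq> skew_topology closure_of (skew_product f ` ?S)"
    unfolding julia_skew_def by (rule continuous_map_image_closure_subset[OF skew_product_continuous[OF f]])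
  also have "\<dots> \<subseteq> julia_skew f"
    unfolding julia_skew_def using julia_fibre_forward[OF f]
    by (intro closure_of_mono) (auto simp: skew_product_def)
  finally have "skew_product f ` julia_skew f \<subseteq> julia_skew f" .
  then show ?thesis using x by (induction n) auto
qed

lemma julia_skew_snd: "x \<in> julia_skew f \<Longrightarrow> snd x \<in> julia (semigroup_gen f)"
proof -
  have "closedin skew_topology {x \<in> topspace skew_topology. snd x \<in> julia (semigroup_gen f)}"
    by (rule closedin_continuous_map_preimage[OF continuous_snd_skew]) (simp add: closed_julia)
  then have "julia_skew f \<subseteq> {x \<in> topspace skew_topology. snd x \<in> julia (semigroup_gen f)}"
    unfolding julia_skew_def using julia_fibre_subset by (intro closure_of_minimal) fastforce+
  then show "x \<in> julia_skew f \<Longrightarrow> snd x \<in> julia (semigroup_gen f)" by blast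
qed

lemma compact_julia_skew_snd: "compact (snd ` julia_skew (f :: 'i::finite \<Rightarrow> riemann_sphere \<Rightarrow> riemann_sphere))"
proof -
  have "compact_space (skew_topology :: ((nat \<Rightarrow> 'i) \<times> riemann_sphere) topology)"
    unfolding skew_topology_def compact_space_prod_topology compact_space_product_topology
    using compact_sphere by (auto simp: compact_space_def compactin_discrete_topology)
  then have "compactin skew_topology (julia_skew f)"
    unfolding julia_skew_def by (intro closedin_compact_space closedin_closure_of)
  from image_compactin[OF this continuous_snd_skew] show ?thesis by simp
qed

lemma birkhoff_const:
  assumes f: "\<And>i. f i \<in> Rat" and x: "(\<omega>, x) \<in> julia_skew f"
    and psi: "\<And>i z. z \<in> f i -` julia (semigroup_gen f) \<Longrightarrow> \<psi> i z = c i"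
  shows "birkhoff_sum (skew_product f) n (lift_potential \<psi>) (\<omega>, x) = (\<Sum>k<n. c (\<omega> k))"
  unfolding birkhoff_sum_def
proof (rule sum.cong)
  fix k
  \<comment> \<open>The potential is prescribed where the current letter maps into the Julia set,
    hence the index \<open>Suc k\<close>.\<close>
  have "word_comp f \<omega> (Suc k) x \<in> julia (semigroup_gen f)"
    using julia_skew_snd[OF julia_skew_forward[OF f x, of "Suc k"]]
    by (simp only: skew_product_iterate snd_conv)
  then show "lift_potential \<psi> ((skew_product f ^^ k) (\<omega>, x)) = c (\<omega> k)"
    by (simp add: skew_product_iterate lift_potential_def psi)
qed simp

lemma birkhoff_geom:
  assumes f: "\<And>i. f i \<in> Rat" and pos: "sph_deriv_norm (word_comp f \<omega> n) x > 0"
  shows "birkhoff_sum (skew_product f) n (lift_potential (geom_potential f)) (\<omega>, x) =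
    - ln (sph_deriv_norm (word_comp f \<omega> n) x)"
proof -
  have "sph_deriv_norm (f (\<omega> k)) (word_comp f \<omega> k x) \<noteq> 0" if "k < n" for k
    using pos that unfolding word_comp_deriv[OF f] by (auto simp: prod_zero_iff less_le)
  then have "ln (sph_deriv_norm (word_comp f \<omega> n) x) = (\<Sum>k<n. ln (sph_deriv_norm (f (\<omega> k)) (word_comp f \<omega> k x)))"
    unfolding word_comp_deriv[OF f] by (intro ln_prod) auto
  then show ?thesis
    by (simp add: birkhoff_sum_def skew_product_iterate lift_potential_def geom_potential_def sum_negf)
qed

subsection \<open>Maps that are conjugate to powers\<close>

definition power_map :: "complex \<Rightarrow> nat \<Rightarrow> (riemann_sphere \<Rightarrow> riemann_sphere) \<Rightarrow> bool" where
  "power_map a d h \<longleftrightarrow> h = ratmap (monom a d) 1 \<or> h = ratmap [:a:] (monom 1 d)"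

lemma deriv_ratmap_Fin:
  assumes "coprime P Q"
  shows "sph_deriv_norm (ratmap P Q) (Fin z) = (1 + (cmod z)\<^sup>2) *
    (cmod (poly (pderiv P) z * poly Q z - poly P z * poly (pderiv Q) z) / ((cmod (poly P z))\<^sup>2 + (cmod (poly Q z))\<^sup>2))"
  using sph_holo_sphere_quot(2)[of "poly P" z "poly Q"] coprime_no_common_root[OF assms, of z]
  by (simp add: sph_deriv_norm_eq_sd chart_at_def analytic_poly deriv_poly)

lemma deriv_ratmap_Infty:
  assumes "coprime P Q" and n: "n = max (degree P) (degree Q)" "n \<ge> 1"
    and z: "coeff P (n - 1) = 0" "coeff Q (n - 1) = 0"
  shows "sph_deriv_norm (ratmap P Q) Infty = 0"
proof -
  have "hom_eval n P 1 0 \<noteq> 0 \<or> hom_eval n Q 1 0 \<noteq> 0"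
    using hom_eval_nonzero[OF assms(1) n, of 1 0] by simp
  then have "sd (\<lambda>u. sphere_quot (hom_eval n P 1 u) (hom_eval n Q 1 u)) 0 = 0"
    using sph_holo_sphere_quot(2)[of "hom_eval n P 1" 0 "hom_eval n Q 1"] z
    by (simp add: analytic_hom_eval deriv_hom_eval_0[OF n(2)])
  then show ?thesis
    by (simp add: sph_deriv_norm_eq_sd chart_at_def ratmap_at_Infty[OF n(1)] del: sphere_inv.simps(1))
qed

lemma coprime_power:
  fixes a :: complex
  assumes "a \<noteq> 0"
  shows "coprime (monom a d) 1" "coprime [:a:] (monom 1 d)"
  using assms by (auto intro!: coprime_complex_polyI)

text \<open>Up to a factor \<open>2\<close>, the ratio of the metrics \<open>2 |du| / (1 + |u|\<^sup>2)\<close> and \<open>|du| / |u|\<close>;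
  power maps are homotheties for the latter.\<close>

fun cyl :: "riemann_sphere \<Rightarrow> real" where
  "cyl (Fin u) = cmod u / (1 + (cmod u)\<^sup>2)"
| "cyl Infty = 0"

lemma one_plus_sq: "1 + (cmod u)\<^sup>2 \<noteq> 0"
  using zero_le_power2[of "cmod u"] by linarith

lemma cyl_sphere_inv: "cyl (sphere_inv x) = cyl x"
proof (cases x)
  case (Fin u)
  have "inverse r / (1 + (inverse r)\<^sup>2) = r / (1 + r\<^sup>2)" if "r \<noteq> 0" for r :: real
  proof -
    have "1 + r\<^sup>2 \<noteq> 0" "r\<^sup>2 + 1 \<noteq> 0" using zero_le_power2[of r] by linarith+
    then show ?thesis using that by (simp add: field_simps power2_eq_square)
  qed
  then show ?thesis by (cases "u = 0") (auto simp: Fin sphere_quot_def norm_divide inverse_eq_divide)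
qed simp

lemma deriv_power_Fin:
  fixes a :: complex
  assumes "a \<noteq> 0" "d \<ge> 1"
  shows "sph_deriv_norm (ratmap (monom a d) 1) (Fin u) =
      (1 + (cmod u)\<^sup>2) * (cmod a * (real d * cmod u ^ (d - 1)) / ((cmod a * cmod u ^ d)\<^sup>2 + 1))"
    and "sph_deriv_norm (ratmap [:a:] (monom 1 d)) (Fin u) =
      (1 + (cmod u)\<^sup>2) * (cmod a * (real d * cmod u ^ (d - 1)) / ((cmod a)\<^sup>2 + (cmod u ^ d)\<^sup>2))"
  using deriv_ratmap_Fin[OF coprime_power(1)[OF assms(1)], of d u]
    deriv_ratmap_Fin[OF coprime_power(2)[OF assms(1)], of d u]
  by (simp_all add: pderiv_monom poly_monom norm_mult norm_power mult_ac)

text \<open>The homothety property of power maps for the metric \<open>|du| / |u|\<close>, with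
  factor \<open>d\<close>. In product form it makes sense at 0 and \<open>Infty\<close> too, where
  \<open>cyl\<close> vanishes.\<close>

lemma deriv_power_map_cyl:
  assumes h: "power_map a d h" and a: "a \<noteq> 0" and d: "d \<ge> 1"
  shows "sph_deriv_norm h x * cyl x = real d * cyl (h x)"
proof (cases x)
  case Infty
  have "coeff (monom a d) d = a" by simp
  then show ?thesis using h a d
    by (auto simp: power_map_def Infty Let_def sphere_quot_def degree_monom_eq coeff_pCons split: nat.splits)
next
  case (Fin u)
  have ud: "cmod u ^ (d - 1) * cmod u = cmod u ^ d" using d by (cases d) auto
  have cancel: "(1 + (cmod u)\<^sup>2) * y * (cmod u / (1 + (cmod u)\<^sup>2)) = y * cmod u" for y
    using one_plus_sq[of u] by simp
  from h consider "h = ratmap (monom a d) 1" | "h = ratmap [:a:] (monom 1 d)" unfolding power_map_def by blast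
  then show ?thesis
  proof cases
    case 1
    have hx: "h x = Fin (a * u ^ d)" by (simp add: 1 Fin poly_monom sphere_quot_def)
    have "sph_deriv_norm h x * cyl x = cmod a * (real d * cmod u ^ (d - 1)) / ((cmod a * cmod u ^ d)\<^sup>2 + 1) * cmod u"
      unfolding 1 Fin deriv_power_Fin(1)[OF a d] cyl.simps(1) cancel ..
    also have "\<dots> = real d * (cmod a * (cmod u ^ (d - 1) * cmod u)) / (1 + (cmod a * cmod u ^ d)\<^sup>2)"
      by (simp add: mult_ac add.commute)
    finally show ?thesis unfolding ud hx by (simp add: norm_mult norm_power)
  next
    case 2
    show ?thesis
    proof (cases "u = 0")
      case True
      then show ?thesis using d by (simp add: 2 Fin poly_monom sphere_quot_def power_0_left)
    next
      case False
      have hx: "h x = Fin (a / u ^ d)" using False by (simp add: 2 Fin poly_monom sphere_quot_def)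
      have "sph_deriv_norm h x * cyl x = cmod a * (real d * cmod u ^ (d - 1)) / ((cmod a)\<^sup>2 + (cmod u ^ d)\<^sup>2) * cmod u"
        unfolding 2 Fin deriv_power_Fin(2)[OF a d] cyl.simps(1) cancel ..
      also have "\<dots> = real d * (cmod a * (cmod u ^ (d - 1) * cmod u) / ((cmod a)\<^sup>2 + (cmod u ^ d)\<^sup>2))"
        by (simp add: mult_ac)
      also have "cmod a * (cmod u ^ (d - 1) * cmod u) / ((cmod a)\<^sup>2 + (cmod u ^ d)\<^sup>2) = cyl (Fin (u ^ d / a))"
      proof -
        have "m * w / (m\<^sup>2 + w\<^sup>2) = w / m / (1 + (w / m)\<^sup>2)" if "m > 0" for m w :: real
        proof -
          have "m\<^sup>2 + w\<^sup>2 \<noteq> 0" using that by (simp add: add_pos_nonneg less_imp_neq[symmetric])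
          moreover have "1 + (w / m)\<^sup>2 = (m\<^sup>2 + w\<^sup>2) / m\<^sup>2"
            using that by (simp add: power_divide add_divide_distrib)
          ultimately show ?thesis using that by (simp add: power2_eq_square)
        qed
        then show ?thesis unfolding ud using a by (simp add: norm_divide norm_power)
      qed
      also have "cyl (Fin (u ^ d / a)) = cyl (h x)"
        using cyl_sphere_inv[of "h x"] a False by (simp add: hx sphere_quot_def)
      finally show ?thesis .
    qed
  qed
qed

lemma power_map_crit:
  assumes h: "power_map a d h" and a: "a \<noteq> 0" and d: "d \<ge> 2"
  shows "sph_deriv_norm h x = 0 \<longleftrightarrow> x \<in> {Fin 0, Infty}"
proof -
  have d1: "d \<ge> 1" using d by simp
  show ?thesis
  proof (cases x)
    case (Fin u)
    have "(cmod a * cmod u ^ d)\<^sup>2 + 1 \<noteq> 0"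
      using zero_le_power2[of "cmod a * cmod u ^ d"] by linarith
    moreover have "(cmod a)\<^sup>2 + (cmod u ^ d)\<^sup>2 \<noteq> 0" using a by (simp add: add_pos_nonneg less_imp_neq[symmetric])
    ultimately show ?thesis
      using h a d one_plus_sq[of u] by (auto simp: power_map_def Fin deriv_power_Fin[OF a d1] power_0_left)
  next
    case Infty
    from h consider "h = ratmap (monom a d) 1" | "h = ratmap [:a:] (monom 1 d)" unfolding power_map_def by blast
    then have "sph_deriv_norm h Infty = 0"
    proof cases
      case 1
      show ?thesis unfolding 1 using a d
        by (intro deriv_ratmap_Infty[where n = d] coprime_power) (auto simp: degree_monom_eq)
    next
      case 2
      show ?thesis unfolding 2 using a d
        by (intro deriv_ratmap_Infty[where n = d] coprime_power) (auto simp: degree_monom_eq coeff_pCons split: nat.splits)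
    qed
    then show ?thesis using Infty by simp
  qed
qed

lemma poly_only_root_0:
  fixes P :: "complex poly"
  assumes "P \<noteq> 0" "\<And>z. poly P z = 0 \<Longrightarrow> z = 0"
  shows "P = monom (lead_coeff P) (degree P)"
proof -
  obtain R where R: "P = [:-0, 1:] ^ order 0 P * R" "\<not> [:-0, 1:] dvd R"
    using order_decomp[OF assms(1), of 0] by blast
  have "degree R = 0"
  proof (rule ccontr)
    assume "degree R \<noteq> 0"
    then obtain z where z: "poly R z = 0" by (rule ex_poly_root)
    then have "poly P z = 0" by (subst R(1)) simp
    then have "z = 0" by (rule assms(2))
    then show False using R(2) z by (simp add: poly_eq_0_iff_dvd)
  qed
  then obtain c where c: "R = [:c:]" by (rule degree_eq_zeroE)
  define k where "k = order 0 P"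
  have P: "P = monom c k"
    by (subst R(1)) (simp add: c monom_altdef k_def)
  then have "c \<noteq> 0" using assms(1) by auto
  then show ?thesis by (simp add: P degree_monom_eq)
qed

lemma ratmap_scale:
  assumes "c \<noteq> 0"
  shows "ratmap (smult c P) (smult c Q) = ratmap P Q"
proof
  fix x show "ratmap (smult c P) (smult c Q) x = ratmap P Q x"
    using assms by (cases x) (auto simp: Let_def sphere_quot_scale)
qed

text \<open>All zeros and poles lie at 0 or \<open>Infty\<close>, so \<open>P\<close> and
  \<open>Q\<close> are monomials, and coprimality makes one of them constant.\<close>

lemma power_map_if_backward_invariant:
  assumes h: "h \<in> Rat" and inv: "\<And>x. h x \<in> {Fin 0, Infty} \<Longrightarrow> x \<in> {Fin 0, Infty}"
  obtains a where "a \<noteq> 0" "power_map a (rat_degree h) h"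
proof -
  obtain P Q n where g: "h = ratmap P Q" "coprime P Q" "n = max (degree P) (degree Q)" "n \<ge> 1"
    "rat_degree h = n" using h by (rule RatE)
  have Pr: "z = 0" if "poly P z = 0" for z
    using inv[of "Fin z"] that coprime_no_common_root[OF g(2), of z] by (auto simp: g(1) sphere_quot_def)
  have Qr: "z = 0" if "poly Q z = 0" for z
    using inv[of "Fin z"] that by (auto simp: g(1) sphere_quot_def)
  have P0: "P \<noteq> 0" using Pr[of 1] by auto
  have Q0: "Q \<noteq> 0" using Qr[of 1] by auto
  define p q where "p = lead_coeff P" and "q = lead_coeff Q"
  have nz: "p \<noteq> 0" "q \<noteq> 0" using P0 Q0 by (auto simp: p_def q_def)
  have Pm: "P = monom p k" if "degree P = k" for k
    using poly_only_root_0[OF P0 Pr] that by (simp add: p_def)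
  have Qm: "Q = monom q k" if "degree Q = k" for k
    using poly_only_root_0[OF Q0 Qr] that by (simp add: q_def)
  have "degree P = 0 \<or> degree Q = 0"
  proof (rule ccontr)
    assume "\<not> ?thesis"
    moreover have "poly P 0 = poly (monom p (degree P)) 0" "poly Q 0 = poly (monom q (degree Q)) 0"
      using Pm[OF refl] Qm[OF refl] by (auto intro: arg_cong[where f = "\<lambda>P. poly P 0"])
    ultimately have "poly P 0 = 0 \<and> poly Q 0 = 0" by (simp add: poly_monom power_0_left)
    then show False using coprime_no_common_root[OF g(2), of 0] by simp
  qed
  then show ?thesis
  proof
    assume d: "degree P = 0"
    then have n: "degree Q = n" using g(3,4) by simp
    have "P = smult q [:p / q:]" using Pm[OF d] nz by (simp add: monom_0)
    moreover have "Q = smult q (monom 1 n)" using Qm[OF n] by (simp add: smult_monom)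
    ultimately have "h = ratmap [:p / q:] (monom 1 n)" unfolding g(1) using ratmap_scale[OF nz(2)] by metis
    then have "power_map (p / q) (rat_degree h) h" unfolding power_map_def g(5) by blast
    then show ?thesis using nz by (intro that[of "p / q"]) auto
  next
    assume d: "degree Q = 0"
    then have n: "degree P = n" using g(3,4) by simp
    have "Q = smult q 1" using Qm[OF d] by (simp add: monom_0)
    moreover have "P = smult q (monom (p / q) n)" using Pm[OF n] nz by (simp add: smult_monom)
    ultimately have "h = ratmap (monom (p / q) n) 1" unfolding g(1) using ratmap_scale[OF nz(2)] by metis
    then have "power_map (p / q) (rat_degree h) h" unfolding power_map_def g(5) by blast
    then show ?thesis using nz by (intro that[of "p / q"]) auto
  qed
qed

definition crit :: "(riemann_sphere \<Rightarrow> riemann_sphere) \<Rightarrow> riemann_sphere set" where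
  "crit g = {x. sph_deriv_norm g x = 0}"

lemma deriv_conj:
  assumes \<phi>: "\<phi> \<in> Aut_sphere" and g: "g \<in> Rat"
  shows "sph_deriv_norm (\<phi> \<circ> g \<circ> inv \<phi>) (\<phi> x) * sph_deriv_norm \<phi> x = sph_deriv_norm \<phi> (g x) * sph_deriv_norm g x"
proof -
  note A = Aut_sphereD[OF \<phi>]
  have "(\<phi> \<circ> g \<circ> inv \<phi>) \<circ> \<phi> = \<phi> \<circ> g" using A(3) by (auto simp: fun_eq_iff)
  then show ?thesis
    using Rat_deriv_comp[OF Rat_compose(1)[OF Rat_compose(1)[OF A(1) g] A(2)] A(1), of x]
      Rat_deriv_comp[OF A(1) g, of x] by simp
qed

lemma crit_conj_power:
  assumes \<phi>: "\<phi> \<in> Aut_sphere" and g: "g \<in> Rat" and p: "power_map a d (\<phi> \<circ> g \<circ> inv \<phi>)" "a \<noteq> 0" "d \<ge> 2"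
  shows "crit g = {inv \<phi> (Fin 0), inv \<phi> Infty}" "card (crit g) = 2"
proof -
  note A = Aut_sphereD[OF \<phi>]
  have "sph_deriv_norm g x = 0 \<longleftrightarrow> \<phi> x \<in> {Fin 0, Infty}" for x
    using deriv_conj[OF \<phi> g, of x] power_map_crit[OF p, of "\<phi> x"] A(7) by auto
  moreover have "\<phi> x = y \<longleftrightarrow> x = inv \<phi> y" for x y using A(3,4) by metis
  ultimately show eq: "crit g = {inv \<phi> (Fin 0), inv \<phi> Infty}" by (auto simp: crit_def)
  have "inv \<phi> (Fin 0) \<noteq> inv \<phi> Infty" using A(4) by (metis riemann_sphere.distinct(1))
  then show "card (crit g) = 2" unfolding eq by simp
qed

lemma crit_comp: "g \<in> Rat \<Longrightarrow> h \<in> Rat \<Longrightarrow> crit (g \<circ> h) = crit h \<union> h -` crit g"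
  by (auto simp: crit_def Rat_deriv_comp)

lemma common_conjugation:
  fixes f :: "'i \<Rightarrow> riemann_sphere \<Rightarrow> riemann_sphere"
  assumes f: "\<And>i. f i \<in> Rat" and c1: "\<And>i. card (crit (f i)) = 2" and c2: "\<And>i j. card (crit (f i \<circ> f j)) = 2"
  obtains \<phi> a where "\<phi> \<in> Aut_sphere" "\<And>i. power_map (a i) (rat_degree (f i)) (\<phi> \<circ> f i \<circ> inv \<phi>)"
proof -
  have surj: "f i ` (f i -` E) = E" for i E
    using Rat_surj[OF f[of i]] by (intro surj_image_vimage_eq) (metis surj_def)
  have pre: "f j -` crit (f i) = crit (f j)" for i j
  proof (rule card_seteq)
    show fin: "finite (crit (f j))" using c1[of j] by (intro card_ge_0_finite) simp
    have fin2: "finite (crit (f i \<circ> f j))" using c2[of i j] by (intro card_ge_0_finite) simp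
    have u: "crit (f i \<circ> f j) = crit (f j) \<union> f j -` crit (f i)" by (rule crit_comp[OF f f])
    have "crit (f j) = crit (f i \<circ> f j)"
      using u c1[of j] c2[of i j] by (intro card_subset_eq[OF fin2]) auto
    then show sub: "f j -` crit (f i) \<subseteq> crit (f j)" using u by blast
    have "card (crit (f i)) = card (f j ` (f j -` crit (f i)))" by (simp only: surj)
    also have "\<dots> \<le> card (f j -` crit (f i))" using sub fin by (intro card_image_le) (rule finite_subset)
    finally show "card (crit (f j)) \<le> card (f j -` crit (f i))" by (simp only: c1)
  qed
  have eq: "crit (f i) = crit (f j)" for i j
  proof -
    have "crit (f i) = f j ` (f j -` crit (f i))" by (simp only: surj)
    also have "\<dots> = f j ` (f j -` crit (f j))" by (simp only: pre)
    finally show ?thesis by (simp only: surj)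
  qed
  obtain i0 :: 'i where True by blast
  obtain e0 e1 where E: "crit (f i0) = {e0, e1}" "e0 \<noteq> e1" using c1[of i0] by (auto simp: card_2_iff)
  obtain \<phi> where \<phi>: "\<phi> \<in> Aut_sphere" "\<phi> e0 = Fin 0" "\<phi> e1 = Infty" using ex_Aut_0_Infty[OF E(2)] .
  note A = Aut_sphereD[OF \<phi>(1)]
  have i01: "inv \<phi> (Fin 0) = e0" "inv \<phi> Infty = e1" using A(3) \<phi>(2,3) by metis+
  have "\<exists>a. power_map a (rat_degree (f i)) (\<phi> \<circ> f i \<circ> inv \<phi>)" for i
  proof -
    let ?h = "\<phi> \<circ> f i \<circ> inv \<phi>"
    have hR: "?h \<in> Rat" "rat_degree ?h = rat_degree (f i)"
      using Rat_compose(1)[OF Rat_compose(1)[OF A(1) f] A(2)] Rat_compose(2)[OF Rat_compose(1)[OF A(1) f] A(2)]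
        Rat_compose(2)[OF A(1) f] A(5,6) by auto
    have "x \<in> {Fin 0, Infty}" if x: "?h x \<in> {Fin 0, Infty}" for x
    proof -
      have "f i (inv \<phi> x) \<in> {e0, e1}" using x A(3)[of "f i (inv \<phi> x)"] i01 by auto
      then have "inv \<phi> x \<in> f i -` crit (f i0)" by (simp add: E(1))
      moreover have "f i -` crit (f i0) = {e0, e1}" by (rule trans[OF pre], rule trans[OF eq E(1)])
      ultimately have "inv \<phi> x \<in> {e0, e1}" by simp
      then show ?thesis using A(4)[of x] \<phi>(2,3) by auto
    qed
    then obtain a where "power_map a (rat_degree ?h) ?h" using power_map_if_backward_invariant[OF hR(1)] by blast
    then show ?thesis using hR(2) by auto
  qed
  then obtain a where "\<And>i. power_map (a i) (rat_degree (f i)) (\<phi> \<circ> f i \<circ> inv \<phi>)" by metis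
  with \<phi>(1) show ?thesis by (rule that)
qed

subsection \<open>Birkhoff quotients along periodic orbits\<close>

text \<open>Subtracting the linear trend leaves a periodic, hence bounded, sequence.\<close>

lemma quasi_periodic_average:
  fixes a :: "nat \<Rightarrow> real"
  assumes T: "T \<ge> 1" and a: "\<And>n. a (n + T) = a n + A"
  shows "(\<lambda>n. a n / real n) \<longlonglongrightarrow> A / real T"
proof -
  define b where "b n = a n - real n * (A / real T)" for n
  have bT: "b (n + T) = b n" for n
  proof -
    have "real (n + T) * (A / real T) = real n * (A / real T) + A" using T by (simp add: add_divide_distrib distrib_right)
    then show ?thesis by (simp add: b_def a)
  qed
  have bk: "b (n + k * T) = b n" for n k
  proof (induction k)
    case (Suc k)
    have "n + Suc k * T = (n + k * T) + T" by simp
    then show ?case by (simp only: bT Suc)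
  qed simp
  have bm: "b n = b (n mod T)" for n
    using bk[of "n mod T" "n div T"] by simp
  have "\<bar>b n\<bar> \<le> (\<Sum>k<T. \<bar>b k\<bar>)" for n
    unfolding bm[of n] using T by (intro member_le_sum) auto
  then have bd: "norm (b n / real n) \<le> (\<Sum>k<T. \<bar>b k\<bar>) / real n" for n
    by (simp add: divide_right_mono abs_divide)
  have "(\<lambda>n. b n / real n) \<longlonglongrightarrow> 0"
    by (rule Lim_null_comparison[OF always_eventually[OF allI[OF bd]] lim_const_over_n])
  then have "(\<lambda>n. b n / real n + A / real T) \<longlonglongrightarrow> 0 + A / real T" by (intro tendsto_intros)
  moreover have "\<forall>\<^sub>F n in sequentially. b n / real n + A / real T = a n / real n"
    using eventually_gt_at_top[of 0] by eventually_elim (simp add: b_def diff_divide_distrib)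
  ultimately show ?thesis using Lim_transform_eventually by fastforce
qed

lemma quasi_periodic_quotient:
  fixes a b :: "nat \<Rightarrow> real"
  assumes T: "T \<ge> 1" and a: "\<And>n. a (n + T) = a n + A" and b: "\<And>n. b (n + T) = b n + B" and B: "B \<noteq> 0"
  shows "(\<lambda>n. a n / b n) \<longlonglongrightarrow> A / B"
proof -
  have "(\<lambda>n. (a n / real n) / (b n / real n)) \<longlonglongrightarrow> (A / real T) / (B / real T)"
    using T B by (intro tendsto_divide quasi_periodic_average a b) auto
  moreover have "(A / real T) / (B / real T) = A / B" using T by simp
  moreover have "\<forall>\<^sub>F n in sequentially. (a n / real n) / (b n / real n) = a n / b n"
    using eventually_gt_at_top[of 0] by eventually_elim simp
  ultimately show ?thesis using Lim_transform_eventually by fastforce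
qed

lemma word_comp_periodic:
  assumes "\<And>k. \<omega> (k + m) = \<omega> k"
  shows "word_comp f \<omega> (m * n) = word_comp f \<omega> m ^^ n"
proof (induction n)
  case (Suc n)
  have "word_comp f \<omega> (m * n + m) = word_comp f \<omega> (m * n) \<circ> word_comp f \<omega> m"
    unfolding word_comp_add using assms by simp
  then show ?case using Suc by (simp add: funpow_Suc_right add.commute del: funpow.simps)
qed simp

lemma periodic_mult:
  fixes k m q :: nat
  assumes "\<And>k. \<omega> (k + m) = \<omega> k"
  shows "\<omega> (k + m * q) = \<omega> k"
proof (induction q)
  case (Suc q)
  have "\<omega> (k + m * Suc q) = \<omega> ((k + m * q) + m)" by (simp add: ac_simps)
  then show ?case using assms Suc by simp
qed simp

lemma Rat_funpow:
  assumes "g \<in> Rat" "n \<ge> 1"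
  shows "g ^^ n \<in> Rat \<and> rat_degree (g ^^ n) = rat_degree g ^ n"
  using assms(2)
proof (induction n rule: nat_induct_at_least)
  case base
  then show ?case using assms(1) by simp
next
  case (Suc n)
  then show ?case using Rat_compose[OF assms(1), of "g ^^ n"] by (simp add: o_def)
qed

section \<open>Expanding systems with constant potentials\<close>

locale expanding_system =
  fixes f :: "'i::finite \<Rightarrow> riemann_sphere \<Rightarrow> riemann_sphere" and c :: "'i \<Rightarrow> real"
    and \<psi> :: "'i \<Rightarrow> riemann_sphere \<Rightarrow> real" and C l :: real
  assumes fRat: "\<And>i. f i \<in> Rat" and Cpos: "C > 0" and l1: "l > 1"
    and expand: "\<And>n \<omega> z. n \<ge> 1 \<Longrightarrow> (\<omega>, z) \<in> julia_skew f \<Longrightarrow> sph_deriv_norm (word_comp f \<omega> n) z \<ge> C * l ^ n"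
    and psi: "\<And>i z. z \<in> f i -` julia (semigroup_gen f) \<Longrightarrow> \<psi> i z = c i"
    and cneg: "\<And>i. c i < 0"
begin

lemma word_sph_map_at: "sph_map_at (word_comp f \<omega> n) x"
  by (rule word_comp_sph_map_at) (rule fRat)

lemma deriv_pos: "(\<omega>, z) \<in> julia_skew f \<Longrightarrow> sph_deriv_norm (word_comp f \<omega> n) z > 0"
proof (cases "n = 0")
  case False
  assume "(\<omega>, z) \<in> julia_skew f"
  then have "C * l ^ n \<le> sph_deriv_norm (word_comp f \<omega> n) z" using False by (intro expand) auto
  moreover have "C * l ^ n > 0" using Cpos l1 by simp
  ultimately show ?thesis by linarith
qed (simp add: sph_deriv_norm_id[unfolded id_def])

definition quotient :: "(nat \<Rightarrow> 'i) \<Rightarrow> riemann_sphere \<Rightarrow> nat \<Rightarrow> real" where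
  "quotient \<omega> x n = (\<Sum>k<n. c (\<omega> k)) / - ln (sph_deriv_norm (word_comp f \<omega> n) x)"

lemma level_set_nonempty_iff:
  "level_set f \<psi> \<alpha> \<noteq> {} \<longleftrightarrow> (\<exists>\<omega> x. (\<omega>, x) \<in> julia_skew f \<and> quotient \<omega> x \<longlonglongrightarrow> \<alpha>)"
proof -
  have "birkhoff_sum (skew_product f) n (lift_potential \<psi>) (\<omega>, x)
      / birkhoff_sum (skew_product f) n (lift_potential (geom_potential f)) (\<omega>, x) = quotient \<omega> x n"
    if "(\<omega>, x) \<in> julia_skew f" for \<omega> x n
  proof -
    have "birkhoff_sum (skew_product f) n (lift_potential \<psi>) (\<omega>, x) = (\<Sum>k<n. c (\<omega> k))"
      by (rule birkhoff_const[OF _ that]) (auto simp: fRat psi)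
    moreover have "birkhoff_sum (skew_product f) n (lift_potential (geom_potential f)) (\<omega>, x) =
        - ln (sph_deriv_norm (word_comp f \<omega> n) x)"
      by (rule birkhoff_geom[OF _ deriv_pos[OF that]]) (rule fRat)
    ultimately show ?thesis by (simp add: quotient_def)
  qed
  then have "x \<in> julia_skew f \<Longrightarrow> ((\<lambda>n. birkhoff_sum (skew_product f) n (lift_potential \<psi>) x
      / birkhoff_sum (skew_product f) n (lift_potential (geom_potential f)) x) \<longlonglongrightarrow> \<alpha>)
      \<longleftrightarrow> quotient (fst x) (snd x) \<longlonglongrightarrow> \<alpha>" for x
    by (cases x) simp
  then show ?thesis unfolding level_set_def by fastforce
qed

text \<open>A multiplier at most 1 would keep the derivatives along multiples of the period bounded
  by 1, against exponential growth. Over one period of length \<open>m * q\<close> both Birkhoff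
  sums gain a fixed amount, and the quotient of the gains is the level.\<close>

lemma periodic_multiplier:
  assumes m: "m \<ge> 1" and per: "\<And>k. \<omega> (k + m) = \<omega> k" and x: "x \<in> julia_fibre f \<omega>"
    and q: "q \<ge> 1" and fixx: "(word_comp f \<omega> m ^^ q) x = x"
  defines "\<kappa> \<equiv> sph_deriv_norm (word_comp f \<omega> m ^^ q) x"
  shows "\<kappa> > 1" and "level_set f \<psi> (real q * (\<Sum>k<m. c (\<omega> k)) / - ln \<kappa>) \<noteq> {}"
proof -
  have xJ: "(\<omega>, x) \<in> julia_skew f" using x by (rule julia_fibre_skew)
  define T where "T = m * q"
  have T: "T \<ge> 1" using m q by (simp add: T_def Suc_le_eq)
  have WT: "word_comp f \<omega> T = word_comp f \<omega> m ^^ q" unfolding T_def by (rule word_comp_periodic[where \<omega> = \<omega> and m = m, OF per])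
  have perT: "\<omega> (k + T) = \<omega> k" for k unfolding T_def by (rule periodic_mult[where \<omega> = \<omega> and m = m, OF per])
  have step: "word_comp f \<omega> (n + T) = word_comp f \<omega> n \<circ> word_comp f \<omega> T" for n
    unfolding word_comp_add using perT by simp
  let ?D = "\<lambda>n. sph_deriv_norm (word_comp f \<omega> n) x"
  have Dstep: "?D (n + T) = ?D n * \<kappa>" for n
  proof -
    have "?D (n + T) = sph_deriv_norm (word_comp f \<omega> n) (word_comp f \<omega> T x) * sph_deriv_norm (word_comp f \<omega> T) x"
      unfolding step by (rule sph_map_at_comp(2)[OF word_sph_map_at word_sph_map_at])
    then show ?thesis unfolding \<kappa>_def using fixx by (simp add: WT)
  qed
  have Dpow: "?D (j * T) = \<kappa> ^ j" for j
  proof (induction j)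
    case (Suc j)
    have "Suc j * T = j * T + T" by simp
    then show ?case by (simp only: Dstep Suc) (simp add: mult.commute)
  qed (simp add: sph_deriv_norm_id[unfolded id_def])
  have kpos: "\<kappa> > 0" unfolding \<kappa>_def WT[symmetric] by (rule deriv_pos[OF xJ])
  show k1: "\<kappa> > 1"
  proof (rule ccontr)
    assume "\<not> \<kappa> > 1"
    \<comment> \<open>\<open>j\<close> is chosen so that the growth overcomes a small constant
      \<open>C\<close>; \<open>Suc j\<close> ensures at least one full period.\<close>
    obtain j where j: "1 / C < l ^ j" using real_arch_pow[OF l1] by blast
    have jT: "j \<le> Suc j * T" "1 \<le> Suc j * T" using mult_le_mono2[OF T, of "Suc j"] by simp_all
    have "1 < C * l ^ j" using j Cpos by (simp add: divide_less_eq mult.commute)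
    also have "\<dots> \<le> C * l ^ (Suc j * T)"
      using Cpos l1 jT(1) by (intro mult_left_mono power_increasing) auto
    also have "\<dots> \<le> ?D (Suc j * T)" by (rule expand[OF jT(2) xJ])
    also have "\<dots> = \<kappa> ^ Suc j" by (rule Dpow)
    also have "\<dots> \<le> 1" using \<open>\<not> \<kappa> > 1\<close> kpos by (intro power_le_one) auto
    finally show False by simp
  qed
  let ?a = "\<lambda>n. \<Sum>k<n. c (\<omega> k)"
  have astep: "?a (n + T) = ?a n + ?a T" for n
  proof (induction n)
    case (Suc n)
    then show ?case by (simp add: perT)
  qed simp
  have am: "?a (m * j) = real j * ?a m" for j
  proof (induction j)
    case (Suc j)
    have "?a (m * j + i) = ?a (m * j) + ?a i" for i
    proof (induction i)
      case (Suc i)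
      have "\<omega> (m * j + i) = \<omega> i" using periodic_mult[where \<omega> = \<omega> and m = m and k = i and q = j, OF per] by (simp add: add.commute)
      then show ?case using Suc by simp
    qed simp
    from this[of m] Suc show ?case by (simp add: algebra_simps)
  qed simp
  have "- ln (?D (n + T)) = - ln (?D n) + - ln \<kappa>" for n
    unfolding Dstep using deriv_pos[OF xJ, of n] kpos by (simp add: ln_mult)
  then have "(\<lambda>n. ?a n / - ln (?D n)) \<longlonglongrightarrow> ?a T / - ln \<kappa>"
    using k1 by (intro quasi_periodic_quotient[where T = T] T astep) auto
  then have "quotient \<omega> x \<longlonglongrightarrow> real q * ?a m / - ln \<kappa>"
    by (simp add: quotient_def[abs_def] T_def am)
  then show "level_set f \<psi> (real q * (\<Sum>k<m. c (\<omega> k)) / - ln \<kappa>) \<noteq> {}"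
    unfolding level_set_nonempty_iff using xJ by blast
qed

text \<open>Uniqueness of the level prescribes \<open>\<alpha>0 * ln\<close> of the multiplier of
  every cycle of \<open>g\<close> in the fibre. The fixed point needed for \<open>rigidity\<close>
  is repelling or parabolic, so it lies in the fibre Julia set, where expansion makes it repelling.
  Rigidity evaluates its multiplier as the degree.\<close>

lemma word_rigidity:
  assumes uniq: "\<And>\<alpha>. level_set f \<psi> \<alpha> \<noteq> {} \<Longrightarrow> \<alpha> = \<alpha>0"
    and m: "m \<ge> 1" and per: "\<And>k. \<omega> (k + m) = \<omega> k"
    and deg: "rat_degree (word_comp f \<omega> m) \<ge> 2"
  shows "\<alpha>0 * ln (rat_degree (word_comp f \<omega> m)) = - (\<Sum>k<m. c (\<omega> k))"
    and "card (crit (word_comp f \<omega> m)) = 2"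
proof -
  define g where "g = word_comp f \<omega> m"
  define J where "J = julia_fibre f \<omega>"
  define cw where "cw = (\<Sum>k<m. c (\<omega> k))"
  have gR: "g \<in> Rat" unfolding g_def by (rule word_comp_Rat[OF _ m]) (rule fRat)
  have "0 < (\<Sum>k<m. - c (\<omega> k))" using m cneg by (intro sum_pos) (auto simp: lessThan_empty_iff)
  then have cw: "cw < 0" by (simp add: cw_def sum_negf)
  have fam: "g ^^ n \<in> {word_comp f \<omega> n | n. n \<ge> 1}" if "n \<ge> 1" for n
    using word_comp_periodic[where \<omega> = \<omega> and m = m and f = f and n = n, OF per] that m unfolding g_def
    by (intro CollectI exI[of _ "m * n"]) (auto simp: Suc_le_eq)
  have val: "sph_deriv_norm (g ^^ q) x > 1 \<and> \<alpha>0 * ln (sph_deriv_norm (g ^^ q) x) = - real q * cw"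
    if "x \<in> J" "q \<ge> 1" "(g ^^ q) x = x" for x q
  proof -
    have "sph_deriv_norm (g ^^ q) x > 1" and ne: "level_set f \<psi> (real q * cw / - ln (sph_deriv_norm (g ^^ q) x)) \<noteq> {}"
      using periodic_multiplier[where \<omega> = \<omega> and x = x, OF m per _ that(2)] that unfolding g_def J_def cw_def by auto
    then show ?thesis using uniq[OF ne] by (auto simp: field_simps)
  qed
  \<comment> \<open>A repelling or parabolic cycle lies in the Julia set of the periodic word, as
    the iterates of \<open>g\<close> are among the compositions along
    \<open>\<omega>\<close>.\<close>
  have inJ: "x \<in> J" if n: "n \<ge> 1" "(g ^^ n) x = x" and mu: "cmod (multiplier (g ^^ n) x) > 1 \<or> multiplier (g ^^ n) x = 1" for x n
    unfolding J_def julia_fibre_def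
  proof (rule not_normal_fixed_point)
    have "2 ^ 1 \<le> rat_degree g ^ n"
    proof -
      have "(2::nat) ^ 1 \<le> 2 ^ n" using n(1) by (intro power_increasing) auto
      also have "\<dots> \<le> rat_degree g ^ n" using deg by (intro power_mono) (auto simp: g_def)
      finally show ?thesis .
    qed
    then show "g ^^ n \<in> Rat" "2 \<le> rat_degree (g ^^ n)" using Rat_funpow[OF gR n(1)] by auto
    show "(g ^^ n) ^^ k \<in> {word_comp f \<omega> n | n. n \<ge> 1}" if "k \<ge> 1" for k
      using fam[of "n * k"] that n(1) by (simp add: funpow_mult mult.commute)
  qed (use n mu in auto)
  obtain p where p: "g p = p" "cmod (multiplier g p) > 1 \<or> multiplier g p = 1"
    using ex_nonattracting_fixed_point[OF gR] deg unfolding g_def by blast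
  have pJ: "p \<in> J" using inJ[of 1 p] p by simp
  have vp: "sph_deriv_norm g p > 1" "\<alpha>0 * ln (sph_deriv_norm g p) = - cw"
    using val[OF pJ, of 1] p(1) by auto
  have a0: "\<alpha>0 \<noteq> 0" using vp(2) cw by auto
  have closedJ: "closed J" unfolding J_def julia_fibre_def by (rule closed_julia)
  have backJ: "x \<in> J" if "g x \<in> J" for x
    using julia_fibre_backward_iterate[of f \<omega> m x, OF fRat] that per unfolding g_def J_def by simp
  have nondeg: "sph_deriv_norm g x \<noteq> 0" if "x \<in> J" for x
    using deriv_pos[OF julia_fibre_skew, of x \<omega> m] that unfolding g_def J_def by simp
  have perD: "sph_deriv_norm (g ^^ n) x = sph_deriv_norm g p ^ n"
    if n: "n \<ge> 1" "(g ^^ n) x = x" and D: "sph_deriv_norm (g ^^ n) x > 1" for x n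
  proof -
    have "cmod (multiplier (g ^^ n) x) = sph_deriv_norm (g ^^ n) x"
      by (rule chart_repr_props(4)[OF sph_map_at_funpow[OF gR] n(2)])
    then have "x \<in> J" using D by (intro inJ[OF n]) simp
    then have "\<alpha>0 * ln (sph_deriv_norm (g ^^ n) x) = - real n * cw" using val n by blast
    also have "\<dots> = real n * (\<alpha>0 * ln (sph_deriv_norm g p))" by (simp add: vp(2))
    also have "\<dots> = \<alpha>0 * (real n * ln (sph_deriv_norm g p))" by simp
    finally have "ln (sph_deriv_norm (g ^^ n) x) = ln (sph_deriv_norm g p ^ n)"
      using a0 vp(1) by (simp add: ln_realpow)
    then show ?thesis using D vp(1) by simp
  qed
  have deg2: "rat_degree g \<ge> 2" using deg by (simp add: g_def)
  note rig = rigidity[OF gR deg2 closedJ backJ nondeg pJ p(1) vp(1) perD]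
  show "\<alpha>0 * ln (rat_degree (word_comp f \<omega> m)) = - (\<Sum>k<m. c (\<omega> k))"
    using rig(1) vp(2) by (simp add: g_def cw_def)
  obtain \<phi> where phi: "\<phi> \<in> Aut_sphere" "\<phi> \<circ> g \<circ> inv \<phi> = ratmap (monom 1 (rat_degree g)) 1 \<or>
      \<phi> \<circ> g \<circ> inv \<phi> = ratmap 1 (monom 1 (rat_degree g))"
    using rig(2) by blast
  have "[:1:] = (1 :: complex poly)" by (simp add: one_pCons)
  then have "power_map 1 (rat_degree g) (\<phi> \<circ> g \<circ> inv \<phi>)"
    using phi(2) by (simp only: power_map_def)
  from crit_conj_power(2)[OF phi(1) gR this _ deg2]
  show "card (crit (word_comp f \<omega> m)) = 2" by (simp add: g_def)
qed

text \<open>Words of length one give the relation between \<open>c\<close> and the degrees; words of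
  length two force common critical points through \<open>common_conjugation\<close>.\<close>

lemma common_conjugation_if_unique_level:
  assumes uniq: "\<And>\<alpha>. level_set f \<psi> \<alpha> \<noteq> {} \<Longrightarrow> \<alpha> = \<alpha>0" and i0: "rat_degree (f i0) \<ge> 2"
  shows "\<exists>\<phi>\<in>Aut_sphere. \<exists>(a :: 'i \<Rightarrow> complex) (b :: real). \<forall>i.
    power_map (a i) (rat_degree (f i)) (\<phi> \<circ> f i \<circ> inv \<phi>) \<and> ln (real (rat_degree (f i))) = b * c i"
proof -
  have w1: "\<alpha>0 * ln (rat_degree (f i)) = - c i" "card (crit (f i)) = 2" if "rat_degree (f i) \<ge> 2" for i
    using word_rigidity[OF uniq, of 1 "\<lambda>_. i"] that by (auto simp: lessThan_Suc o_def)
  have w2: "\<alpha>0 * ln (rat_degree (f i \<circ> f j)) = - (c i + c j)" "card (crit (f i \<circ> f j)) = 2"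
    if "rat_degree (f i \<circ> f j) \<ge> 2" for i j
  proof -
    define \<omega> where "\<omega> k = (if even k then j else i)" for k :: nat
    have W: "word_comp f \<omega> 2 = f i \<circ> f j" by (simp add: numeral_2_eq_2 \<omega>_def o_def)
    have S: "(\<Sum>k<2. c (\<omega> k)) = c i + c j" by (simp add: numeral_2_eq_2 \<omega>_def)
    have per: "\<omega> (k + 2) = \<omega> k" for k by (simp add: \<omega>_def)
    have d: "rat_degree (word_comp f \<omega> 2) \<ge> 2" using that by (simp only: W)
    show "\<alpha>0 * ln (rat_degree (f i \<circ> f j)) = - (c i + c j)" "card (crit (f i \<circ> f j)) = 2"
      using word_rigidity[OF uniq _ per d] unfolding W S by auto
  qed
  have degc: "rat_degree (f i \<circ> f j) = rat_degree (f i) * rat_degree (f j)" for i j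
    by (rule Rat_compose(2)[OF fRat fRat])
  have dpos: "rat_degree (f i) \<ge> 1" for i using RatE[OF fRat[of i]] by metis
  have apos: "\<alpha>0 > 0"
  proof -
    have "\<alpha>0 * ln (rat_degree (f i0)) > 0" using w1(1)[OF i0] cneg[of i0] by simp
    moreover have "ln (real (rat_degree (f i0))) > 0" using i0 by simp
    ultimately show ?thesis using zero_less_mult_pos2 by blast
  qed
  \<comment> \<open>A letter \<open>j\<close> of degree 1 would leave the degree of
    \<open>f i0\<close> unchanged in \<open>f i0 \<circ> f j\<close>, while the sum of the weights
    drops by \<open>c j < 0\<close>.\<close>
  have d2: "rat_degree (f j) \<ge> 2" for j
  proof (rule ccontr)
    assume "\<not> ?thesis"
    then have dj: "rat_degree (f j) = 1" using dpos[of j] by simp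
    then have "rat_degree (f i0 \<circ> f j) = rat_degree (f i0)" by (simp add: degc)
    then have "- (c i0 + c j) = - c i0" using w2(1)[of i0 j] w1(1)[OF i0] i0 by simp
    then show False using cneg[of j] by simp
  qed
  have dd: "rat_degree (f i \<circ> f j) \<ge> 2" for i j
    using mult_le_mono[OF d2[of i] dpos[of j]] by (simp add: degc)
  obtain \<phi> a where phi: "\<phi> \<in> Aut_sphere" "\<And>i. power_map (a i) (rat_degree (f i)) (\<phi> \<circ> f i \<circ> inv \<phi>)"
    using common_conjugation[of f, OF fRat w1(2)[OF d2] w2(2)[OF dd]] by blast
  have "ln (real (rat_degree (f i))) = (- 1 / \<alpha>0) * c i" for i
    using w1(1)[OF d2[of i]] apos by (simp add: field_simps)
  then show ?thesis using phi by blast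
qed

end

subsection \<open>Power maps have a single level\<close>

lemma isCont_sph_deriv_norm:
  assumes g: "g \<in> Rat"
  shows "isCont (sph_deriv_norm g) x"
proof -
  let ?w = "to_complex (chart_at x x)" and ?k = "\<lambda>y. to_complex (chart_at x y)"
  let ?H = "\<lambda>u. chart_at x (Fin u)"
  have G: "sph_holo (\<lambda>u. g (?H u)) u" "sd (\<lambda>u. g (?H u)) u = sph_deriv_norm g (?H u) * sd ?H u" for u
    by (rule sph_holo_compose[OF sph_holo_chart Rat_sph_map_at[OF g]])+
  have sdH: "sd ?H u = 1 / (1 + (cmod u)\<^sup>2)" for u
    using sd_eq[where h = "\<lambda>u. u" and c = "chart_at x" and H = ?H and z = u, OF _ chart_at_cases] by simp
  have k: "(?k \<longlongrightarrow> ?w) (nhds x)"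
    by (intro tendsto_to_complex tendsto_intros chart_at_self filterlim_ident)
  let ?F = "\<lambda>u. (1 + (cmod u)\<^sup>2) * sd (\<lambda>u. g (?H u)) u"
  have F: "?F u = sph_deriv_norm g (?H u)" for u
    using one_plus_sq[of u] by (simp add: G(2) sdH)
  have "isCont ?F ?w" by (intro continuous_intros isCont_sd G(1))
  then have lim: "((\<lambda>y. ?F (?k y)) \<longlongrightarrow> ?F ?w) (nhds x)" using k by (rule isCont_tendsto_compose)
  have "((\<lambda>y. chart_at x y) \<longlongrightarrow> Fin ?w) (nhds x)"
    by (subst Fin_to_complex[OF chart_at_self]) (intro tendsto_intros filterlim_ident)
  then have "\<forall>\<^sub>F y in nhds x. ?F (?k y) = sph_deriv_norm g y"
    by (rule tendsto_eventually_not_Infty[THEN eventually_mono]) (simp only: F, simp add: Fin_to_complex)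
  from Lim_transform_eventually[OF lim this]
  show ?thesis by (simp add: F isCont_def tendsto_at_iff_tendsto_nhds)
qed

lemma isCont_cyl: "isCont cyl x"
proof -
  \<comment> \<open>\<open>cyl\<close> is half the distance of the stereographic image from the
    polar axis, which shows continuity at \<open>Infty\<close> too.\<close>
  have eq: "cyl x = norm (fst (stereo x)) / 2" for x
  proof (cases x)
    case (Fin u)
    have "norm (fst (stereo x)) = 2 / (1 + (cmod u)\<^sup>2) * cmod u"
      by (simp add: Fin add_nonneg_nonneg)
    moreover have "r / s = 2 / s * r / 2" for r s :: real by simp
    ultimately show ?thesis by (simp only: Fin cyl.simps)
  qed simp
  have "(stereo \<longlongrightarrow> stereo x) (at x)" using tendsto_sphere_iff[of "\<lambda>x. x" x "at x"] by simp
  then have "((\<lambda>x. norm (fst (stereo x)) / 2) \<longlongrightarrow> norm (fst (stereo x)) / 2) (at x)"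
    by (intro tendsto_intros) auto
  then show ?thesis by (simp add: isCont_def eq[abs_def])
qed

lemma cyl_nonneg: "cyl x \<ge> 0"
  by (cases x) (auto simp: add_nonneg_nonneg)

lemma cyl_eq_0_iff: "cyl x = 0 \<longleftrightarrow> x \<in> {Fin 0, Infty}"
  using one_plus_sq by (cases x) auto

text \<open>With coefficient 0 the map would be constant on the punctured plane, against finiteness
  of fibres.\<close>

lemma power_map_nonzero:
  assumes h: "h \<in> Rat" and p: "power_map a d h"
  shows "a \<noteq> 0"
proof
  assume a: "a = 0"
  then have "h (Fin u) = Fin 0" if "u \<noteq> 0" for u
    using p that by (auto simp: power_map_def sphere_quot_def poly_monom)
  then have "Fin ` (- {0}) \<subseteq> {x. h x = Fin 0}" by auto
  then have "finite (Fin ` (- {0 :: complex}))" using Rat_finite_fibre[OF h] finite_subset by blast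
  then have "finite (- {0 :: complex})" by (rule finite_imageD) (auto simp: inj_on_def)
  then show False by (simp add: infinite_UNIV_char_0 Compl_eq_Diff_UNIV)
qed

text \<open>\<open>s\<close> decreases at least linearly, so a bounded error disappears in the
  quotient.\<close>

lemma quotient_tendsto_if_bounded_difference:
  fixes s L :: "nat \<Rightarrow> real"
  assumes b: "b \<noteq> 0" and \<delta>: "\<delta> > 0" and s: "\<And>n. s n \<le> - real n * \<delta>"
    and L: "\<And>n. \<bar>L n - b * s n\<bar> \<le> M"
  shows "(\<lambda>n. s n / - L n) \<longlonglongrightarrow> - 1 / b"
proof -
  have M0: "M \<ge> 0" using L[of 0] by linarith
  have ev: "\<forall>\<^sub>F n in sequentially. s n < 0"
    using eventually_gt_at_top[of 0]
  proof eventually_elim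
    case (elim n)
    then have "real n * \<delta> > 0" using \<delta> by simp
    then show ?case using s[of n] by linarith
  qed
  have "\<forall>\<^sub>F n in sequentially. norm (L n / s n - b) \<le> (M / \<delta>) / real n"
    using eventually_gt_at_top[of 0] ev
  proof eventually_elim
    case (elim n)
    have pos: "real n * \<delta> > 0" using elim \<delta> by simp
    have "norm (L n / s n - b) = \<bar>L n - b * s n\<bar> / \<bar>s n\<bar>"
    proof -
      have "L n / s n - b = (L n - b * s n) / s n" using elim by (simp add: diff_divide_distrib)
      then show ?thesis by (simp add: abs_divide)
    qed
    also have "\<dots> \<le> M / (real n * \<delta>)"
      using L[of n] s[of n] pos M0 by (intro frac_le) auto
    finally show ?case by (simp add: mult.commute)
  qed
  then have "(\<lambda>n. L n / s n - b) \<longlonglongrightarrow> 0"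
    by (rule Lim_null_comparison) (rule lim_const_over_n)
  then have "(\<lambda>n. L n / s n) \<longlonglongrightarrow> b" by (simp add: LIM_zero_iff)
  then have "(\<lambda>n. - inverse (L n / s n)) \<longlonglongrightarrow> - inverse b" using b by (intro tendsto_intros)
  moreover have "- inverse (L n / s n) = s n / - L n" for n by simp
  ultimately show ?thesis by (simp add: inverse_eq_divide)
qed

context expanding_system
begin

text \<open>By the homothety property, \<open>ln\<close> of the derivative along an orbit is the sum
  of the \<open>ln\<close> of the degrees plus a difference of two values of
  \<open>ln \<circ> T\<close>. These stay bounded, as \<open>T\<close> is continuous and positive on
  the compact projection of the skew Julia set.\<close>

lemma level_set_nonempty_iff_if_power_maps:
  assumes \<phi>: "\<phi> \<in> Aut_sphere" and p: "\<And>i. power_map (a i) (rat_degree (f i)) (\<phi> \<circ> f i \<circ> inv \<phi>)"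
    and b: "\<And>i. ln (real (rat_degree (f i))) = b * c i" and i0: "rat_degree (f i0) \<ge> 2"
    and ne: "julia_skew f \<noteq> {}"
  shows "level_set f \<psi> \<alpha> \<noteq> {} \<longleftrightarrow> \<alpha> = - 1 / b"
proof -
  note A = Aut_sphereD[OF \<phi>]
  let ?d = "\<lambda>i. rat_degree (f i)"
  have a0: "a i \<noteq> 0" for i
    by (rule power_map_nonzero[OF Rat_compose(1)[OF Rat_compose(1)[OF A(1) fRat] A(2)] p])
  have b0: "b < 0"
  proof -
    have "ln (real (?d i0)) > 0" using i0 by simp
    then have "b * c i0 > 0" by (simp only: b)
    then show ?thesis using cneg[of i0] by (simp add: zero_less_mult_iff)
  qed
  \<comment> \<open>Degree 1 would give \<open>ln 1 = 0\<close>, but \<open>b * c i\<close> is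
    positive.\<close>
  have d2: "?d i \<ge> 2" for i
  proof -
    have "ln (real (?d i)) > 0" using b[of i] b0 cneg[of i] by (simp add: mult_neg_neg)
    then have "real (?d i) > 1" by (cases "?d i = 0") auto
    then show ?thesis by simp
  qed
  have d1: "?d i \<ge> 1" for i using d2[of i] by simp
  \<comment> \<open>Up to a constant, \<open>1 / T\<close> is the density of the metric
    \<open>|du| / |u|\<close>, pulled back by \<open>\<phi>\<close>, relative to the spherical
    metric.\<close>
  define T where "T x = cyl (\<phi> x) / sph_deriv_norm \<phi> x" for x
  have Dphi: "sph_deriv_norm \<phi> x > 0" for x
    using A(7) sph_deriv_norm_nonneg[of \<phi> x] by (simp add: less_le)
  have step: "sph_deriv_norm (f i) x * T x = real (?d i) * T (f i x)" for i x
  proof -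
    let ?h = "\<phi> \<circ> f i \<circ> inv \<phi>"
    have "sph_deriv_norm ?h (\<phi> x) * cyl (\<phi> x) = real (?d i) * cyl (\<phi> (f i x))"
      using deriv_power_map_cyl[OF p a0 d1, of i "\<phi> x"] by (simp add: A(3))
    moreover have "sph_deriv_norm ?h (\<phi> x) = sph_deriv_norm \<phi> (f i x) * sph_deriv_norm (f i) x / sph_deriv_norm \<phi> x"
      using deriv_conj[OF \<phi> fRat, of i x] Dphi[of x] by (simp add: field_simps)
    ultimately show ?thesis
      using Dphi[of x] Dphi[of "f i x"] by (simp add: T_def field_simps)
  qed
  have steps: "sph_deriv_norm (word_comp f \<omega> n) x * T x = (\<Prod>k<n. real (?d (\<omega> k))) * T (word_comp f \<omega> n x)" for \<omega> n x
  proof (induction n)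
    case (Suc n)
    let ?y = "word_comp f \<omega> n x"
    have "sph_deriv_norm (word_comp f \<omega> (Suc n)) x * T x =
        sph_deriv_norm (f (\<omega> n)) ?y * (sph_deriv_norm (word_comp f \<omega> n) x * T x)"
      by (simp only: word_comp_deriv[where f = f, OF fRat] prod.lessThan_Suc mult_ac)
    also have "\<dots> = (\<Prod>k<n. real (?d (\<omega> k))) * (sph_deriv_norm (f (\<omega> n)) ?y * T ?y)"
      unfolding Suc by simp
    also have "\<dots> = (\<Prod>k<Suc n. real (?d (\<omega> k))) * T (word_comp f \<omega> (Suc n) x)"
      unfolding step by simp
    finally show ?case .
  qed (simp add: sph_deriv_norm_id[unfolded id_def])
  define Y where "Y = snd ` julia_skew f"
  have "isCont T x" for x
    unfolding T_def[abs_def]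
    by (rule isCont_divide[OF isCont_o2[OF Rat_isCont[OF A(1)] isCont_cyl] isCont_sph_deriv_norm[OF A(1)] A(7)])
  then have "continuous_on Y T" by (simp add: continuous_at_imp_continuous_on)
  moreover have "compact Y" unfolding Y_def by (rule compact_julia_skew_snd)
  moreover have "Y \<noteq> {}" using ne by (simp add: Y_def)
  ultimately obtain y1 y2 where y: "y1 \<in> Y" "\<And>x. x \<in> Y \<Longrightarrow> T y1 \<le> T x" "\<And>x. x \<in> Y \<Longrightarrow> T x \<le> T y2"
    using continuous_attains_inf[of Y T] continuous_attains_sup[of Y T] by blast
  \<comment> \<open>\<open>T\<close> vanishes only where \<open>\<phi>\<close> takes the value 0 or
    \<open>Infty\<close>. These are the critical points of every \<open>f i\<close>, and expansion
    keeps the Julia set away from them.\<close>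
  have Tpos: "T x > 0" if "x \<in> Y" for x
  proof -
    obtain \<omega> where w: "(\<omega>, x) \<in> julia_skew f" using \<open>x \<in> Y\<close> by (auto simp: Y_def)
    have "sph_deriv_norm (f (\<omega> 0)) x > 0" using deriv_pos[OF w, of 1] by (simp add: o_def)
    then have "x \<notin> crit (f (\<omega> 0))" by (simp add: crit_def)
    then have "\<phi> x \<notin> {Fin 0, Infty}"
      unfolding crit_conj_power(1)[OF \<phi> fRat p a0 d2] using A(3)[of x] by auto
    then have "cyl (\<phi> x) > 0" using cyl_nonneg[of "\<phi> x"] cyl_eq_0_iff[of "\<phi> x"] by (simp add: less_le)
    then show ?thesis using Dphi[of x] by (simp add: T_def)
  qed
  have lim: "quotient \<omega> x \<longlonglongrightarrow> - 1 / b" if w: "(\<omega>, x) \<in> julia_skew f" for \<omega> x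
    unfolding quotient_def[abs_def]
  proof (rule quotient_tendsto_if_bounded_difference)
    have orb: "word_comp f \<omega> n x \<in> Y" for n
      using julia_skew_forward[where n = n, OF fRat w] by (force simp: Y_def skew_product_iterate)
    have x: "x \<in> Y" using orb[of 0] by simp
    show "\<bar>ln (sph_deriv_norm (word_comp f \<omega> n) x) - b * (\<Sum>k<n. c (\<omega> k))\<bar> \<le> ln (T y2) - ln (T y1)" for n
    proof -
      let ?D = "sph_deriv_norm (word_comp f \<omega> n) x" and ?y = "word_comp f \<omega> n x"
      have pp: "(\<Prod>k<n. real (?d (\<omega> k))) > 0" using d1 by (intro prod_pos) (simp add: Suc_le_eq)
      have lnm: "ln (u * v) = ln u + ln v" if "u > 0" "v > 0" for u v :: real
        using that by (simp add: ln_mult)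
      have "ln ?D + ln (T x) = ln (?D * T x)" by (rule lnm[OF deriv_pos[OF w] Tpos[OF x], symmetric])
      also have "\<dots> = ln (\<Prod>k<n. real (?d (\<omega> k))) + ln (T ?y)"
        unfolding steps by (rule lnm[OF pp Tpos[OF orb]])
      also have "ln (\<Prod>k<n. real (?d (\<omega> k))) = b * (\<Sum>k<n. c (\<omega> k))"
      proof -
        have "ln (\<Prod>k<n. real (?d (\<omega> k))) = (\<Sum>k<n. ln (real (?d (\<omega> k))))"
          using d1 by (intro ln_prod) (auto simp: Suc_le_eq)
        then show ?thesis by (simp add: b sum_distrib_left)
      qed
      finally have eq: "ln ?D - b * (\<Sum>k<n. c (\<omega> k)) = ln (T ?y) - ln (T x)" by simp
      have "ln (T y1) \<le> ln (T z) \<and> ln (T z) \<le> ln (T y2)" if "z \<in> Y" for z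
        using y Tpos[OF that] Tpos[OF y(1)] that by (simp add: less_le_trans)
      from this[OF orb[of n]] this[OF x] eq show ?thesis by linarith
    qed
    define \<delta> where "\<delta> = Min (range (\<lambda>i. - c i))"
    show "\<delta> > 0" unfolding \<delta>_def using cneg by (subst Min_gr_iff) auto
    have "- c i \<ge> \<delta>" for i unfolding \<delta>_def by (intro Min_le) auto
    then have "(\<Sum>k<n. c (\<omega> k)) \<le> (\<Sum>k<n. - \<delta>)" for n by (intro sum_mono) (simp add: minus_le_iff le_minus_iff)
    then show "(\<Sum>k<n. c (\<omega> k)) \<le> - real n * \<delta>" for n by simp
  qed (use b0 in simp)
  show ?thesis
  proof
    assume "level_set f \<psi> \<alpha> \<noteq> {}"
    then obtain \<omega> x where "(\<omega>, x) \<in> julia_skew f" "quotient \<omega> x \<longlonglongrightarrow> \<alpha>"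
      unfolding level_set_nonempty_iff by blast
    then show "\<alpha> = - 1 / b" using lim LIMSEQ_unique by metis
  next
    assume "\<alpha> = - 1 / b"
    then show "level_set f \<psi> \<alpha> \<noteq> {}" unfolding level_set_nonempty_iff using lim ne by fastforce
  qed
qed

end

theorem proposition1p4:
  fixes f :: "'i::finite \<Rightarrow> riemann_sphere \<Rightarrow> riemann_sphere"
    and c :: "'i \<Rightarrow> real"
    and \<psi> :: "'i \<Rightarrow> riemann_sphere \<Rightarrow> real"
  assumes "multi_map f"
    and "expanding f"
    and "\<exists>i0. rat_degree (f i0) \<ge> 2"
    and "\<And>i. c i < 0"
    and "\<And>i z. z \<in> f i -` julia (semigroup_gen f) \<Longrightarrow> \<psi> i z = c i"
  shows "alpha_minus f \<psi> = alpha_plus f \<psi> \<longleftrightarrow>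
    (\<exists>\<phi>\<in>Aut_sphere. \<exists>(a :: 'i \<Rightarrow> complex) (l :: real). \<forall>i.
       (\<phi> \<circ> f i \<circ> inv \<phi> = ratmap (monom (a i) (rat_degree (f i))) 1 \<or>
        \<phi> \<circ> f i \<circ> inv \<phi> = ratmap [:a i:] (monom 1 (rat_degree (f i)))) \<and>
       ln (real (rat_degree (f i))) = l * c i)"
proof -
  have fRat: "f i \<in> Rat" for i using assms(1) by (simp add: multi_map_def)
  from assms(2) obtain C l where Cl: "C > 0" "l > 1" and ne: "julia_skew f \<noteq> {}"
    and ex: "\<And>n \<omega> z. n \<ge> 1 \<Longrightarrow> (\<omega>, z) \<in> julia_skew f \<Longrightarrow> sph_deriv_norm (word_comp f \<omega> n) z \<ge> C * l ^ n"
    unfolding expanding_def by fast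
  interpret expanding_system f c \<psi> C l
    by (intro expanding_system.intro fRat Cl ex assms(4,5))
  obtain i0 where i0: "rat_degree (f i0) \<ge> 2" using assms(3) by blast
  let ?A = "{\<alpha>. level_set f \<psi> \<alpha> \<noteq> {}}"
  show ?thesis
  proof
    assume eq: "alpha_minus f \<psi> = alpha_plus f \<psi>"
    then have "Inf (ereal ` ?A) = Sup (ereal ` ?A)" by (simp add: alpha_minus_def alpha_plus_def)
    moreover have "Inf (ereal ` ?A) \<le> ereal \<alpha>" "ereal \<alpha> \<le> Sup (ereal ` ?A)" if "\<alpha> \<in> ?A" for \<alpha>
      using that by (auto intro: Inf_lower Sup_upper)
    ultimately have "ereal \<alpha> = Sup (ereal ` ?A)" if "\<alpha> \<in> ?A" for \<alpha>
      using that by (metis antisym)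
    \<comment> \<open>Infimum and supremum squeeze every level to the same extended real, whose real
      part serves as the common value \<alpha>0.\<close>
    from this[THEN arg_cong[where f = real_of_ereal]]
    have "\<alpha> = real_of_ereal (Sup (ereal ` ?A))" if "level_set f \<psi> \<alpha> \<noteq> {}" for \<alpha>
      using that by simp
    from common_conjugation_if_unique_level[OF this i0]
    show "\<exists>\<phi>\<in>Aut_sphere. \<exists>(a :: 'i \<Rightarrow> complex) (l :: real). \<forall>i.
       (\<phi> \<circ> f i \<circ> inv \<phi> = ratmap (monom (a i) (rat_degree (f i))) 1 \<or>
        \<phi> \<circ> f i \<circ> inv \<phi> = ratmap [:a i:] (monom 1 (rat_degree (f i)))) \<and>
       ln (real (rat_degree (f i))) = l * c i"
      unfolding power_map_def .
  next
    assume "\<exists>\<phi>\<in>Aut_sphere. \<exists>(a :: 'i \<Rightarrow> complex) (l :: real). \<forall>i.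
       (\<phi> \<circ> f i \<circ> inv \<phi> = ratmap (monom (a i) (rat_degree (f i))) 1 \<or>
        \<phi> \<circ> f i \<circ> inv \<phi> = ratmap [:a i:] (monom 1 (rat_degree (f i)))) \<and>
       ln (real (rat_degree (f i))) = l * c i"
    then obtain \<phi> and a :: "'i \<Rightarrow> complex" and b :: real where \<phi>: "\<phi> \<in> Aut_sphere"
      and p: "\<forall>i. power_map (a i) (rat_degree (f i)) (\<phi> \<circ> f i \<circ> inv \<phi>) \<and> ln (real (rat_degree (f i))) = b * c i"
      unfolding power_map_def[symmetric] by blast
    from level_set_nonempty_iff_if_power_maps[OF \<phi> p[rule_format, THEN conjunct1] p[rule_format, THEN conjunct2] i0 ne]
    have "?A = {- 1 / b}" by auto
    then show "alpha_minus f \<psi> = alpha_plus f \<psi>" by (simp add: alpha_minus_def alpha_plus_def)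
  qed
qed

end
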